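(* Let $\{\omega_t^s\}$ be produced by Algorithm 1 (described in the context) with $R=\mathrm{Exp}$ (exponential map) and $\mathcal T=\Gamma$ (parallel translation), with option 2 (output $\omega_a$ drawn uniformly at random from $\{\omega_t^s:0\le t\le m-1,\ 1\le s\le S\}$). Assume: (i) $f$ and each $f_i$ are continuously differentiable; (ii) all iterates stay in a compact neighbourhood $\Omega$ of $\omega^*$; there is $\rho>0$ such that for every $\omega\in\Omega$, with $B(0_\omega,\rho)\subset T_\omega\mathcal M$ the ball of radius $\rho$ centred at $0_\omega$, $R_\omega$ is a diffeomorphism on $B(0_\omega,\rho)$ and $\Omega\subset R_\omega(B(0_\omega,\rho))$; and $R_{\omega_t^s}(-\tau\alpha_t^sV_t^s)\in\Omega$ for all $t\ge0$, $s\ge1$, $\tau\in[0,1]$; (iii) $\mathcal T$ is continuous and isometric: $\langle\mathcal T_\eta\xi,\mathcal T_\eta\zeta\rangle=\langle\xi,\zeta\rangle$ for all $\eta,\xi,\zeta\in T_\omega\mathcal M$, $\omega\in\mathcal M$; (iv) there is $M>0$ with $\frac1n\sum_{i=1}^n\|\mathrm{grad}f_i(x)-\Gamma_y^x\mathrm{grad}f_i(y)\|^2\le M^2\|\xi\|^2$ for all $x,y=R_x(\xi)\in\Omega$; (v) there is $\theta>0$ with $\|\Gamma_x^y\eta-\mathcal T_x^y\eta\|\le\theta\|\xi\|\|\eta\|$ for all $x,y=R_x(\xi)\in\Omega$, $\eta\in T_x\mathcal M$; (vi) there is $L>0$ with $f(y)\le f(x)+\langle\mathrm{grad}f(x),\xi\rangle+\frac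 L2\|\xi\|^2$ for all $x,y=R_x(\xi)\in\Omega$; (vii) there are $C_1,C_2>0$ and $\delta_{C_1,C_2}>0$ such that for all $x,y=R_x(\xi)\in\Omega$ with $\|\xi\|\le\delta_{C_1,C_2}$: $\|\xi\|\le C_1d(x,y)$ and $d(x,y)\le C_2\|\xi\|$. Let $N>0$ satisfy $\|\mathrm{grad}f_i(\omega)\|\le N$ for all $\omega\in\Omega$ and all $i$. Let $\alpha_t^s\equiv C_\alpha$, $\phi_t^s=\phi^s$ and $\psi_t^s=\psi^s$ (independent of $t$) with $C_\alpha\le\frac{2}{L+\sqrt{L^2+4\nu}}$, where $\nu=4m^3M^2$, and $\sum_{s=1}^\infty\big((1-\phi^s)^2+(\psi^s)^2\big)<\infty$. Then $$\mathbb E[\|\mathrm{grad}f(\omega_a)\|^2]\le\frac{2}{mSC_\alpha}\big(f(\tilde\omega^0)-f(\omega^* )\big)+\frac{4mN^2}{S}\sum_{s=1}^\infty\big((1-\phi^s)^2+(\psi^s)^2\big)=\mathcal O\Big(\frac1S\Big).$$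
   Context: $\mathcal M$ is a smooth Riemannian manifold with metric $\langle\cdot,\cdot\rangle$, induced norm $\|\cdot\|$ on tangent spaces, and Riemannian distance $d$. $f_1,\dots,f_n:\mathcal M\to\mathbb R$ and $f=\frac1n\sum_{i=1}^n f_i$; $\mathrm{grad}$ is the Riemannian gradient; $\omega^*$ is a global minimizer of $f$. $R_\omega=\mathrm{Exp}_\omega:T_\omega\mathcal M\to\mathcal M$ is the exponential map. $\Gamma_x^y:T_x\mathcal M\to T_y\mathcal M$ is the parallel translation along the geodesic (exponential mapping) linking $x$ and $y$; $\mathcal T=\Gamma$, and $\mathcal T_\omega^{R_\omega(\eta)}=\mathcal T_\eta$ for $\eta\in T_\omega\mathcal M$. Algorithm 1 (R-SHG with adaptive parameters). Input: step sizes $\alpha_t^s>0$, an integer $m\ge1$, a constant $0<\mu<1$, parameters $\phi_t^s,\psi_t^s\ge0$ with $\phi_t^s+\psi_t^s\le1$, and an initial point $\tilde\omega^0$. For $s=1,2,\dots,S$: set $\omega_0^s=\tilde\omega^{s-1}$, $V_0^s=\mathrm{grad}f(\omega_0^s)$, $\omega_1^s=R_{\omega_0^s}(-\alpha_0^sV_0^s)$. For $t=1,\dots,m-1$: choose an index set $I_t^s\subset\{1,\dots,n\}$ of given cardinality $b$ uniformly at random (independently of the past) and write $\mathrm{grad}f_{I_t^s}=\frac1{|I_t^s|}\sum_{i\in I_t^s}\mathrm{grad}f_i$; let $D_t^s=\langle\mathcal T_{\omega_{t-1}^s}^{\omega_t^s}(V_{t-1}^s-\mathrm{grad}f(\omega_{t-1}^s)),\mathrm{grad}f(\omega_t^s)\rangle$;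 put $\tilde\psi_t^s=\min\{\psi_t^s,\ \mu\|\mathrm{grad}f(\omega_t^s)\|^2/|D_t^s|\}$ if $D_t^s\ne0$ and $\tilde\psi_t^s=\psi_t^s$ otherwise; set $$V_t^s=\phi_t^s\big(\mathrm{grad}f_{I_t^s}(\omega_t^s)-\mathcal T_{\omega_0^s}^{\omega_t^s}(\mathrm{grad}f_{I_t^s}(\omega_0^s)-\mathrm{grad}f(\omega_0^s))\big)+\tilde\psi_t^s\big(\mathrm{grad}f_{I_t^s}(\omega_t^s)-\mathcal T_{\omega_{t-1}^s}^{\omega_t^s}(\mathrm{grad}f_{I_t^s}(\omega_{t-1}^s)-V_{t-1}^s)\big)+(1-\phi_t^s-\tilde\psi_t^s)\mathrm{grad}f_{I_t^s}(\omega_t^s)$$ and $\omega_{t+1}^s=R_{\omega_t^s}(-\alpha_t^sV_t^s)$. Then $\tilde\omega^s=\omega_m^s$. The $\mathcal O$ is as $S\to\infty$ with all other quantities fixed. *)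

theory Defs
  imports "HOL-Probability.Probability" "HOL-Library.Landau_Symbols"
begin

section \<open>Smooth manifolds and tangent vectors\<close>

text \<open>
  For maps between Euclidean spaces on an open set: being \<open>k\<close> times continuously differentiable,
  expressed through directional derivatives.
\<close>

primrec Ck_on :: "nat \<Rightarrow> 'a::euclidean_space set \<Rightarrow> ('a \<Rightarrow> 'b::real_normed_vector) \<Rightarrow> bool" where
  "Ck_on 0 S f \<longleftrightarrow> continuous_on S f"
| "Ck_on (Suc k) S f \<longleftrightarrow>
     (\<forall>x\<in>S. f differentiable (at x)) \<and> (\<forall>v. Ck_on k S (\<lambda>x. frechet_derivative f (at x) v))"

definition smooth_on :: "'a::euclidean_space set \<Rightarrow> ('a \<Rightarrow> 'b::real_normed_vector) \<Rightarrow> bool" where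
  "smooth_on S f \<longleftrightarrow> (\<forall>k. Ck_on k S f)"

text \<open>
  The manifold is the whole type \<open>'m\<close>. A chart is a pair of its domain and its coordinate map; the
  values of the coordinate map outside the domain are irrelevant.
\<close>

type_synonym ('m, 'e) chart = "'m set \<times> ('m \<Rightarrow> 'e)"

definition chart_inv :: "('m, 'e) chart \<Rightarrow> 'e \<Rightarrow> 'm" where
  "chart_inv c = inv_into (fst c) (snd c)"

definition smooth_atlas ::
    "('m::{t2_space,second_countable_topology}, 'e::euclidean_space) chart set \<Rightarrow> bool" where
  "smooth_atlas A \<longleftrightarrow>
     (\<forall>c\<in>A. open (fst c) \<and> open (snd c ` fst c) \<and>
            homeomorphism (fst c) (snd c ` fst c) (snd c) (chart_inv c)) \<and>
     (\<Union>c\<in>A. fst c) = UNIV \<and>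
     (\<forall>c\<in>A. \<forall>d\<in>A. smooth_on (snd c ` (fst c \<inter> fst d)) (snd d \<circ> chart_inv c))"

text \<open>
  One preferred chart is selected at every point \<open>p\<close>. A tangent vector at \<open>p\<close> is represented by its
  coordinate vector in the preferred chart at \<open>p\<close>, so every tangent space is carried by the type
  \<open>'e\<close>. The map \<open>to_coord A c p\<close> sends a tangent vector at \<open>p\<close> to its coordinate vector in the
  chart \<open>c\<close>, and \<open>of_coord A c p\<close> is the inverse map. All constructions below are stated in arbitrary
  charts through these maps.
\<close>

definition chart_at :: "('m, 'e) chart set \<Rightarrow> 'm \<Rightarrow> ('m, 'e) chart" where
  "chart_at A p = (SOME c. c \<in> A \<and> p \<in> fst c)"

definition to_coord :: "('m, 'e::euclidean_space) chart set \<Rightarrow> ('m, 'e) chart \<Rightarrow> 'm \<Rightarrow> 'e \<Rightarrow> 'e" where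
  "to_coord A c p v =
     frechet_derivative (snd c \<circ> chart_inv (chart_at A p)) (at (snd (chart_at A p) p)) v"

definition of_coord :: "('m, 'e::euclidean_space) chart set \<Rightarrow> ('m, 'e) chart \<Rightarrow> 'm \<Rightarrow> 'e \<Rightarrow> 'e" where
  "of_coord A c p u =
     frechet_derivative (snd (chart_at A p) \<circ> chart_inv c) (at (snd c p)) u"

definition C1_function :: "('m, 'e::euclidean_space) chart set \<Rightarrow> ('m \<Rightarrow> real) \<Rightarrow> bool" where
  "C1_function A f \<longleftrightarrow> (\<forall>c\<in>A. Ck_on 1 (snd c ` fst c) (f \<circ> chart_inv c))"

definition differential :: "('m, 'e::euclidean_space) chart set \<Rightarrow> ('m \<Rightarrow> real) \<Rightarrow> 'm \<Rightarrow> 'e \<Rightarrow> real" where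
  "differential A f p v =
     frechet_derivative (f \<circ> chart_inv (chart_at A p)) (at (snd (chart_at A p) p)) v"

text \<open>
  Derivative of a curve parametrised by \<open>{0..1}\<close>, one-sided at the two end points.
\<close>

definition velocity :: "('m, 'e::euclidean_space) chart set \<Rightarrow> (real \<Rightarrow> 'm) \<Rightarrow> real \<Rightarrow> 'e" where
  "velocity A \<gamma> t = vector_derivative (snd (chart_at A (\<gamma> t)) \<circ> \<gamma>) (at t within {0..1})"


section \<open>Riemannian metrics\<close>

text \<open>
  \<open>gram A g c x\<close> is the metric in the coordinates of the chart \<open>c\<close>, at the coordinate point \<open>x\<close>.
\<close>

definition gram ::
    "('m, 'e::euclidean_space) chart set \<Rightarrow> ('m \<Rightarrow> 'e \<Rightarrow> 'e \<Rightarrow> real) \<Rightarrow> ('m, 'e) chart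
      \<Rightarrow> 'e \<Rightarrow> 'e \<Rightarrow> 'e \<Rightarrow> real" where
  "gram A g c x u v =
     (let p = chart_inv c x in g p (of_coord A c p u) (of_coord A c p v))"

definition riemannian_metric ::
    "('m, 'e::euclidean_space) chart set \<Rightarrow> ('m \<Rightarrow> 'e \<Rightarrow> 'e \<Rightarrow> real) \<Rightarrow> bool" where
  "riemannian_metric A g \<longleftrightarrow>
     (\<forall>p. bilinear (g p) \<and> (\<forall>u v. g p u v = g p v u) \<and> (\<forall>v. v \<noteq> 0 \<longrightarrow> g p v v > 0)) \<and>
     (\<forall>c\<in>A. \<forall>u v. smooth_on (snd c ` fst c) (\<lambda>x. gram A g c x u v))"

definition riemannian_manifold ::
    "('m::{t2_space,second_countable_topology}, 'e::euclidean_space) chart set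
      \<Rightarrow> ('m \<Rightarrow> 'e \<Rightarrow> 'e \<Rightarrow> real) \<Rightarrow> bool" where
  "riemannian_manifold A g \<longleftrightarrow> smooth_atlas A \<and> riemannian_metric A g"

definition tnorm :: "('m \<Rightarrow> 'e \<Rightarrow> 'e \<Rightarrow> real) \<Rightarrow> 'm \<Rightarrow> 'e \<Rightarrow> real" where
  "tnorm g p v = sqrt (g p v v)"

definition tball :: "('m \<Rightarrow> 'e \<Rightarrow> 'e \<Rightarrow> real) \<Rightarrow> 'm \<Rightarrow> real \<Rightarrow> 'e set" where
  "tball g p r = {v. tnorm g p v < r}"

definition grad ::
    "('m, 'e::euclidean_space) chart set \<Rightarrow> ('m \<Rightarrow> 'e \<Rightarrow> 'e \<Rightarrow> real) \<Rightarrow> ('m \<Rightarrow> real) \<Rightarrow> 'm \<Rightarrow> 'e" where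
  "grad A g f p = (THE u. \<forall>v. g p u v = differential A f p v)"

definition C1_curve_on ::
    "('m::topological_space, 'e::euclidean_space) chart set \<Rightarrow> real \<Rightarrow> real \<Rightarrow> (real \<Rightarrow> 'm) \<Rightarrow> bool" where
  "C1_curve_on A a b \<gamma> \<longleftrightarrow>
     continuous_on {a..b} \<gamma> \<and>
     (\<forall>c\<in>A. \<exists>D. continuous_on {t\<in>{a..b}. \<gamma> t \<in> fst c} D \<and>
        (\<forall>t\<in>{a..b}. \<gamma> t \<in> fst c \<longrightarrow>
           ((snd c \<circ> \<gamma>) has_vector_derivative D t) (at t within {a..b})))"

definition piecewise_C1_curve ::
    "('m::topological_space, 'e::euclidean_space) chart set \<Rightarrow> (real \<Rightarrow> 'm) \<Rightarrow> bool" where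
  "piecewise_C1_curve A \<gamma> \<longleftrightarrow>
     continuous_on {0..1} \<gamma> \<and>
     (\<exists>K. finite K \<and> {0, 1} \<subseteq> K \<and> K \<subseteq> {0..1} \<and>
        (\<forall>a\<in>K. \<forall>b\<in>K. a < b \<and> K \<inter> {a<..<b} = {} \<longrightarrow> C1_curve_on A a b \<gamma>))"

definition curve_length ::
    "('m, 'e::euclidean_space) chart set \<Rightarrow> ('m \<Rightarrow> 'e \<Rightarrow> 'e \<Rightarrow> real) \<Rightarrow> (real \<Rightarrow> 'm) \<Rightarrow> real" where
  "curve_length A g \<gamma> = integral {0..1} (\<lambda>t. tnorm g (\<gamma> t) (velocity A \<gamma> t))"

text \<open>
  For points in different connected components the infimum ranges over the empty set and the value
  of \<open>rdist\<close> carries no meaning; it is only used below for points joined by a geodesic.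
\<close>

definition rdist ::
    "('m::topological_space, 'e::euclidean_space) chart set \<Rightarrow> ('m \<Rightarrow> 'e \<Rightarrow> 'e \<Rightarrow> real)
      \<Rightarrow> 'm \<Rightarrow> 'm \<Rightarrow> real" where
  "rdist A g x y =
     Inf {curve_length A g \<gamma> | \<gamma>. piecewise_C1_curve A \<gamma> \<and> \<gamma> 0 = x \<and> \<gamma> 1 = y}"


section \<open>Levi-Civita connection, exponential map and parallel translation\<close>

text \<open>
  In the coordinates of \<open>c\<close> the Levi-Civita connection is
  \<open>\<nabla>\<^sub>u v = D v u + christoffel A g c x u v\<close>. The bilinear map \<open>christoffel A g c x\<close>
  collects the Christoffel symbols, determined by
  \<open>2 G (\<Gamma>(u,v), w) = D\<^sub>u G(v,w) + D\<^sub>v G(u,w) - D\<^sub>w G(u,v)\<close> for the metric \<open>G\<close> in coordinates.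
\<close>

definition christoffel ::
    "('m, 'e::euclidean_space) chart set \<Rightarrow> ('m \<Rightarrow> 'e \<Rightarrow> 'e \<Rightarrow> real) \<Rightarrow> ('m, 'e) chart
      \<Rightarrow> 'e \<Rightarrow> 'e \<Rightarrow> 'e \<Rightarrow> 'e" where
  "christoffel A g c x u v =
     (THE z. \<forall>w. 2 * gram A g c x z w =
        frechet_derivative (\<lambda>y. gram A g c y v w) (at x) u
        + frechet_derivative (\<lambda>y. gram A g c y u w) (at x) v
        - frechet_derivative (\<lambda>y. gram A g c y u v) (at x) w)"

text \<open>
  The vector field \<open>X\<close> along the curve \<open>\<gamma>\<close> (both on \<open>{0..1}\<close>, with \<open>X t\<close> tangent at \<open>\<gamma> t\<close>) is parallel:
  in every chart, its covariant derivative along \<open>\<gamma>\<close> vanishes.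
\<close>

definition parallel_along ::
    "('m::topological_space, 'e::euclidean_space) chart set \<Rightarrow> ('m \<Rightarrow> 'e \<Rightarrow> 'e \<Rightarrow> real)
      \<Rightarrow> (real \<Rightarrow> 'm) \<Rightarrow> (real \<Rightarrow> 'e) \<Rightarrow> bool" where
  "parallel_along A g \<gamma> X \<longleftrightarrow>
     (\<forall>c\<in>A. \<forall>t\<in>{0..1}. \<gamma> t \<in> fst c \<longrightarrow>
        (snd c \<circ> \<gamma>) differentiable (at t within {0..1}) \<and>
        ((\<lambda>\<tau>. to_coord A c (\<gamma> \<tau>) (X \<tau>)) has_vector_derivative
           - christoffel A g c (snd c (\<gamma> t))
               (vector_derivative (snd c \<circ> \<gamma>) (at t within {0..1}))
               (to_coord A c (\<gamma> t) (X t))) (at t within {0..1}))"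

definition geodesic_from ::
    "('m::topological_space, 'e::euclidean_space) chart set \<Rightarrow> ('m \<Rightarrow> 'e \<Rightarrow> 'e \<Rightarrow> real)
      \<Rightarrow> 'm \<Rightarrow> 'e \<Rightarrow> (real \<Rightarrow> 'm) \<Rightarrow> bool" where
  "geodesic_from A g p v \<gamma> \<longleftrightarrow>
     continuous_on {0..1} \<gamma> \<and> parallel_along A g \<gamma> (velocity A \<gamma>) \<and>
     \<gamma> 0 = p \<and> velocity A \<gamma> 0 = v"

text \<open>
  \<open>exp_dom A g p\<close> is the maximal domain of the exponential map at \<open>p\<close>. It is the whole tangent space
  for geodesically complete manifolds.
\<close>

definition exp_dom ::
    "('m::topological_space, 'e::euclidean_space) chart set \<Rightarrow> ('m \<Rightarrow> 'e \<Rightarrow> 'e \<Rightarrow> real)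
      \<Rightarrow> 'm \<Rightarrow> 'e set" where
  "exp_dom A g p = {v. \<exists>\<gamma>. geodesic_from A g p v \<gamma>}"

definition exp_map ::
    "('m::topological_space, 'e::euclidean_space) chart set \<Rightarrow> ('m \<Rightarrow> 'e \<Rightarrow> 'e \<Rightarrow> real)
      \<Rightarrow> 'm \<Rightarrow> 'e \<Rightarrow> 'm" where
  "exp_map A g p v = (THE q. \<exists>\<gamma>. geodesic_from A g p v \<gamma> \<and> \<gamma> 1 = q)"

text \<open>
  Parallel translation of the tangent vector \<open>\<xi>\<close> at \<open>p\<close> along the geodesic with initial velocity
  \<open>\<eta>\<close>; the result is a tangent vector at \<open>exp_map A g p \<eta>\<close>.
\<close>

definition par_transport ::
    "('m::topological_space, 'e::euclidean_space) chart set \<Rightarrow> ('m \<Rightarrow> 'e \<Rightarrow> 'e \<Rightarrow> real)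
      \<Rightarrow> 'm \<Rightarrow> 'e \<Rightarrow> 'e \<Rightarrow> 'e" where
  "par_transport A g p \<eta> \<xi> =
     (THE \<zeta>. \<exists>\<gamma> X. geodesic_from A g p \<eta> \<gamma> \<and> parallel_along A g \<gamma> X \<and> X 0 = \<xi> \<and> X 1 = \<zeta>)"

text \<open>
  Parallel translation from \<open>x\<close> to \<open>y\<close> along the geodesic linking them, where the geodesic is
  the one selected by inverting the exponential map at \<open>x\<close> on the ball of radius \<open>\<rho>\<close>.
\<close>

definition exp_inv ::
    "('m::topological_space, 'e::euclidean_space) chart set \<Rightarrow> ('m \<Rightarrow> 'e \<Rightarrow> 'e \<Rightarrow> real)
      \<Rightarrow> real \<Rightarrow> 'm \<Rightarrow> 'm \<Rightarrow> 'e" where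
  "exp_inv A g \<rho> x y = inv_into (tball g x \<rho>) (exp_map A g x) y"

definition par_transport_between ::
    "('m::topological_space, 'e::euclidean_space) chart set \<Rightarrow> ('m \<Rightarrow> 'e \<Rightarrow> 'e \<Rightarrow> real)
      \<Rightarrow> real \<Rightarrow> 'm \<Rightarrow> 'm \<Rightarrow> 'e \<Rightarrow> 'e" where
  "par_transport_between A g \<rho> x y \<xi> = par_transport A g x (exp_inv A g \<rho> x y) \<xi>"

text \<open>
  A map \<open>F\<close> from an open subset \<open>B\<close> of a tangent space to the manifold is a diffeomorphism onto its
  (open) image.
\<close>

definition diffeomorphism_on ::
    "('m::topological_space, 'e::euclidean_space) chart set \<Rightarrow> 'e set \<Rightarrow> ('e \<Rightarrow> 'm) \<Rightarrow> bool" where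
  "diffeomorphism_on A B F \<longleftrightarrow>
     inj_on F B \<and> continuous_on B F \<and> open (F ` B) \<and>
     (\<forall>c\<in>A. smooth_on {v\<in>B. F v \<in> fst c} (snd c \<circ> F) \<and>
            smooth_on (snd c ` (fst c \<inter> F ` B)) (inv_into B F \<circ> chart_inv c))"

text \<open>
  Continuity, with respect to the topology of the tangent bundle, of a vector transport \<open>T\<close> over
  the retraction \<open>R\<close>, where \<open>D p\<close> is the domain of \<open>R p\<close>: the foot point \<open>R p \<eta>\<close> and the
  coordinates of \<open>T p \<eta> \<xi>\<close> depend continuously on the coordinates of \<open>p\<close>, \<open>\<eta>\<close> and \<open>\<xi>\<close>.
\<close>

definition continuous_transport ::
    "('m::topological_space, 'e::euclidean_space) chart set \<Rightarrow> ('m \<Rightarrow> 'e set)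
      \<Rightarrow> ('m \<Rightarrow> 'e \<Rightarrow> 'm) \<Rightarrow> ('m \<Rightarrow> 'e \<Rightarrow> 'e \<Rightarrow> 'e) \<Rightarrow> bool" where
  "continuous_transport A D R T \<longleftrightarrow>
     (\<forall>c\<in>A.
        continuous_on {(x, u). x \<in> snd c ` fst c \<and> of_coord A c (chart_inv c x) u \<in> D (chart_inv c x)}
          (\<lambda>(x, u). R (chart_inv c x) (of_coord A c (chart_inv c x) u)) \<and>
        (\<forall>d\<in>A.
           continuous_on
             {(x, u, v). x \<in> snd c ` fst c \<and> of_coord A c (chart_inv c x) u \<in> D (chart_inv c x) \<and>
                R (chart_inv c x) (of_coord A c (chart_inv c x) u) \<in> fst d}
             (\<lambda>(x, u, v). to_coord A d (R (chart_inv c x) (of_coord A c (chart_inv c x) u))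
                (T (chart_inv c x) (of_coord A c (chart_inv c x) u) (of_coord A c (chart_inv c x) v)))))"


section \<open>The stochastic hybrid gradient method with adaptive parameters\<close>

definition average :: "nat \<Rightarrow> (nat \<Rightarrow> 'm \<Rightarrow> real) \<Rightarrow> 'm \<Rightarrow> real" where
  "average n f p = (\<Sum>i\<in>{1..n}. f i p) / real n"

definition batch_grad ::
    "('m, 'e::euclidean_space) chart set \<Rightarrow> ('m \<Rightarrow> 'e \<Rightarrow> 'e \<Rightarrow> real) \<Rightarrow> (nat \<Rightarrow> 'm \<Rightarrow> real)
      \<Rightarrow> nat set \<Rightarrow> 'm \<Rightarrow> 'e" where
  "batch_grad A g f J p = (1 / real (card J)) *\<^sub>R (\<Sum>i\<in>J. grad A g (f i) p)"

definition batches :: "nat \<Rightarrow> nat \<Rightarrow> nat set set" where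
  "batches n b = {J. J \<subseteq> {1..n} \<and> card J = b}"

text \<open>
  In the following functions \<open>g\<close> is the metric, \<open>R\<close> the retraction, \<open>T x y\<close> the transport of tangent
  vectors from \<open>x\<close> to \<open>y\<close>, \<open>G\<close> the full gradient field and \<open>H J\<close> the gradient field for the batch
  \<open>J\<close>. The direction at the point \<open>q\<close> is computed from the first point \<open>p\<^sub>0\<close> of the epoch and from the
  preceding point \<open>p\<close> with its direction \<open>V\<close>.
\<close>

definition adaptive_weight ::
    "('m \<Rightarrow> 'e \<Rightarrow> 'e \<Rightarrow> real) \<Rightarrow> ('m \<Rightarrow> 'm \<Rightarrow> 'e \<Rightarrow> 'e) \<Rightarrow> ('m \<Rightarrow> 'e::real_vector)
      \<Rightarrow> real \<Rightarrow> real \<Rightarrow> 'm \<Rightarrow> 'e \<Rightarrow> 'm \<Rightarrow> real" where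
  "adaptive_weight g T G \<mu> \<psi> p V q =
     (let D = g q (T p q (V - G p)) (G q)
      in if D \<noteq> 0 then min \<psi> (\<mu> * (tnorm g q (G q))\<^sup>2 / \<bar>D\<bar>) else \<psi>)"

definition rshg_direction ::
    "('m \<Rightarrow> 'e \<Rightarrow> 'e \<Rightarrow> real) \<Rightarrow> ('m \<Rightarrow> 'm \<Rightarrow> 'e \<Rightarrow> 'e) \<Rightarrow> ('m \<Rightarrow> 'e::real_vector)
      \<Rightarrow> (nat set \<Rightarrow> 'm \<Rightarrow> 'e) \<Rightarrow> real \<Rightarrow> real \<Rightarrow> real \<Rightarrow> nat set
      \<Rightarrow> 'm \<Rightarrow> 'm \<Rightarrow> 'e \<Rightarrow> 'm \<Rightarrow> 'e" where
  "rshg_direction g T G H \<mu> \<phi> \<psi> J p\<^sub>0 p V q =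
     (let \<psi>' = adaptive_weight g T G \<mu> \<psi> p V q
      in \<phi> *\<^sub>R (H J q - T p\<^sub>0 q (H J p\<^sub>0 - G p\<^sub>0))
         + \<psi>' *\<^sub>R (H J q - T p q (H J p - V))
         + (1 - \<phi> - \<psi>') *\<^sub>R H J q)"

text \<open>
  The \<open>t\<close>-th point of an epoch together with the direction computed there.
\<close>

primrec rshg_epoch ::
    "('m \<Rightarrow> 'e \<Rightarrow> 'e \<Rightarrow> real) \<Rightarrow> ('m \<Rightarrow> 'e \<Rightarrow> 'm) \<Rightarrow> ('m \<Rightarrow> 'm \<Rightarrow> 'e \<Rightarrow> 'e) \<Rightarrow> ('m \<Rightarrow> 'e::real_vector)
      \<Rightarrow> (nat set \<Rightarrow> 'm \<Rightarrow> 'e) \<Rightarrow> real \<Rightarrow> (nat \<Rightarrow> real) \<Rightarrow> (nat \<Rightarrow> real) \<Rightarrow> (nat \<Rightarrow> real)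
      \<Rightarrow> (nat \<Rightarrow> nat set) \<Rightarrow> 'm \<Rightarrow> nat \<Rightarrow> 'm \<times> 'e" where
  "rshg_epoch g R T G H \<mu> \<alpha> \<phi> \<psi> J p\<^sub>0 0 = (p\<^sub>0, G p\<^sub>0)"
| "rshg_epoch g R T G H \<mu> \<alpha> \<phi> \<psi> J p\<^sub>0 (Suc t) =
     (let (p, V) = rshg_epoch g R T G H \<mu> \<alpha> \<phi> \<psi> J p\<^sub>0 t;
          q = R p (- \<alpha> t *\<^sub>R V)
      in (q, rshg_direction g T G H \<mu> (\<phi> (Suc t)) (\<psi> (Suc t)) (J (Suc t)) p\<^sub>0 p V q))"

text \<open>
  The starting point of epoch \<open>Suc s\<close>, that is, the output of the first \<open>s\<close> epochs. Parameters and
  batches are indexed by the epoch and then by the inner step.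
\<close>

primrec rshg_outer ::
    "('m \<Rightarrow> 'e \<Rightarrow> 'e \<Rightarrow> real) \<Rightarrow> ('m \<Rightarrow> 'e \<Rightarrow> 'm) \<Rightarrow> ('m \<Rightarrow> 'm \<Rightarrow> 'e \<Rightarrow> 'e) \<Rightarrow> ('m \<Rightarrow> 'e::real_vector)
      \<Rightarrow> (nat set \<Rightarrow> 'm \<Rightarrow> 'e) \<Rightarrow> nat \<Rightarrow> real \<Rightarrow> (nat \<Rightarrow> nat \<Rightarrow> real) \<Rightarrow> (nat \<Rightarrow> nat \<Rightarrow> real)
      \<Rightarrow> (nat \<Rightarrow> nat \<Rightarrow> real) \<Rightarrow> (nat \<Rightarrow> nat \<Rightarrow> nat set) \<Rightarrow> 'm \<Rightarrow> nat \<Rightarrow> 'm" where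
  "rshg_outer g R T G H m \<mu> \<alpha> \<phi> \<psi> I p 0 = p"
| "rshg_outer g R T G H m \<mu> \<alpha> \<phi> \<psi> I p (Suc s) =
     fst (rshg_epoch g R T G H \<mu> (\<alpha> (Suc s)) (\<phi> (Suc s)) (\<psi> (Suc s)) (I (Suc s))
            (rshg_outer g R T G H m \<mu> \<alpha> \<phi> \<psi> I p s) m)"

text \<open>
  The pair of the \<open>t\<close>-th point and direction in epoch \<open>s\<close>, for \<open>1 \<le> s\<close>.
\<close>

definition rshg ::
    "('m \<Rightarrow> 'e \<Rightarrow> 'e \<Rightarrow> real) \<Rightarrow> ('m \<Rightarrow> 'e \<Rightarrow> 'm) \<Rightarrow> ('m \<Rightarrow> 'm \<Rightarrow> 'e \<Rightarrow> 'e) \<Rightarrow> ('m \<Rightarrow> 'e::real_vector)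
      \<Rightarrow> (nat set \<Rightarrow> 'm \<Rightarrow> 'e) \<Rightarrow> nat \<Rightarrow> real \<Rightarrow> (nat \<Rightarrow> nat \<Rightarrow> real) \<Rightarrow> (nat \<Rightarrow> nat \<Rightarrow> real)
      \<Rightarrow> (nat \<Rightarrow> nat \<Rightarrow> real) \<Rightarrow> (nat \<Rightarrow> nat \<Rightarrow> nat set) \<Rightarrow> 'm \<Rightarrow> nat \<Rightarrow> nat \<Rightarrow> 'm \<times> 'e" where
  "rshg g R T G H m \<mu> \<alpha> \<phi> \<psi> I p s t =
     rshg_epoch g R T G H \<mu> (\<alpha> s) (\<phi> s) (\<psi> s) (I s)
       (rshg_outer g R T G H m \<mu> \<alpha> \<phi> \<psi> I p (s - 1)) t"

text \<open>
  \<open>X\<close> is uniformly distributed on the finite set \<open>K\<close>.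
\<close>

definition uniform_rv :: "'w measure \<Rightarrow> 'a set \<Rightarrow> ('w \<Rightarrow> 'a) \<Rightarrow> bool" where
  "uniform_rv P K X \<longleftrightarrow>
     X \<in> measurable P (count_space K) \<and> distr P (count_space K) X = uniform_count_measure K"

definition rv_events :: "'w measure \<Rightarrow> ('w \<Rightarrow> 'a) \<Rightarrow> 'w set set" where
  "rv_events P X = {X -` B \<inter> space P | B. True}"

text \<open>
  For each number \<open>S\<close> of epochs, \<open>a S\<close> is the index pair (epoch, inner step) of the random output.
  The batches and this index pair are uniformly distributed and mutually independent (events
  indexed by \<open>None\<close> are those of the output index).
\<close>

definition rshg_randomness ::
    "'w measure \<Rightarrow> nat \<Rightarrow> nat \<Rightarrow> nat \<Rightarrow> (nat \<Rightarrow> nat \<Rightarrow> 'w \<Rightarrow> nat set) \<Rightarrow> (nat \<Rightarrow> 'w \<Rightarrow> nat \<times> nat) \<Rightarrow> bool" where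
  "rshg_randomness P n b m I a \<longleftrightarrow>
     prob_space P \<and>
     (\<forall>s\<ge>1. \<forall>t\<in>{1..<m}. uniform_rv P (batches n b) (I s t)) \<and>
     (\<forall>S\<ge>1. uniform_rv P ({1..S} \<times> {0..<m}) (a S)) \<and>
     (\<forall>S\<ge>1. prob_space.indep_sets P
        (\<lambda>j. case j of None \<Rightarrow> rv_events P (a S) | Some (s, t) \<Rightarrow> rv_events P (I s t))
        (insert None (Some ` ({1..} \<times> {1..<m}))))"

end

theory Submission
  imports Defs
begin

text \<open>
  Write \<open>e\<^sub>t = V\<^sub>t - grad f(\<omega>\<^sub>t)\<close>. Given the past, \<open>e\<^sub>t\<close> is a mean-zero fluctuation of the fresh batch plus the
  transported error \<open>\<T> e\<^bsub>t-1\<^esub>\<close> weighted by the adaptive parameter, so \<open>E \<parallel>e\<^sub>t\<parallel>\<^sup>2\<close> accumulates only additively.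
  The fluctuation splits into a variance-reduced part, which (iv) bounds by \<open>M\<^sup>2 \<parallel>\<xi>\<parallel>\<^sup>2\<close> with
  \<open>\<xi> = Exp\<^sup>-\<^sup>1(\<omega>\<^sub>0)\<close> taken at \<open>\<omega>\<^sub>t\<close>, and two parts with the small weights \<open>1 - \<phi>\<close> and \<open>\<psi>\<close>, bounded by \<open>N\<^sup>2\<close>.
  The vector \<open>\<xi>\<close> is no longer than the broken geodesic \<open>\<omega>\<^sub>0, \<dots>, \<omega>\<^sub>t\<close>: by the Gauss lemma a geodesic
  inside a normal ball changes the distance to the centre by at most its length. Hence the sum of the errors over an
  epoch is at most \<open>\<nu> C\<alpha>\<^sup>2 \<Sum> E \<parallel>V\<^sub>t\<parallel>\<^sup>2\<close> plus the stated noise, and the step size restriction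
  lets the descent inequality (vi) absorb the first term.
\<close>

section \<open>Calculus of smooth maps\<close>

text \<open>Hypothesis (iv) measures the gap between two points by the vector \<xi> with y = Exp_x
  \<xi>, and the lengths of inverse exponentials obey no evident triangle inequality; this calls for
  the Gauss lemma. The centre is the current point because (iv) is read in its tangent space.
  \<open>exp_map\<close> and \<open>par_transport\<close> are definite descriptions: the former
  becomes usable once geodesics are shown to be unique, the latter is handled through isometry,
  which already forces linearity. The weight of the transported error is a function of the past,
  hence fixed while the fresh batch is averaged, and at most \<psi> \<le> 1; centring removes the
  cross term, so the old error enters with factor at most one. The 3 of three squares, a factor m
  from Cauchy-Schwarz along the path, one from the accumulation of errors and one from their sum
  give \<open>3 m^3 M^2\<close>, within \<nu>; without the path the same count gives
  \<open>3 m^2 N^2\<close> for the noise. The step size restriction amounts to \<nu> c^2 + L c \<le>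
  1. A run up to a given step depends on finitely many batches, so conditioning on the past is a
  finite sum and no measurability on the manifold has to be discussed.\<close>

lemma smooth_on_differentiable: "smooth_on S f \<Longrightarrow> x \<in> S \<Longrightarrow> f differentiable (at x)"
  unfolding smooth_on_def by (drule spec[of _ "Suc 0"]) simp

lemma smooth_on_frechet_derivative:
  "smooth_on S f \<Longrightarrow> smooth_on S (\<lambda>x. frechet_derivative f (at x) v)"
  unfolding smooth_on_def using Ck_on.simps(2) by blast

lemma smooth_on_continuous: "smooth_on S f \<Longrightarrow> continuous_on S f"
  unfolding smooth_on_def by (drule spec[of _ "0"]) simp

lemma smooth_on_has_derivative:
  "smooth_on S f \<Longrightarrow> x \<in> S \<Longrightarrow> (f has_derivative frechet_derivative f (at x)) (at x)"
  using smooth_on_differentiable frechet_derivative_works by blast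

text \<open>The mean value theorem in direction v turns the second difference into t times a
  difference of \<open>D x v\<close> at two points near z; differentiability of \<open>D x v\<close>
  at z alone identifies that difference as \<open>t * A w\<close> up to o(t).\<close>

lemma second_difference_bound:
  fixes \<phi> :: "'a::real_normed_vector \<Rightarrow> real"
  assumes "open U" "z \<in> U" and D: "\<And>x. x \<in> U \<Longrightarrow> (\<phi> has_derivative D x) (at x)"
    and A: "((\<lambda>x. D x v) has_derivative A) (at z)" and "e > 0"
  shows "\<forall>\<^sub>F t in at_right 0.
    \<bar>\<phi> (z + t *\<^sub>R v + t *\<^sub>R w) - \<phi> (z + t *\<^sub>R v) - \<phi> (z + t *\<^sub>R w) + \<phi> z - t\<^sup>2 * A w\<bar> \<le> e * t\<^sup>2"
proof -
  define n where "n = norm v + norm w + 1"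
  have n: "n > 0" unfolding n_def by (simp add: add_nonneg_pos)
  obtain r where r: "r > 0" "ball z r \<subseteq> U" using assms(1,2) open_contains_ball by blast
  \<comment> \<open>Two points of evaluation contribute e' t n each, and the mean value theorem a
    further factor t: together e t^2.\<close>
  define e' where "e' = e / (2 * n)"
  have e': "e' > 0" using n \<open>e > 0\<close> by (simp add: e'_def)
  obtain d where d: "d > 0" "\<And>y. norm (y - z) < d \<Longrightarrow> \<bar>D y v - D z v - A (y - z)\<bar> \<le> e' * norm (y - z)"
    using A e' unfolding has_derivative_at_alt by (auto simp: real_norm_def)
  have linA: "linear A" using A has_derivative_linear by blast
  define t0 where "t0 = min d r / n"
  have t0: "t0 > 0" using d r n by (simp add: t0_def)
  have "\<bar>\<phi> (z + t *\<^sub>R v + t *\<^sub>R w) - \<phi> (z + t *\<^sub>R v) - \<phi> (z + t *\<^sub>R w) + \<phi> z - t\<^sup>2 * A w\<bar> \<le> e * t\<^sup>2"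
    if t: "0 < t" "t < t0" for t
  proof -
    have tn: "t * n < min d r" using t n by (simp add: t0_def field_simps)
    have nb: "norm (s *\<^sub>R v + k *\<^sub>R w) \<le> t * n" if "0 \<le> s" "s \<le> t" "0 \<le> k" "k \<le> t" for s k
    proof -
      have "norm (s *\<^sub>R v + k *\<^sub>R w) \<le> s * norm v + k * norm w"
        using norm_triangle_ineq[of "s *\<^sub>R v" "k *\<^sub>R w"] that by simp
      also have "\<dots> \<le> t * norm v + t * norm w" using that by (intro add_mono mult_right_mono) auto
      also have "\<dots> \<le> t * n" using t by (simp add: n_def algebra_simps)
      finally show ?thesis .
    qed
    have inU: "z + (s *\<^sub>R v + k *\<^sub>R w) \<in> U" if "0 \<le> s" "s \<le> t" "0 \<le> k" "k \<le> t" for s k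
    proof -
      have "dist (z + (s *\<^sub>R v + k *\<^sub>R w)) z < r"
        using nb[OF that] tn unfolding dist_norm add_diff_cancel_left' by linarith
      then show ?thesis using r(2) by (auto simp: dist_commute)
    qed
    define h where "h s = \<phi> (z + s *\<^sub>R v + t *\<^sub>R w) - \<phi> (z + s *\<^sub>R v)" for s
    have "DERIV h s :> D (z + s *\<^sub>R v + t *\<^sub>R w) v - D (z + s *\<^sub>R v) v" if s: "0 \<le> s" "s \<le> t" for s
    proof -
      have in1: "z + s *\<^sub>R v + t *\<^sub>R w \<in> U" using inU[of s t] s t by (simp add: add.assoc)
      have in2: "z + s *\<^sub>R v \<in> U" using inU[of s 0] s t by simp
      have "((\<lambda>s. \<phi> (z + s *\<^sub>R v + t *\<^sub>R w)) has_derivative (\<lambda>h. D (z + s *\<^sub>R v + t *\<^sub>R w) (h *\<^sub>R v))) (at s)"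
        by (rule has_derivative_compose[where f="\<lambda>s. z + s *\<^sub>R v + t *\<^sub>R w" and g=\<phi>, OF _ D[OF in1]]) (auto intro!: derivative_eq_intros)
      moreover have "((\<lambda>s. \<phi> (z + s *\<^sub>R v)) has_derivative (\<lambda>h. D (z + s *\<^sub>R v) (h *\<^sub>R v))) (at s)"
        by (rule has_derivative_compose[where f="\<lambda>s. z + s *\<^sub>R v" and g=\<phi>, OF _ D[OF in2]]) (auto intro!: derivative_eq_intros)
      ultimately have "(h has_derivative (\<lambda>h. D (z + s *\<^sub>R v + t *\<^sub>R w) (h *\<^sub>R v) - D (z + s *\<^sub>R v) (h *\<^sub>R v))) (at s)"
        unfolding h_def by (rule has_derivative_diff)
      moreover have "linear (D (z + s *\<^sub>R v + t *\<^sub>R w))" "linear (D (z + s *\<^sub>R v))"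
        using D[OF in1] D[OF in2] has_derivative_linear by blast+
      ultimately show ?thesis
        by (auto intro: has_derivative_imp_has_field_derivative simp: linear_scale right_diff_distrib)
    qed
    then obtain s where s: "0 < s" "s < t"
      and hs: "h t - h 0 = (t - 0) * (D (z + s *\<^sub>R v + t *\<^sub>R w) v - D (z + s *\<^sub>R v) v)"
      using MVT2[of 0 t h "\<lambda>s. D (z + s *\<^sub>R v + t *\<^sub>R w) v - D (z + s *\<^sub>R v) v"] t by auto
    have 1: "\<bar>D (z + s *\<^sub>R v + t *\<^sub>R w) v - D z v - A (s *\<^sub>R v + t *\<^sub>R w)\<bar> \<le> e' * (t * n)"
    proof -
      have "norm (s *\<^sub>R v + t *\<^sub>R w) \<le> t * n" using nb[of s t] s t by simp
      then show ?thesis using d(2)[of "z + s *\<^sub>R v + t *\<^sub>R w"] tn e'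
        by (smt (verit) add.assoc add_diff_cancel_left' mult_left_mono)
    qed
    have 2: "\<bar>D (z + s *\<^sub>R v) v - D z v - A (s *\<^sub>R v)\<bar> \<le> e' * (t * n)"
    proof -
      have "norm (s *\<^sub>R v) \<le> t * n" using nb[of s 0] s t by simp
      then show ?thesis using d(2)[of "z + s *\<^sub>R v"] tn e'
        by (smt (verit) add_diff_cancel_left' mult_left_mono)
    qed
    have "A (s *\<^sub>R v + t *\<^sub>R w) - A (s *\<^sub>R v) = t * A w"
      using linA by (simp add: linear_add linear_scale)
    with 1 2 have "\<bar>(D (z + s *\<^sub>R v + t *\<^sub>R w) v - D (z + s *\<^sub>R v) v) - t * A w\<bar> \<le> 2 * e' * (t * n)" by linarith
    then have "t * \<bar>(D (z + s *\<^sub>R v + t *\<^sub>R w) v - D (z + s *\<^sub>R v) v) - t * A w\<bar> \<le> t * (2 * e' * (t * n))"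
      using t by (intro mult_left_mono) auto
    also have "t * (2 * e' * (t * n)) = e * t\<^sup>2" using n by (simp add: e'_def power2_eq_square field_simps)
    also have "t * \<bar>(D (z + s *\<^sub>R v + t *\<^sub>R w) v - D (z + s *\<^sub>R v) v) - t * A w\<bar> = \<bar>h t - h 0 - t\<^sup>2 * A w\<bar>"
    proof -
      have "h t - h 0 - t\<^sup>2 * A w = t * ((D (z + s *\<^sub>R v + t *\<^sub>R w) v - D (z + s *\<^sub>R v) v) - t * A w)"
        by (simp only: hs power2_eq_square right_diff_distrib mult.assoc diff_zero)
      then show ?thesis using t by (simp only: abs_mult abs_of_pos)
    qed
    finally show ?thesis by (simp add: h_def algebra_simps)
  qed
  then show ?thesis using t0 by (auto simp: eventually_at_right_field)
qed

text \<open>The second difference is symmetric in v and w, so its two leading terms must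
  agree.\<close>

lemma second_derivative_symmetric_real:
  fixes \<phi> :: "'a::real_normed_vector \<Rightarrow> real"
  assumes U: "open U" "z \<in> U" and D: "\<And>x. x \<in> U \<Longrightarrow> (\<phi> has_derivative D x) (at x)"
    and A: "((\<lambda>x. D x v) has_derivative A) (at z)" and B: "((\<lambda>x. D x w) has_derivative B) (at z)"
  shows "A w = B v"
proof (rule ccontr)
  assume ne: "A w \<noteq> B v"
  \<comment> \<open>A third of the gap: the two estimates permit a discrepancy of 2 e t^2, while it
    equals 3 e t^2.\<close>
  define e where "e = \<bar>A w - B v\<bar> / 3"
  have e: "e > 0" using ne by (simp add: e_def)
  have "\<forall>\<^sub>F t in at_right 0.
    \<bar>\<phi> (z + t *\<^sub>R v + t *\<^sub>R w) - \<phi> (z + t *\<^sub>R v) - \<phi> (z + t *\<^sub>R w) + \<phi> z - t\<^sup>2 * A w\<bar> \<le> e * t\<^sup>2"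
    by (rule second_difference_bound[OF U D A e])
  moreover have "\<forall>\<^sub>F t in at_right 0.
    \<bar>\<phi> (z + t *\<^sub>R w + t *\<^sub>R v) - \<phi> (z + t *\<^sub>R w) - \<phi> (z + t *\<^sub>R v) + \<phi> z - t\<^sup>2 * B v\<bar> \<le> e * t\<^sup>2"
    by (rule second_difference_bound[OF U D B e])
  moreover have "\<forall>\<^sub>F t::real in at_right 0. 0 < t" by (rule eventually_at_right_less)
  ultimately have "\<forall>\<^sub>F t::real in at_right 0. False"
  proof eventually_elim
    case (elim t)
    have c: "z + t *\<^sub>R w + t *\<^sub>R v = z + t *\<^sub>R v + t *\<^sub>R w" by simp
    have "\<bar>t\<^sup>2 * A w - t\<^sup>2 * B v\<bar> \<le> 2 * (e * t\<^sup>2)" using elim(1,2) unfolding c by linarith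
    moreover have "\<bar>t\<^sup>2 * A w - t\<^sup>2 * B v\<bar> = t\<^sup>2 * (3 * e)"
      by (simp add: e_def abs_mult flip: right_diff_distrib)
    moreover have "t\<^sup>2 * e > 0" using elim(3) e by simp
    ultimately show ?case by (simp add: algebra_simps)
  qed
  then show False by (simp add: trivial_limit_at_right_real)
qed

lemma second_derivative_symmetric:
  fixes \<phi> :: "'a::real_normed_vector \<Rightarrow> 'b::euclidean_space"
  assumes U: "open U" "z \<in> U" and D: "\<And>x. x \<in> U \<Longrightarrow> (\<phi> has_derivative D x) (at x)"
    and A: "((\<lambda>x. D x v) has_derivative A) (at z)" and B: "((\<lambda>x. D x w) has_derivative B) (at z)"
  shows "A w = B v"
proof (rule euclidean_eqI)
  fix b :: 'b
  show "A w \<bullet> b = B v \<bullet> b"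
    by (rule second_derivative_symmetric_real[OF U, where \<phi>="\<lambda>x. \<phi> x \<bullet> b" and D="\<lambda>x h. D x h \<bullet> b"
          and A="\<lambda>h. A h \<bullet> b" and B="\<lambda>h. B h \<bullet> b"])
       (auto intro!: has_derivative_inner_left D A B)
qed

lemma smooth_on_second_derivative_symmetric:
  fixes \<phi> :: "'a::euclidean_space \<Rightarrow> 'b::euclidean_space"
  assumes "open U" "z \<in> U" "smooth_on U \<phi>"
  shows "frechet_derivative (\<lambda>x. frechet_derivative \<phi> (at x) v) (at z) w =
         frechet_derivative (\<lambda>x. frechet_derivative \<phi> (at x) w) (at z) v"
  by (rule second_derivative_symmetric[OF assms(1,2), where \<phi>=\<phi>])
     (auto intro!: smooth_on_has_derivative assms smooth_on_frechet_derivative)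

text \<open>The zero t0 may lie anywhere in the interval: exp(-C t) D is nonincreasing to its right
  and exp(C t) D nondecreasing to its left, and D is nonnegative. It is applied to the squared
  distance of two geodesics in phase space.\<close>

lemma gronwall_zero:
  fixes D :: "real \<Rightarrow> real"
  assumes D: "\<And>t. t \<in> {a..b} \<Longrightarrow> (D has_real_derivative D' t) (at t within {a..b})"
    and bound: "\<And>t. t \<in> {a..b} \<Longrightarrow> \<bar>D' t\<bar> \<le> C * D t"
    and nonneg: "\<And>t. t \<in> {a..b} \<Longrightarrow> 0 \<le> D t"
    and t0: "t0 \<in> {a..b}" "D t0 = 0" and t: "t \<in> {a..b}"
  shows "D t = 0"
proof -
  have at: "(D has_real_derivative D' t) (at t)" if "a < t" "t < b" for t
    using D[of t] at_within_interior[of t "{a..b}"] that by simp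
  have cont: "continuous_on {a..b} D"
    using D by (meson DERIV_continuous continuous_on_eq_continuous_within)
  have dE: "((\<lambda>t. exp (k * t) * D t) has_real_derivative exp (k * t) * (k * D t + D' t)) (at t)"
    if "a < t" "t < b" for t k
    by (rule derivative_eq_intros at[OF that] refl | simp add: algebra_simps)+
  show ?thesis
  proof (cases "t0 \<le> t")
    case True
    have "exp (- C * t) * D t \<le> exp (- C * t0) * D t0"
    proof (rule DERIV_nonpos_imp_decreasing_open[OF True])
      fix x assume "t0 < x" "x < t"
      then have x: "a < x" "x < b" using t0 t by auto
      show "\<exists>y. ((\<lambda>t. exp (- C * t) * D t) has_real_derivative y) (at x) \<and> y \<le> 0"
        using dE[OF x, of "- C"] bound[of x] x
        by (intro exI[of _ "exp (- C * x) * (- C * D x + D' x)"]) (auto intro!: mult_nonneg_nonpos)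
      next
        show "continuous_on {t0..t} (\<lambda>t. exp (- C * t) * D t)"
          using t0 t by (intro continuous_intros continuous_on_subset[OF cont]) auto
    qed
    then show ?thesis using t0 nonneg[OF t]
      by (smt (verit) exp_gt_zero mult_eq_0_iff mult_pos_pos)
  next
    case False
    have "exp (C * t) * D t \<le> exp (C * t0) * D t0"
    proof (rule DERIV_nonneg_imp_increasing_open[of t t0])
      fix x assume "t < x" "x < t0"
      then have x: "a < x" "x < b" using t0 t by auto
      show "\<exists>y. ((\<lambda>t. exp (C * t) * D t) has_real_derivative y) (at x) \<and> 0 \<le> y"
        using dE[OF x, of "C"] bound[of x] x
        by (intro exI[of _ "exp (C * x) * (C * D x + D' x)"]) (auto intro!: mult_nonneg_nonneg)
      next
        show "continuous_on {t..t0} (\<lambda>t. exp (C * t) * D t)"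
          using t0 t by (intro continuous_intros continuous_on_subset[OF cont]) auto
    qed (use False in simp)
    then show ?thesis using t0 nonneg[OF t]
      by (smt (verit) exp_gt_zero mult_eq_0_iff mult_pos_pos)
  qed
qed

text \<open>The square root is not differentiable where f vanishes, which happens when a curve meets
  the centre of a normal ball; hence the estimate for f + e with e > 0, followed by the limit e to
  0.\<close>

lemma sqrt_increment_bound:
  fixes f :: "real \<Rightarrow> real"
  assumes f: "\<And>t. t \<in> {0..1} \<Longrightarrow> (f has_real_derivative f' t) (at t within {0..1})"
    and nonneg: "\<And>t. t \<in> {0..1} \<Longrightarrow> 0 \<le> f t"
    and bound: "\<And>t. t \<in> {0..1} \<Longrightarrow> \<bar>f' t\<bar> \<le> 2 * sqrt (f t) * l" and l: "0 \<le> l"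
  shows "\<bar>sqrt (f 1) - sqrt (f 0)\<bar> \<le> l"
proof -
  have ineq: "\<bar>sqrt (f 1 + e) - sqrt (f 0 + e)\<bar> \<le> l" if e: "e > 0" for e
  proof -
    define h where "h t = sqrt (f t + e)" for t
    have h: "(h has_real_derivative (f' t / (2 * sqrt (f t + e)))) (at t within {0..1})" if t: "t \<in> {0..1}" for t
      unfolding h_def using nonneg[OF t] e
      by (auto intro!: derivative_eq_intros f[OF t] simp: field_simps)
    have "\<bar>f' t / (2 * sqrt (f t + e))\<bar> \<le> l" if t: "t \<in> {0..1}" for t
    proof -
      have "\<bar>f' t\<bar> \<le> 2 * sqrt (f t) * l" by (rule bound[OF t])
      also have "\<dots> \<le> 2 * sqrt (f t + e) * l" using e l by (intro mult_right_mono mult_left_mono) auto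
      finally show ?thesis using nonneg[OF t] e by (simp add: abs_mult field_simps)
    qed
    then have "norm (h 1 - h 0) \<le> l * norm (1 - 0 :: real)"
      by (intro field_differentiable_bound[of "{0..1}" h]) (use h in auto)
    then show ?thesis by (simp add: h_def)
  qed
  have "((\<lambda>e. \<bar>sqrt (f 1 + e) - sqrt (f 0 + e)\<bar>) \<longlongrightarrow> \<bar>sqrt (f 1 + 0) - sqrt (f 0 + 0)\<bar>) (at_right 0)"
    by (intro tendsto_intros)
  then have "\<bar>sqrt (f 1 + 0) - sqrt (f 0 + 0)\<bar> \<le> l"
    by (rule tendsto_upperbound) (auto simp: eventually_at_right_field intro!: exI[of _ 1] ineq)
  then show ?thesis by simp
qed

section \<open>Metrics in coordinates\<close>

lemma linear_bound_Basis:
  fixes l :: "'e::euclidean_space \<Rightarrow> real"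
  assumes "linear l" "\<And>b. b \<in> Basis \<Longrightarrow> \<bar>l b\<bar> \<le> K"
  shows "\<bar>l u\<bar> \<le> real DIM('e) * K * norm u"
proof -
  have "l u = (\<Sum>b\<in>Basis. (u \<bullet> b) * l b)"
    by (subst euclidean_representation[of u, symmetric], subst linear_sum[OF assms(1)])
      (simp add: linear_scale[OF assms(1)])
  also have "\<bar>\<dots>\<bar> \<le> (\<Sum>b\<in>(Basis::'e set). norm u * K)"
    by (rule order_trans[OF sum_abs], rule sum_mono)
      (auto simp: abs_mult intro!: mult_mono assms(2) Basis_le_norm)
  finally show ?thesis by (simp add: algebra_simps)
qed

lemma bilinear_bound_Basis:
  fixes B :: "'e::euclidean_space \<Rightarrow> 'e \<Rightarrow> real"
  assumes "\<And>v. linear (\<lambda>u. B u v)" "\<And>u. linear (B u)"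
    and "\<And>i j. i \<in> Basis \<Longrightarrow> j \<in> Basis \<Longrightarrow> \<bar>B i j\<bar> \<le> K"
  shows "\<bar>B u v\<bar> \<le> real DIM('e) ^ 2 * K * norm u * norm v"
proof -
  have "\<bar>B i v\<bar> \<le> real DIM('e) * K * norm v" if "i \<in> Basis" for i
    using that assms by (intro linear_bound_Basis) auto
  then have "\<bar>B u v\<bar> \<le> real DIM('e) * (real DIM('e) * K * norm v) * norm u"
    using assms by (intro linear_bound_Basis) auto
  then show ?thesis by (simp add: power2_eq_square algebra_simps)
qed

lemma trilinear_bound_Basis:
  fixes B :: "'e::euclidean_space \<Rightarrow> 'e \<Rightarrow> 'e \<Rightarrow> real"
  assumes "\<And>v w. linear (\<lambda>u. B u v w)" "\<And>u w. linear (\<lambda>v. B u v w)" "\<And>u v. linear (B u v)"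
    and "\<And>i j k. i \<in> Basis \<Longrightarrow> j \<in> Basis \<Longrightarrow> k \<in> Basis \<Longrightarrow> \<bar>B i j k\<bar> \<le> K"
  shows "\<bar>B u v w\<bar> \<le> real DIM('e) ^ 3 * K * norm u * norm v * norm w"
proof -
  have "\<bar>B i v w\<bar> \<le> real DIM('e)^2 * K * norm v * norm w" if "i \<in> Basis" for i
    using that assms by (intro bilinear_bound_Basis) auto
  then have "\<bar>B u v w\<bar> \<le> real DIM('e) * (real DIM('e)^2 * K * norm v * norm w) * norm u"
    using assms by (intro linear_bound_Basis) auto
  then show ?thesis by (simp add: power2_eq_square power3_eq_cube algebra_simps)
qed

lemma finite_uniform_bound:
  fixes P :: "'a \<Rightarrow> real \<Rightarrow> bool"
  assumes "finite A" "\<And>a. a \<in> A \<Longrightarrow> \<exists>K. P a K" "\<And>a K K'. P a K \<Longrightarrow> K \<le> K' \<Longrightarrow> P a K'"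
  obtains K where "K \<ge> 0" "\<And>a. a \<in> A \<Longrightarrow> P a K"
proof -
  obtain k where k: "\<And>a. a \<in> A \<Longrightarrow> P a (k a)" using assms(2) by metis
  show ?thesis
  proof (rule that)
    show "(\<Sum>a\<in>A. \<bar>k a\<bar>) \<ge> 0" by (simp add: sum_nonneg)
    fix a assume "a \<in> A"
    then have "k a \<le> (\<Sum>a\<in>A. \<bar>k a\<bar>)"
      using member_le_sum[of a A "\<lambda>a. \<bar>k a\<bar>"] assms(1) by force
    then show "P a (\<Sum>a\<in>A. \<bar>k a\<bar>)" using k[OF \<open>a \<in> A\<close>] assms(3) by blast
  qed
qed

text \<open>Both bounds share one K and are monotone in it, so that
  \<open>finite_uniform_bound\<close> can merge them over all basis indices. The Lipschitz part
  rests on the convexity of the ball.\<close>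

lemma smooth_on_lipschitz_bound:
  fixes f :: "'e::euclidean_space \<Rightarrow> real"
  assumes "smooth_on S f" "cball x0 r \<subseteq> S"
  shows "\<exists>K. \<forall>x\<in>cball x0 r. \<bar>f x\<bar> \<le> K \<and> (\<forall>y\<in>cball x0 r. \<bar>f x - f y\<bar> \<le> K * norm (x - y))"
proof -
  have "continuous_on (cball x0 r) f"
    using assms smooth_on_continuous continuous_on_subset by blast
  then have "bounded (f ` cball x0 r)" using compact_continuous_image compact_imp_bounded compact_cball by blast
  then obtain K1 where K1: "\<And>x. x \<in> cball x0 r \<Longrightarrow> \<bar>f x\<bar> \<le> K1" unfolding bounded_iff by (metis imageI real_norm_def)
  have ex: "\<exists>K. \<forall>x\<in>cball x0 r. \<bar>frechet_derivative f (at x) b\<bar> \<le> K" for b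
  proof -
    have "continuous_on (cball x0 r) (\<lambda>x. frechet_derivative f (at x) b)"
      using assms smooth_on_continuous smooth_on_frechet_derivative continuous_on_subset by blast
    then have "bounded ((\<lambda>x. frechet_derivative f (at x) b) ` cball x0 r)"
      using compact_continuous_image compact_imp_bounded compact_cball by blast
    then show ?thesis by (auto simp: bounded_iff)
  qed
  obtain K where K: "K \<ge> 0"
    "\<And>b. b \<in> Basis \<Longrightarrow> \<forall>x\<in>cball x0 r. \<bar>frechet_derivative f (at x) b\<bar> \<le> K"
  proof (rule finite_uniform_bound[of "Basis::'e set" "\<lambda>b K. \<forall>x\<in>cball x0 r. \<bar>frechet_derivative f (at x) b\<bar> \<le> K"])
    fix a :: 'e and K K' :: real
    assume "\<forall>x\<in>cball x0 r. \<bar>frechet_derivative f (at x) a\<bar> \<le> K" "K \<le> K'"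
    then show "\<forall>x\<in>cball x0 r. \<bar>frechet_derivative f (at x) a\<bar> \<le> K'" by force
  qed (rule finite_Basis, rule ex, blast)
  define K2 where "K2 = real DIM('e) * K"
  have der: "(f has_derivative frechet_derivative f (at x)) (at x within cball x0 r)" if "x \<in> cball x0 r" for x
    by (rule has_derivative_at_withinI[OF smooth_on_has_derivative[OF assms(1) subsetD[OF assms(2) that]]])
  have on: "onorm (frechet_derivative f (at x)) \<le> K2" if "x \<in> cball x0 r" for x
    using linear_bound_Basis[OF has_derivative_linear[OF der[OF that]], of K] K that
    by (intro onorm_le) (auto simp: K2_def)
  have "\<bar>f x - f y\<bar> \<le> K2 * norm (x - y)" if "x \<in> cball x0 r" "y \<in> cball x0 r" for x y
    using differentiable_bound[OF convex_cball der on that] by (simp add: real_norm_def)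
  then show ?thesis
    by (intro exI[of _ "max K1 K2"])
      (auto intro: order_trans[OF K1] order_trans[OF _ mult_right_mono[of K2]] simp: le_max_iff_disj)
qed

text \<open>The metric as seen in one chart. The local calculus is done here, on an open set of
  coordinates, and is brought back to the manifold by interpreting the locale chart by
  chart.\<close>

locale coord_metric =
  fixes S :: "'e::euclidean_space set" and G :: "'e \<Rightarrow> 'e \<Rightarrow> 'e \<Rightarrow> real"
  assumes open_S: "open S"
    and bilinear_G: "x \<in> S \<Longrightarrow> bilinear (G x)"
    and G_commute: "x \<in> S \<Longrightarrow> G x u v = G x v u"
    and G_pos: "x \<in> S \<Longrightarrow> v \<noteq> 0 \<Longrightarrow> G x v v > 0"
    and smooth_G: "smooth_on S (\<lambda>x. G x u v)"
begin

definition dG :: "'e \<Rightarrow> 'e \<Rightarrow> 'e \<Rightarrow> 'e \<Rightarrow> real" where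
  "dG x u v w = frechet_derivative (\<lambda>y. G y v w) (at x) u"

definition chr :: "'e \<Rightarrow> 'e \<Rightarrow> 'e \<Rightarrow> 'e" where
  "chr x u v = (THE z. \<forall>w. 2 * G x z w = dG x u v w + dG x v u w - dG x w u v)"

lemma linear_G: "x \<in> S \<Longrightarrow> linear (\<lambda>u. G x u v)" "x \<in> S \<Longrightarrow> linear (G x v)"
  using bilinear_G unfolding bilinear_def by auto

lemma dG_has_derivative: "x \<in> S \<Longrightarrow> ((\<lambda>y. G y v w) has_derivative (\<lambda>u. dG x u v w)) (at x)"
  using smooth_on_has_derivative[OF smooth_G] unfolding dG_def by simp

lemma linear_dG1: "x \<in> S \<Longrightarrow> linear (\<lambda>u. dG x u v w)"
  using dG_has_derivative has_derivative_linear by blast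

text \<open>Carries algebraic identities of G over to \<open>dG\<close>: functions that agree on the
  open set S have the same derivative there.\<close>

lemma dG_unique:
  assumes "x \<in> S" "\<And>y. y \<in> S \<Longrightarrow> h y = G y v w" "(h has_derivative h') (at x)"
  shows "h' u = dG x u v w"
proof -
  have "((\<lambda>y. G y v w) has_derivative h') (at x)"
    by (rule has_derivative_transform_within_open[OF assms(3) open_S assms(1) assms(2)])
  then show ?thesis using has_derivative_unique[OF dG_has_derivative[OF assms(1)]] by metis
qed

lemma linear_dG2: "x \<in> S \<Longrightarrow> linear (\<lambda>v. dG x u v w)"
proof (rule linearI)
  assume x: "x \<in> S"
  show "dG x u (v + v') w = dG x u v w + dG x u v' w" for v v'
    by (rule sym, rule dG_unique[OF x _ has_derivative_add[OF dG_has_derivative[OF x] dG_has_derivative[OF x]]])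
       (simp add: linear_add[OF linear_G(1)])
  show "dG x u (c *\<^sub>R v) w = c *\<^sub>R dG x u v w" for c v
    by (rule sym, rule dG_unique[OF x _ has_derivative_scaleR_right[OF dG_has_derivative[OF x]]])
       (simp add: linear_scale[OF linear_G(1)])
qed

lemma dG_commute: "x \<in> S \<Longrightarrow> dG x u v w = dG x u w v"
  by (rule dG_unique[OF _ _ dG_has_derivative]) (auto simp: G_commute)

lemma linear_dG3: "x \<in> S \<Longrightarrow> linear (dG x u v)"
proof -
  assume x: "x \<in> S"
  have "dG x u v = (\<lambda>w. dG x u w v)" using dG_commute[OF x] by blast
  then show ?thesis using linear_dG2[OF x] by simp
qed

lemmas linear_dG = linear_dG1 linear_dG2 linear_dG3

end

text \<open>The map that sends z to the vector of values \<open>B z b\<close> over the basis is an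
  injective, hence surjective, endomorphism. This gives meaning to the definite descriptions of
  \<open>chr\<close> and \<open>grad\<close>.\<close>

lemma riesz_bilinear:
  fixes B :: "'e::euclidean_space \<Rightarrow> 'e \<Rightarrow> real"
  assumes "bilinear B" "\<And>v. v \<noteq> 0 \<Longrightarrow> B v v > 0" "linear l"
  shows "\<exists>!z. \<forall>w. B z w = l w"
proof -
  have l1: "linear (\<lambda>u. B u v)" and l2: "linear (B v)" for v
    using assms(1) unfolding bilinear_def by auto
  define h where "h z = (\<Sum>b\<in>Basis. B z b *\<^sub>R b)" for z
  have hb: "h z \<bullet> b = B z b" if "b \<in> Basis" for z b
    using that by (simp add: h_def inner_sum_left inner_Basis if_distrib sum.delta cong: if_cong)
  have ext: "(\<forall>w. B z w = l' w) \<longleftrightarrow> (\<forall>b\<in>Basis. B z b = l' b)" if "linear l'" for z l'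
    using linear_eq_stdbasis[OF l2 that, of z] by metis
  have lin: "linear h"
    unfolding h_def by (intro linear_compose_sum ballI linearI)
      (auto simp: linear_add[OF l1] linear_scale[OF l1] algebra_simps)
  have "inj h"
  proof (subst linear_injective_0[OF lin], intro allI impI)
    fix z assume "h z = 0"
    then have "\<forall>b\<in>Basis. B z b = 0" using hb by (metis inner_zero_left)
    then have "B z z = 0" using ext[of "\<lambda>_. 0" z] by (simp add: module_hom_zero)
    then show "z = 0" using assms(2) by fastforce
  qed
  then have "surj h" using lin by (metis linear_injective_imp_surjective)
  then obtain z where "h z = (\<Sum>b\<in>Basis. l b *\<^sub>R b)" by (metis surjD)
  then have "\<forall>b\<in>Basis. B z b = l b"
    by (auto simp: inner_sum_left inner_Basis if_distrib sum.delta simp flip: hb cong: if_cong)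
  then have ex: "\<forall>w. B z w = l w" using ext[OF assms(3)] by blast
  show ?thesis
  proof (rule ex1I[of _ z])
    fix z' assume "\<forall>w. B z' w = l w"
    then have "B (z' - z) (z' - z) = 0" using ex by (simp add: linear_diff[OF l1])
    then show "z' = z" using assms(2)[of "z' - z"] by force
  qed (use ex in blast)
qed

context coord_metric begin

lemma chr_eq:
  assumes "x \<in> S"
  shows "2 * G x (chr x u v) w = dG x u v w + dG x v u w - dG x w u v"
proof -
  note lin = linear_dG[OF assms] linear_G[OF assms]
  have "\<exists>!z. \<forall>w. G x z w = (dG x u v w + dG x v u w - dG x w u v) / 2"
    by (rule riesz_bilinear[OF bilinear_G[OF assms] G_pos[OF assms]])
       (auto intro!: linearI simp: linear_add[OF lin(1)] linear_add[OF lin(3)]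
          linear_scale[OF lin(1)] linear_scale[OF lin(3)] algebra_simps add_divide_distrib diff_divide_distrib)
  then have "\<exists>!z. \<forall>w. 2 * G x z w = dG x u v w + dG x v u w - dG x w u v"
    by (simp add: field_simps)
  from theI'[OF this] show ?thesis unfolding chr_def by blast
qed

lemma G_nondegenerate: "x \<in> S \<Longrightarrow> (\<And>w. G x z w = G x z' w) \<Longrightarrow> z = z'"
  using linear_diff[OF linear_G(1), of x z z' "z - z'"] G_pos[of x "z - z'"] by force

text \<open>Quadratic homogeneity is what keeps a geodesic a geodesic when its time is rescaled by a
  constant.\<close>

lemma chr_scale: assumes x: "x \<in> S" shows "chr x (c *\<^sub>R u) (c *\<^sub>R u) = (c * c) *\<^sub>R chr x u u"
proof (rule G_nondegenerate[OF x])
  note lin = linear_dG[OF x] linear_G[OF x]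
  fix w
  have "2 * G x (chr x (c *\<^sub>R u) (c *\<^sub>R u)) w = c * c * (2 * G x (chr x u u) w)"
    unfolding chr_eq[OF x] by (simp add: linear_scale[OF lin(1)] linear_scale[OF lin(2)] linear_scale[OF lin(3)] algebra_simps)
  then show "G x (chr x (c *\<^sub>R u) (c *\<^sub>R u)) w = G x ((c * c) *\<^sub>R chr x u u) w"
    by (simp add: linear_scale[OF lin(4)])
qed

text \<open>Smoothness of the metric is given for fixed vector arguments; derivatives with moving
  arguments reduce through this expansion to the product rule for scalar functions.\<close>

lemma G_expand:
  assumes "x \<in> S"
  shows "G x y z = (\<Sum>i\<in>Basis. \<Sum>j\<in>Basis. G x i j * ((y \<bullet> i) * (z \<bullet> j)))"
proof -
  have "G x y z = G x (\<Sum>i\<in>Basis. (y \<bullet> i) *\<^sub>R i) (\<Sum>j\<in>Basis. (z \<bullet> j) *\<^sub>R j)"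
    by (simp add: euclidean_representation)
  also have "\<dots> = (\<Sum>i\<in>Basis. \<Sum>j\<in>Basis. G x i j * ((y \<bullet> i) * (z \<bullet> j)))"
    by (subst linear_sum[OF linear_G(1)[OF assms(1)]], subst linear_sum[OF linear_G(2)[OF assms(1)]])
       (simp add: linear_scale[OF linear_G(1)[OF assms(1)]] linear_scale[OF linear_G(2)[OF assms(1)]] algebra_simps)
  finally show ?thesis .
qed

lemma dG_expand:
  assumes "x \<in> S"
  shows "dG x u y z = (\<Sum>i\<in>Basis. \<Sum>j\<in>Basis. dG x u i j * ((y \<bullet> i) * (z \<bullet> j)))"
proof -
  have "dG x u y z = dG x u (\<Sum>i\<in>Basis. (y \<bullet> i) *\<^sub>R i) (\<Sum>j\<in>Basis. (z \<bullet> j) *\<^sub>R j)"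
    by (simp add: euclidean_representation)
  also have "\<dots> = (\<Sum>i\<in>Basis. \<Sum>j\<in>Basis. dG x u i j * ((y \<bullet> i) * (z \<bullet> j)))"
    by (subst linear_sum[OF linear_dG(2)[OF assms]], subst linear_sum[OF linear_dG(3)[OF assms]])
       (simp add: linear_scale[OF linear_dG(2)[OF assms]] linear_scale[OF linear_dG(3)[OF assms]] algebra_simps)
  finally show ?thesis .
qed

lemma G_along_curve:
  assumes X: "(X has_vector_derivative X') (at t within T)"
    and Y: "(Y has_vector_derivative Y') (at t within T)"
    and Z: "(Z has_vector_derivative Z') (at t within T)"
    and t: "t \<in> T" "X t \<in> S"
  shows "((\<lambda>\<tau>. G (X \<tau>) (Y \<tau>) (Z \<tau>)) has_real_derivative
           dG (X t) X' (Y t) (Z t) + G (X t) Y' (Z t) + G (X t) (Y t) Z') (at t within T)"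
proof -
  let ?K = "\<lambda>\<tau>. \<Sum>i\<in>Basis. \<Sum>j\<in>Basis. G (X \<tau>) i j * ((Y \<tau> \<bullet> i) * (Z \<tau> \<bullet> j))"
  have 1: "((\<lambda>\<tau>. G (X \<tau>) i j) has_real_derivative dG (X t) X' i j) (at t within T)" for i j
    using has_derivative_compose[OF X[unfolded has_vector_derivative_def] dG_has_derivative[OF t(2)]]
    by (rule has_derivative_imp_has_field_derivative) (simp add: linear_scale[OF linear_dG1[OF t(2)]])
  have 2: "((\<lambda>\<tau>. Y \<tau> \<bullet> i) has_real_derivative Y' \<bullet> i) (at t within T)"
    "((\<lambda>\<tau>. Z \<tau> \<bullet> i) has_real_derivative Z' \<bullet> i) (at t within T)" for i
    by (rule has_derivative_imp_has_field_derivative[OF has_derivative_inner_left[OF Y[unfolded has_vector_derivative_def]]], simp)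
       (rule has_derivative_imp_has_field_derivative[OF has_derivative_inner_left[OF Z[unfolded has_vector_derivative_def]]], simp)
  have "(?K has_real_derivative (\<Sum>i\<in>Basis. \<Sum>j\<in>Basis.
      dG (X t) X' i j * ((Y t \<bullet> i) * (Z t \<bullet> j)) + G (X t) i j * ((Y' \<bullet> i) * (Z t \<bullet> j))
       + G (X t) i j * ((Y t \<bullet> i) * (Z' \<bullet> j)))) (at t within T)"
    by (auto intro!: derivative_eq_intros 1 2 sum.cong simp: algebra_simps)
  also have "(\<Sum>i\<in>Basis. \<Sum>j\<in>Basis.
      dG (X t) X' i j * ((Y t \<bullet> i) * (Z t \<bullet> j)) + G (X t) i j * ((Y' \<bullet> i) * (Z t \<bullet> j))
       + G (X t) i j * ((Y t \<bullet> i) * (Z' \<bullet> j))) =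
       dG (X t) X' (Y t) (Z t) + G (X t) Y' (Z t) + G (X t) (Y t) Z'"
    unfolding sum.distrib
    by (simp only: dG_expand[OF t(2), symmetric] G_expand[OF t(2), symmetric])
  finally have K: "(?K has_real_derivative
      dG (X t) X' (Y t) (Z t) + G (X t) Y' (Z t) + G (X t) (Y t) Z') (at t within T)" .
  \<comment> \<open>The expansion into coefficients holds inside S only; since S is open, the curve
    stays there near t.\<close>
  have "(X \<longlongrightarrow> X t) (at t within T)"
    using has_vector_derivative_continuous[OF X] by (simp add: continuous_within)
  then have "\<forall>\<^sub>F \<tau> in at t within T. X \<tau> \<in> S"
    using open_S t(2) topological_tendstoD by blast
  then have ev: "\<forall>\<^sub>F \<tau> in at t within T. ?K \<tau> = G (X \<tau>) (Y \<tau>) (Z \<tau>)"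
    by eventually_elim (simp add: G_expand)
  show ?thesis
    using K unfolding has_field_derivative_def
    by (rule has_derivative_transform_eventually[OF _ ev G_expand[OF t(2), symmetric] t(1)])
qed

lemma local_bounds:
  assumes "x0 \<in> S"
  obtains r K l where "r > 0" "K \<ge> 0" "l > 0" "cball x0 r \<subseteq> S"
    "\<And>x z. x \<in> cball x0 r \<Longrightarrow> G x z z \<ge> l * (norm z)\<^sup>2"
    "\<And>x y u v. x \<in> cball x0 r \<Longrightarrow> y \<in> cball x0 r \<Longrightarrow> \<bar>G x u v - G y u v\<bar> \<le> K * norm (x - y) * norm u * norm v"
    "\<And>x u v w. x \<in> cball x0 r \<Longrightarrow> \<bar>dG x u v w\<bar> \<le> K * norm u * norm v * norm w"
    "\<And>x y u v w. x \<in> cball x0 r \<Longrightarrow> y \<in> cball x0 r \<Longrightarrow>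
       \<bar>dG x u v w - dG y u v w\<bar> \<le> K * norm (x - y) * norm u * norm v * norm w"
proof -
  obtain r0 where r0: "r0 > 0" "cball x0 r0 \<subseteq> S" using assms open_S open_contains_cball by blast
  have smooth_dG: "smooth_on S (\<lambda>x. dG x u v w)" for u v w
    unfolding dG_def by (intro smooth_on_frechet_derivative smooth_G)
  define Q where "Q f K \<longleftrightarrow> (\<forall>x\<in>cball x0 r0. \<bar>f x\<bar> \<le> K \<and> (\<forall>y\<in>cball x0 r0. \<bar>f x - f y\<bar> \<le> K * norm (x - y)))"
    for f :: "'e \<Rightarrow> real" and K
  have Q_mono: "Q f K'" if "Q f K" "K \<le> K'" for f K K'
    using that unfolding Q_def by (meson mult_right_mono norm_ge_zero order_trans)
  obtain K1 where K1: "K1 \<ge> 0" "\<And>i j. i \<in> Basis \<Longrightarrow> j \<in> Basis \<Longrightarrow> Q (\<lambda>x. G x i j) K1"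
  proof (rule finite_uniform_bound[of "Basis \<times> Basis" "\<lambda>p K. Q (\<lambda>x. G x (fst p) (snd p)) K"])
    show "\<exists>K. Q (\<lambda>x. G x (fst a) (snd a)) K" for a :: "'e \<times> 'e"
      unfolding Q_def by (rule smooth_on_lipschitz_bound[OF smooth_G r0(2)])
  qed (use Q_mono that in auto)
  obtain K2 where K2: "K2 \<ge> 0" "\<And>i j k. i \<in> Basis \<Longrightarrow> j \<in> Basis \<Longrightarrow> k \<in> Basis \<Longrightarrow> Q (\<lambda>x. dG x i j k) K2"
  proof (rule finite_uniform_bound[of "Basis \<times> Basis \<times> Basis" "\<lambda>p K. Q (\<lambda>x. dG x (fst p) (fst (snd p)) (snd (snd p))) K"])
    show "\<exists>K. Q (\<lambda>x. dG x (fst a) (fst (snd a)) (snd (snd a))) K" for a :: "'e \<times> 'e \<times> 'e"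
      unfolding Q_def by (rule smooth_on_lipschitz_bound[OF smooth_dG r0(2)])
  qed (use Q_mono that in auto)
  define d where "d = real DIM('e)"
  define K where "K = max (d^2 * K1) (d^3 * K2)"
  have Knn: "K \<ge> 0" using K1(1) by (simp add: K_def le_max_iff_disj d_def)
  have b1: "\<bar>G x u v - G y u v\<bar> \<le> K * norm (x - y) * norm u * norm v"
    if xy: "x \<in> cball x0 r0" "y \<in> cball x0 r0" for x y u v
  proof -
    have S: "x \<in> S" "y \<in> S" using xy r0 by auto
    have "\<bar>G x u v - G y u v\<bar> \<le> d^2 * (K1 * norm (x - y)) * norm u * norm v"
      unfolding d_def
      by (rule bilinear_bound_Basis[where B="\<lambda>u v. G x u v - G y u v"])
        (use K1(2) xy in \<open>auto simp: Q_def intro!: linear_compose_sub linear_G S\<close>)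
    also have "\<dots> = (d^2 * K1) * (norm (x - y) * norm u * norm v)" by simp
    also have "\<dots> \<le> K * (norm (x - y) * norm u * norm v)"
      by (intro mult_right_mono) (auto simp: K_def)
    finally show ?thesis by (simp add: algebra_simps)
  qed
  have b2: "\<bar>dG x u v w\<bar> \<le> K * norm u * norm v * norm w" if x: "x \<in> cball x0 r0" for x u v w
  proof -
    have S: "x \<in> S" using x r0 by auto
    have "\<bar>dG x u v w\<bar> \<le> d^3 * K2 * norm u * norm v * norm w"
      unfolding d_def by (rule trilinear_bound_Basis)
        (use K2(2) x in \<open>auto simp: Q_def intro!: linear_dG S\<close>)
    also have "\<dots> = (d^3 * K2) * (norm u * norm v * norm w)" by simp
    also have "\<dots> \<le> K * (norm u * norm v * norm w)"
      by (intro mult_right_mono) (auto simp: K_def)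
    finally show ?thesis by (simp add: algebra_simps)
  qed
  have b3: "\<bar>dG x u v w - dG y u v w\<bar> \<le> K * norm (x - y) * norm u * norm v * norm w"
    if xy: "x \<in> cball x0 r0" "y \<in> cball x0 r0" for x y u v w
  proof -
    have S: "x \<in> S" "y \<in> S" using xy r0 by auto
    have "\<bar>dG x u v w - dG y u v w\<bar> \<le> d^3 * (K2 * norm (x - y)) * norm u * norm v * norm w"
      unfolding d_def by (rule trilinear_bound_Basis[where B="\<lambda>u v w. dG x u v w - dG y u v w"])
        (use K2(2) xy in \<open>auto simp: Q_def intro!: linear_compose_sub linear_dG S\<close>)
    also have "\<dots> = (d^3 * K2) * (norm (x - y) * norm u * norm v * norm w)" by simp
    also have "\<dots> \<le> K * (norm (x - y) * norm u * norm v * norm w)"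
      by (intro mult_right_mono) (auto simp: K_def)
    finally show ?thesis by (simp add: algebra_simps)
  qed
  \<comment> \<open>l is half the minimum of the form at x0 over the unit sphere; the other half is
    spent on moving the base point.\<close>
  obtain l where l: "l > 0" "\<And>z. G x0 z z \<ge> 2 * l * (norm z)\<^sup>2"
  proof -
    have bb: "bounded_bilinear (G x0)" using bilinear_G[OF assms(1)] bilinear_conv_bounded_bilinear by blast
    have "continuous_on (sphere 0 1) (\<lambda>z. G x0 z z)"
      by (rule bounded_bilinear.continuous_on[OF bb continuous_on_id continuous_on_id])
    moreover have ne: "sphere (0::'e) 1 \<noteq> {}"
      by simp
    ultimately obtain z0 where z0: "z0 \<in> sphere 0 1" "\<And>z. z \<in> sphere 0 1 \<Longrightarrow> G x0 z0 z0 \<le> G x0 z z"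
      using continuous_attains_inf[OF compact_sphere ne] by blast
    have pos: "G x0 z0 z0 > 0" using z0 by (intro G_pos assms) auto
    show ?thesis
    proof (rule that[of "G x0 z0 z0 / 2"])
      fix z
      show "2 * (G x0 z0 z0 / 2) * (norm z)\<^sup>2 \<le> G x0 z z"
      proof (cases "z = 0")
        case False
        have "G x0 z0 z0 \<le> G x0 ((1 / norm z) *\<^sub>R z) ((1 / norm z) *\<^sub>R z)"
          using False by (intro z0(2)) auto
        then show ?thesis using False
          by (simp add: linear_scale[OF linear_G(1)[OF assms(1)]] linear_scale[OF linear_G(2)[OF assms(1)]]
              field_simps power2_eq_square)
      next
        case True
        then show ?thesis by (simp add: linear_0[OF linear_G(1)[OF assms(1)]])
      qed
    qed (use pos in simp)
  qed
  \<comment> \<open>Within l / (K + 1) of x0 the form changes by at most l |z|^2; the summand 1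
    covers K = 0.\<close>
  define r where "r = min r0 (l / (K + 1))"
  have r: "r > 0" "r \<le> r0" using r0 l Knn by (auto simp: r_def)
  have b4: "G x z z \<ge> l * (norm z)\<^sup>2" if x: "x \<in> cball x0 r" for x z
  proof -
    have "\<bar>G x z z - G x0 z z\<bar> \<le> K * norm (x - x0) * norm z * norm z"
      using x r r0 by (intro b1) auto
    also have "\<dots> = (K * norm (x - x0)) * (norm z)\<^sup>2" by (simp add: power2_eq_square)
    also have "\<dots> \<le> l * (norm z)\<^sup>2"
    proof (rule mult_right_mono)
      have "norm (x - x0) \<le> l / (K + 1)" using x by (simp add: r_def dist_norm norm_minus_commute)
      then have "(K + 1) * norm (x - x0) \<le> l" using Knn by (simp add: field_simps)
      then show "K * norm (x - x0) \<le> l" using norm_ge_zero[of "x - x0"] unfolding distrib_right by linarith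
    qed simp
    finally show ?thesis using l(2)[of z] by linarith
  qed
  show ?thesis
    by (rule that[OF r(1) Knn l(1)]) (use r r0 b1 b2 b3 b4 in auto)
qed

text \<open>
  The Christoffel map is given only implicitly; the bound comes from testing the difference of its
  defining identities with the difference of the two values and using that the metric is locally
  bounded below.
\<close>

lemma chr_local_lipschitz:
  assumes "x0 \<in> S" and R: "R \<ge> 0"
  obtains r C where "r > 0" "C \<ge> 0" "cball x0 r \<subseteq> S"
    "\<And>x1 x2 (y1::'e) (y2::'e). x1 \<in> cball x0 r \<Longrightarrow> x2 \<in> cball x0 r \<Longrightarrow> norm y1 \<le> R \<Longrightarrow> norm y2 \<le> R \<Longrightarrow>
       norm (chr x1 y1 y1 - chr x2 y2 y2) \<le> C * (norm (x1 - x2) + norm (y1 - y2))"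
proof -
  obtain r K l where rK: "r > 0" "K \<ge> 0" "l > 0" "cball x0 r \<subseteq> S"
    and b4: "\<And>x z. x \<in> cball x0 r \<Longrightarrow> G x z z \<ge> l * (norm z)\<^sup>2"
    and b1: "\<And>x y u v. x \<in> cball x0 r \<Longrightarrow> y \<in> cball x0 r \<Longrightarrow> \<bar>G x u v - G y u v\<bar> \<le> K * norm (x - y) * norm u * norm v"
    and b2: "\<And>x u v w. x \<in> cball x0 r \<Longrightarrow> \<bar>dG x u v w\<bar> \<le> K * norm u * norm v * norm w"
    and b3: "\<And>x y u v w. x \<in> cball x0 r \<Longrightarrow> y \<in> cball x0 r \<Longrightarrow>
       \<bar>dG x u v w - dG y u v w\<bar> \<le> K * norm (x - y) * norm u * norm v * norm w"
    using local_bounds[OF assms(1)] by blast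
  have b2': "\<bar>dG x u v w\<bar> \<le> K * A * B * norm w" if "x \<in> cball x0 r" "norm u \<le> A" "norm v \<le> B" for x u v w A B
  proof (rule order_trans[OF b2[OF that(1)]])
    have "norm u * norm v \<le> A * B" using that by (intro mult_mono) (auto intro: order_trans[OF norm_ge_zero])
    then have "(K * norm w) * (norm u * norm v) \<le> (K * norm w) * (A * B)" using rK by (intro mult_left_mono) auto
    then show "K * norm u * norm v * norm w \<le> K * A * B * norm w" by (simp add: algebra_simps)
  qed
  have b2'': "\<bar>dG x w u v\<bar> \<le> K * A * B * norm w" if "x \<in> cball x0 r" "norm u \<le> A" "norm v \<le> B" for x u v w A B
  proof (rule order_trans[OF b2[OF that(1)]])
    have "norm u * norm v \<le> A * B" using that by (intro mult_mono) (auto intro: order_trans[OF norm_ge_zero])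
    then have "(K * norm w) * (norm u * norm v) \<le> (K * norm w) * (A * B)" using rK by (intro mult_left_mono) auto
    then show "K * norm w * norm u * norm v \<le> K * A * B * norm w" by (simp add: algebra_simps)
  qed
  define q where "q x y w = 2 * dG x y y w - dG x w y y" for x y w
  have chr_q: "2 * G x (chr x y y) w = q x y w" if "x \<in> S" for x y w
    unfolding chr_eq[OF that] q_def by simp
  \<comment> \<open>Testing the defining identity of z = \<open>chr x y y\<close> with z itself
    gives 2 l |z|^2 \<le> 3 K R^2 |z|.\<close>
  define Z where "Z = 3 * K * R\<^sup>2 / (2 * l)"
  have Znn: "Z \<ge> 0" using rK by (simp add: Z_def)
  have cancel: "a \<le> B" if "l * a\<^sup>2 \<le> l * B * a" "a \<ge> 0" "B \<ge> 0" for a B :: real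
  proof (cases "a = 0")
    case False
    then show ?thesis using that rK by (simp add: power2_eq_square)
  qed (use that in simp)
  have z_bound: "norm (chr x y y) \<le> Z" if "x \<in> cball x0 r" "norm y \<le> R" for x y
  proof (rule cancel)
    let ?z = "chr x y y"
    have "2 * (l * (norm ?z)\<^sup>2) \<le> 2 * G x ?z ?z" using b4[OF that(1)] by simp
    also have "\<dots> = q x y ?z" using that rK by (intro chr_q) auto
    also have "\<dots> \<le> 3 * (K * R * R * norm ?z)"
      using b2'[OF that(1,2,2), of ?z] b2''[OF that(1,2,2), of ?z] unfolding q_def by linarith
    also have "\<dots> = 2 * (l * Z * norm ?z)" using rK by (simp add: Z_def power2_eq_square)
    finally show "l * (norm ?z)\<^sup>2 \<le> l * Z * norm ?z" by simp
  qed (use Znn in auto)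
  define C where "C = (3 * K * R\<^sup>2 + 6 * K * R + 2 * K * Z) / (2 * l)"
  have Cnn: "C \<ge> 0" using rK R Znn by (simp add: C_def)
  show ?thesis
  proof (rule that[OF rK(1) Cnn rK(4)])
    fix x1 x2 and y1 y2 :: 'e
    assume x: "x1 \<in> cball x0 r" "x2 \<in> cball x0 r" and y: "norm y1 \<le> R" "norm y2 \<le> R"
    have S: "x1 \<in> S" "x2 \<in> S" using x rK by auto
    let ?z1 = "chr x1 y1 y1" and ?z2 = "chr x2 y2 y2"
    define w where "w = ?z1 - ?z2"
    define dx where "dx = norm (x1 - x2)"
    define dy where "dy = norm (y1 - y2)"
    have nn: "dx \<ge> 0" "dy \<ge> 0" by (auto simp: dx_def dy_def)
    \<comment> \<open>The difference of the defining identities has three sources: the base point of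
      \<open>dG\<close>, the vector y, and the base point of the metric, because z2 is defined
      through the metric at x2 while the test uses the one at x1. They are estimated in
      \<open>t1\<close>, \<open>t2\<close> and \<open>t3\<close>.\<close>
    have t1: "\<bar>q x1 y1 w - q x2 y1 w\<bar> \<le> 3 * (K * dx * (R * R) * norm w)"
    proof -
      have "norm y1 * norm y1 \<le> R * R" using y R by (intro mult_mono) auto
      then have "K * dx * norm w * (norm y1 * norm y1) \<le> K * dx * norm w * (R * R)"
        using rK nn by (intro mult_left_mono) auto
      moreover have "\<bar>dG x1 y1 y1 w - dG x2 y1 y1 w\<bar> \<le> K * dx * norm w * (norm y1 * norm y1)"
        using b3[OF x, of y1 y1 w] by (simp add: dx_def algebra_simps)
      moreover have "\<bar>dG x1 w y1 y1 - dG x2 w y1 y1\<bar> \<le> K * dx * norm w * (norm y1 * norm y1)"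
        using b3[OF x, of w y1 y1] by (simp add: dx_def algebra_simps)
      moreover have "K * dx * (R * R) * norm w = K * dx * norm w * (R * R)" by simp
      ultimately show ?thesis unfolding q_def by argo
    qed
    have t2: "\<bar>q x2 y1 w - q x2 y2 w\<bar> \<le> 6 * (K * R * dy * norm w)"
    proof -
      note l = linear_diff[OF linear_dG1[OF S(2)]] linear_diff[OF linear_dG2[OF S(2)]] linear_diff[OF linear_dG3[OF S(2)]]
      have e1: "dG x2 y1 y1 w - dG x2 y2 y2 w = dG x2 (y1 - y2) y1 w + dG x2 y2 (y1 - y2) w" by (simp add: l)
      have e2: "dG x2 w y1 y1 - dG x2 w y2 y2 = dG x2 w (y1 - y2) y1 + dG x2 w y2 (y1 - y2)" by (simp add: l)
      have "\<bar>dG x2 (y1 - y2) y1 w\<bar> \<le> K * R * dy * norm w" "\<bar>dG x2 y2 (y1 - y2) w\<bar> \<le> K * R * dy * norm w"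
        using b2'[OF x(2), of "y1 - y2" dy y1 R w] b2'[OF x(2), of y2 R "y1 - y2" dy w] y
        by (auto simp: dy_def algebra_simps)
      moreover have "\<bar>dG x2 w (y1 - y2) y1\<bar> \<le> K * R * dy * norm w" "\<bar>dG x2 w y2 (y1 - y2)\<bar> \<le> K * R * dy * norm w"
        using b2''[OF x(2), of "y1 - y2" dy y1 R w] b2''[OF x(2), of y2 R "y1 - y2" dy w] y
        by (auto simp: dy_def algebra_simps)
      ultimately show ?thesis using e1 e2 unfolding q_def by argo
    qed
    have t3: "\<bar>G x1 ?z2 w - G x2 ?z2 w\<bar> \<le> K * dx * Z * norm w"
    proof -
      have "\<bar>G x1 ?z2 w - G x2 ?z2 w\<bar> \<le> K * dx * norm w * norm ?z2"
        using b1[OF x, of ?z2 w] by (simp add: dx_def algebra_simps)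
      also have "\<dots> \<le> K * dx * norm w * Z"
        using z_bound[OF x(2) y(2)] rK nn by (intro mult_left_mono) auto
      finally show ?thesis by (simp add: algebra_simps)
    qed
    have "norm w \<le> C * (dx + dy)"
    proof (rule cancel)
      have "2 * (l * (norm w)\<^sup>2) \<le> 2 * G x1 w w" using b4[OF x(1)] by simp
      also have "\<dots> = 2 * G x1 ?z1 w - 2 * G x2 ?z2 w - 2 * (G x1 ?z2 w - G x2 ?z2 w)"
        unfolding w_def by (simp add: linear_diff[OF linear_G(1)[OF S(1)]])
      also have "\<dots> = (q x1 y1 w - q x2 y1 w) + (q x2 y1 w - q x2 y2 w) - 2 * (G x1 ?z2 w - G x2 ?z2 w)"
        by (simp add: chr_q S)
      also have "\<dots> \<le> 3 * (K * dx * (R * R) * norm w) + 6 * (K * R * dy * norm w) + 2 * (K * dx * Z * norm w)"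
      proof -
        have arith: "a + b - 2 * c \<le> A + B + 2 * C" if "a \<le> A" "b \<le> B" "- c \<le> C" for a b c A B C :: real
          using that by linarith
        show ?thesis by (rule arith[OF abs_le_D1[OF t1] abs_le_D1[OF t2] abs_le_D2[OF t3]])
      qed
      also have "\<dots> = (3 * K * R\<^sup>2 * dx + 6 * K * R * dy + 2 * K * Z * dx) * norm w"
        by (simp add: algebra_simps power2_eq_square)
      also have "\<dots> \<le> ((3 * K * R\<^sup>2 + 6 * K * R + 2 * K * Z) * (dx + dy)) * norm w"
      proof (rule mult_right_mono)
        have "0 \<le> 3 * K * R\<^sup>2 * dy + 6 * K * R * dx + 2 * K * Z * dy" using rK R Znn nn by simp
        then show "3 * K * R\<^sup>2 * dx + 6 * K * R * dy + 2 * K * Z * dx \<le>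
            (3 * K * R\<^sup>2 + 6 * K * R + 2 * K * Z) * (dx + dy)" by (simp add: algebra_simps)
      qed simp
      also have "\<dots> = 2 * (l * (C * (dx + dy)) * norm w)" using rK by (simp add: C_def)
      finally show "l * (norm w)\<^sup>2 \<le> l * (C * (dx + dy)) * norm w" by simp
    qed (use Cnn nn in auto)
    then show "norm (?z1 - ?z2) \<le> C * (norm (x1 - x2) + norm (y1 - y2))" by (simp add: w_def dx_def dy_def)
  qed
qed

end

section \<open>Geodesics\<close>

lemma at_within_01_nontrivial: "t \<in> {0..1::real} \<Longrightarrow> at t within {0..1} \<noteq> bot"
  by (simp add: trivial_limit_within islimpt_Icc)

lemma has_vector_derivative_rescale:
  assumes "(f has_vector_derivative f') (at (r * t) within {0..1})" "r \<in> {0..1}" "t \<in> {0..1::real}"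
  shows "((\<lambda>\<tau>. f (r * \<tau>)) has_vector_derivative r *\<^sub>R f') (at t within {0..1})"
proof -
  have "((\<lambda>\<tau>. r * \<tau>) has_vector_derivative r) (at t within {0..1})"
    by (auto intro!: derivative_eq_intros)
  moreover have "(\<lambda>\<tau>. r * \<tau>) ` {0..1} \<subseteq> {0..1}" using assms(2) by (auto intro: mult_le_one)
  ultimately show ?thesis
    using vector_diff_chain_within[of "\<lambda>\<tau>. r * \<tau>" r t "{0..1}" f f'] has_vector_derivative_within_subset[OF assms(1)]
    by (auto simp: o_def)
qed

lemma has_real_derivative_inner_self:
  assumes "(u has_vector_derivative u') (at t within T)"
  shows "((\<lambda>t. u t \<bullet> u t) has_real_derivative 2 * (u t \<bullet> u')) (at t within T)"
  by (rule has_derivative_imp_has_field_derivative[OF has_derivative_inner[OF assms[unfolded has_vector_derivative_def]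
        assms[unfolded has_vector_derivative_def]]]) (simp add: inner_commute)

lemma bilinear_Cauchy_Schwarz:
  assumes "bilinear B" "\<And>u v. B u v = B v u" "\<And>v. v \<noteq> 0 \<Longrightarrow> B v v > (0::real)"
  shows "\<bar>B u v\<bar> \<le> sqrt (B u u) * sqrt (B v v)"
proof (cases "v = 0")
  case True
  then show ?thesis using bilinear_rzero[OF assms(1)] by simp
next
  case False
  then have pos: "B v v > 0" using assms(3) by simp
  \<comment> \<open>The component of u orthogonal to v, multiplied by \<open>B v v\<close> to avoid
    a division.\<close>
  define w where "w = B v v *\<^sub>R u - B u v *\<^sub>R v"
  have "B w w \<ge> 0" using assms(3)[of w] bilinear_lzero[OF assms(1), of 0] by (cases "w = 0") auto
  also have "B w w = B v v * (B v v * B u u - (B u v)\<^sup>2)"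
    unfolding w_def using assms(2)[of v u]
    by (simp add: bilinear_lsub[OF assms(1)] bilinear_rsub[OF assms(1)] bilinear_lmul[OF assms(1)]
        bilinear_rmul[OF assms(1)] algebra_simps power2_eq_square)
  finally have "(B u v)\<^sup>2 \<le> B u u * B v v" using pos by (simp add: zero_le_mult_iff mult.commute)
  then have "sqrt ((B u v)\<^sup>2) \<le> sqrt (B u u * B v v)" by (rule real_sqrt_le_mono)
  then show ?thesis by (simp add: real_sqrt_mult)
qed

locale riemannian =
  fixes A :: "('m::{t2_space,second_countable_topology}, 'e::euclidean_space) chart set"
    and g :: "'m \<Rightarrow> 'e \<Rightarrow> 'e \<Rightarrow> real"
  assumes manifold: "riemannian_manifold A g"
begin

lemma bilinear_g: "bilinear (g p)" and g_commute: "g p u v = g p v u" and g_pos: "v \<noteq> 0 \<Longrightarrow> g p v v > 0"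
  using manifold unfolding riemannian_manifold_def riemannian_metric_def by auto

lemma g_nonneg: "g p v v \<ge> 0"
  using g_pos[of v p] bilinear_lzero[OF bilinear_g, of p 0] by (cases "v = 0") auto

lemmas g_simps = bilinear_ladd[OF bilinear_g] bilinear_radd[OF bilinear_g] bilinear_lmul[OF bilinear_g]
  bilinear_rmul[OF bilinear_g] bilinear_lsub[OF bilinear_g] bilinear_rsub[OF bilinear_g]
  bilinear_lzero[OF bilinear_g] bilinear_rzero[OF bilinear_g] bilinear_lneg[OF bilinear_g] bilinear_rneg[OF bilinear_g]

lemma g_Cauchy_Schwarz: "\<bar>g p u v\<bar> \<le> tnorm g p u * tnorm g p v"
  unfolding tnorm_def by (rule bilinear_Cauchy_Schwarz[OF bilinear_g g_commute g_pos])

lemma chart_at: "chart_at A p \<in> A" "p \<in> fst (chart_at A p)"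
proof -
  have "\<exists>c. c \<in> A \<and> p \<in> fst c"
    using manifold unfolding riemannian_manifold_def smooth_atlas_def by blast
  from someI_ex[OF this] show "chart_at A p \<in> A" "p \<in> fst (chart_at A p)" unfolding chart_at_def by auto
qed

lemma open_chart: "c \<in> A \<Longrightarrow> open (fst c)" and open_chart_image: "c \<in> A \<Longrightarrow> open (snd c ` fst c)"
  and chart_homeo: "c \<in> A \<Longrightarrow> homeomorphism (fst c) (snd c ` fst c) (snd c) (chart_inv c)"
  and smooth_transition: "c \<in> A \<Longrightarrow> d \<in> A \<Longrightarrow> smooth_on (snd c ` (fst c \<inter> fst d)) (snd d \<circ> chart_inv c)"
  using manifold unfolding riemannian_manifold_def smooth_atlas_def by auto

lemma chart_inv: "c \<in> A \<Longrightarrow> p \<in> fst c \<Longrightarrow> chart_inv c (snd c p) = p"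
  and chart_inv_in: "c \<in> A \<Longrightarrow> x \<in> snd c ` fst c \<Longrightarrow> chart_inv c x \<in> fst c"
  and chart_chart_inv: "c \<in> A \<Longrightarrow> x \<in> snd c ` fst c \<Longrightarrow> snd c (chart_inv c x) = x"
  using chart_homeo[of c] unfolding homeomorphism_def by auto

section \<open>Changes of charts\<close>

lemma eventually_in_chart:
  assumes "c \<in> A" "X t \<in> fst c" "continuous (at t within T) X"
  shows "\<forall>\<^sub>F \<tau> in at t within T. X \<tau> \<in> fst c"
  using assms open_chart topological_tendstoD unfolding continuous_within by blast

text \<open>The Jacobian of a change of coordinates. Both \<open>to_coord\<close> and
  \<open>of_coord\<close> are instances with the preferred chart at p on one side, so their rules
  follow from the chain rule for transitions.\<close>

definition transition :: "('m, 'e) chart \<Rightarrow> ('m, 'e) chart \<Rightarrow> 'm \<Rightarrow> 'e \<Rightarrow> 'e" where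
  "transition c d p u = frechet_derivative (snd d \<circ> chart_inv c) (at (snd c p)) u"

lemma to_coord_transition: "to_coord A c p = transition (chart_at A p) c p"
  and of_coord_transition: "of_coord A c p = transition c (chart_at A p) p"
  unfolding to_coord_def of_coord_def transition_def by auto

lemma transition_has_derivative:
  assumes "c \<in> A" "d \<in> A" "p \<in> fst c" "p \<in> fst d"
  shows "((\<lambda>x. snd d (chart_inv c x)) has_derivative transition c d p) (at (snd c p))"
  using smooth_on_has_derivative[OF smooth_transition[OF assms(1,2)], of "snd c p"] assms
  by (auto simp: transition_def[abs_def] o_def)

lemma linear_transition:
  assumes "c \<in> A" "d \<in> A" "p \<in> fst c" "p \<in> fst d"
  shows "linear (transition c d p)"
  using has_derivative_linear[OF transition_has_derivative[OF assms]] .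

text \<open>The parameter lives in an arbitrary normed space so that the rule covers curves, inverse
  charts and the exponential map alike.\<close>

lemma change_chart:
  fixes X :: "'a::real_normed_vector \<Rightarrow> 'm"
  assumes "c \<in> A" "d \<in> A" "X t \<in> fst c" "X t \<in> fst d" "t \<in> T" "continuous (at t within T) X"
    and "((\<lambda>\<tau>. snd c (X \<tau>)) has_derivative X') (at t within T)"
  shows "((\<lambda>\<tau>. snd d (X \<tau>)) has_derivative (\<lambda>h. transition c d (X t) (X' h))) (at t within T)"
proof -
  have 1: "((\<lambda>\<tau>. snd d (chart_inv c (snd c (X \<tau>)))) has_derivative (\<lambda>h. transition c d (X t) (X' h))) (at t within T)"
    by (rule has_derivative_compose[OF assms(7) transition_has_derivative[OF assms(1-4)]])
  have "\<forall>\<^sub>F \<tau> in at t within T. snd d (chart_inv c (snd c (X \<tau>))) = snd d (X \<tau>)"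
    using eventually_in_chart[OF assms(1,3,6)] by eventually_elim (simp add: chart_inv assms)
  then show ?thesis
    using has_derivative_transform_eventually[OF 1 _ _ assms(5)] assms by (simp add: chart_inv)
qed

lemma transition_self:
  assumes "c \<in> A" "p \<in> fst c"
  shows "transition c c p u = u"
proof -
  have "((\<lambda>x. snd c (chart_inv c x)) has_derivative (\<lambda>h. h)) (at (snd c p))"
    by (rule has_derivative_transform_within_open[OF has_derivative_ident open_chart_image[OF assms(1)]])
      (use assms in \<open>auto simp: chart_chart_inv\<close>)
  from has_derivative_unique[OF this transition_has_derivative[OF assms(1,1,2,2)]]
  show ?thesis by (simp add: fun_eq_iff)
qed

lemma transition_comp:
  assumes "c \<in> A" "d \<in> A" "e \<in> A" "p \<in> fst c" "p \<in> fst d" "p \<in> fst e"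
  shows "transition d e p (transition c d p u) = transition c e p u"
proof -
  have "continuous_on (snd c ` fst c) (chart_inv c)"
    using chart_homeo[OF assms(1)] unfolding homeomorphism_def by blast
  then have "continuous (at (snd c p)) (chart_inv c)"
    using open_chart_image[OF assms(1)] assms(4) continuous_on_eq_continuous_at by blast
  then have "((\<lambda>x. snd e (chart_inv c x)) has_derivative (\<lambda>h. transition d e p (transition c d p h))) (at (snd c p))"
    using change_chart[of d e "chart_inv c" "snd c p" UNIV "transition c d p"] assms
      transition_has_derivative[of c d p] by (simp add: chart_inv)
  from has_derivative_unique[OF this transition_has_derivative[OF assms(1,3,4,6)]]
  show ?thesis by (simp add: fun_eq_iff)
qed

lemma linear_to_coord: "c \<in> A \<Longrightarrow> p \<in> fst c \<Longrightarrow> linear (to_coord A c p)"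
  unfolding to_coord_transition by (intro linear_transition chart_at)

lemma linear_of_coord: "c \<in> A \<Longrightarrow> p \<in> fst c \<Longrightarrow> linear (of_coord A c p)"
  unfolding of_coord_transition by (intro linear_transition chart_at)

lemma of_to_coord: "c \<in> A \<Longrightarrow> p \<in> fst c \<Longrightarrow> of_coord A c p (to_coord A c p u) = u"
  unfolding of_coord_transition to_coord_transition
  by (subst transition_comp) (auto simp: chart_at transition_self)

lemma to_of_coord: "c \<in> A \<Longrightarrow> p \<in> fst c \<Longrightarrow> to_coord A c p (of_coord A c p u) = u"
  unfolding of_coord_transition to_coord_transition
  by (subst transition_comp) (auto simp: chart_at transition_self)

lemma to_coord_chart_at: "to_coord A (chart_at A p) p u = u"
  unfolding to_coord_transition by (intro transition_self chart_at)

lemma gram_to_coord: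
  "c \<in> A \<Longrightarrow> p \<in> fst c \<Longrightarrow> gram A g c (snd c p) (to_coord A c p u) (to_coord A c p v) = g p u v"
  unfolding gram_def Let_def by (simp add: chart_inv of_to_coord)

section \<open>The metric and curves in one chart\<close>

lemma coord_metric: assumes c: "c \<in> A" shows "coord_metric (snd c ` fst c) (gram A g c)"
proof
  show "open (snd c ` fst c)" by (rule open_chart_image[OF c])
  fix x u v assume x: "x \<in> snd c ` fst c"
  define p where "p = chart_inv c x"
  have p: "p \<in> fst c" unfolding p_def by (rule chart_inv_in[OF c x])
  have gr: "gram A g c x a b = g p (of_coord A c p a) (of_coord A c p b)" for a b
    unfolding gram_def Let_def p_def ..
  note lin = linear_of_coord[OF c p]
  show "bilinear (gram A g c x)"
    unfolding bilinear_def
    by (intro conjI allI linearI) (simp_all add: gr linear_add[OF lin] linear_scale[OF lin] g_simps)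
  show "gram A g c x u v = gram A g c x v u" unfolding gr by (rule g_commute)
  show "gram A g c x v v > 0" if "v \<noteq> 0"
  proof -
    have "of_coord A c p v \<noteq> 0"
      using to_of_coord[OF c p, of v] linear_0[OF linear_to_coord[OF c p]] that by metis
    then show ?thesis unfolding gr by (rule g_pos)
  qed
next
  fix u v show "smooth_on (snd c ` fst c) (\<lambda>x. gram A g c x u v)"
    using manifold c unfolding riemannian_manifold_def riemannian_metric_def by blast
qed

lemma christoffel_chr: assumes c: "c \<in> A" shows "christoffel A g c x u v = coord_metric.chr (gram A g c) x u v"
  unfolding christoffel_def coord_metric.chr_def[OF coord_metric[OF c]] coord_metric.dG_def[OF coord_metric[OF c]] ..

text \<open>\<open>velocity\<close> at t is expressed in the preferred chart at \<gamma> t, which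
  may jump with t. Referring it to one chart c makes it a function that can be differentiated in
  t.\<close>

definition cvel :: "('m, 'e) chart \<Rightarrow> (real \<Rightarrow> 'm) \<Rightarrow> real \<Rightarrow> 'e" where
  "cvel c \<gamma> t = to_coord A c (\<gamma> t) (velocity A \<gamma> t)"

lemma cvel_eqI:
  assumes "c \<in> A" "continuous_on {0..1} \<gamma>" "t \<in> {0..1}" "\<gamma> t \<in> fst c"
    and x': "((\<lambda>\<tau>. snd c (\<gamma> \<tau>)) has_vector_derivative x') (at t within {0..1})"
  shows "cvel c \<gamma> t = x'"
proof -
  let ?d = "chart_at A (\<gamma> t)"
  have cont: "continuous (at t within {0..1}) \<gamma>"
    using assms(2,3) continuous_on_eq_continuous_within by blast
  have "((\<lambda>\<tau>. snd ?d (\<gamma> \<tau>)) has_derivative (\<lambda>h. transition c ?d (\<gamma> t) (h *\<^sub>R x'))) (at t within {0..1})"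
    by (rule change_chart[OF assms(1) chart_at(1) assms(4) chart_at(2) assms(3) cont x'[unfolded has_vector_derivative_def]])
  then have "((\<lambda>\<tau>. snd ?d (\<gamma> \<tau>)) has_vector_derivative transition c ?d (\<gamma> t) x') (at t within {0..1})"
    unfolding has_vector_derivative_def
    by (simp add: linear_scale[OF linear_transition[OF assms(1) chart_at(1) assms(4) chart_at(2)]])
  then have "velocity A \<gamma> t = transition c ?d (\<gamma> t) x'"
    unfolding velocity_def o_def by (rule vector_derivative_within[OF at_within_01_nontrivial[OF assms(3)]])
  then show ?thesis
    unfolding cvel_def to_coord_transition by (simp add: transition_comp assms chart_at transition_self)
qed

text \<open>The geodesic equation as a first-order system for position and velocity, the form in
  which Gronwall and the rule \<open>G_along_curve\<close> apply.\<close>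

lemma geodesic_coord:
  assumes "geodesic_from A g p v \<gamma>" "c \<in> A" "t \<in> {0..1}" "\<gamma> t \<in> fst c"
  shows "((\<lambda>\<tau>. snd c (\<gamma> \<tau>)) has_vector_derivative cvel c \<gamma> t) (at t within {0..1})" (is ?x)
    and "(cvel c \<gamma> has_vector_derivative
           - coord_metric.chr (gram A g c) (snd c (\<gamma> t)) (cvel c \<gamma> t) (cvel c \<gamma> t)) (at t within {0..1})"
proof -
  have cont: "continuous_on {0..1} \<gamma>" and par: "parallel_along A g \<gamma> (velocity A \<gamma>)"
    using assms(1) unfolding geodesic_from_def by auto
  from par assms have d: "(\<lambda>\<tau>. snd c (\<gamma> \<tau>)) differentiable (at t within {0..1})"
    and y: "(cvel c \<gamma> has_vector_derivative - christoffel A g c (snd c (\<gamma> t))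
               (vector_derivative (\<lambda>\<tau>. snd c (\<gamma> \<tau>)) (at t within {0..1})) (cvel c \<gamma> t)) (at t within {0..1})"
    unfolding parallel_along_def cvel_def[abs_def] o_def by auto
  have "cvel c \<gamma> t = vector_derivative (\<lambda>\<tau>. snd c (\<gamma> \<tau>)) (at t within {0..1})"
    by (rule cvel_eqI[OF assms(2) cont assms(3,4)]) (use d vector_derivative_works in blast)
  with d y show ?x and "(cvel c \<gamma> has_vector_derivative
           - coord_metric.chr (gram A g c) (snd c (\<gamma> t)) (cvel c \<gamma> t) (cvel c \<gamma> t)) (at t within {0..1})"
    using vector_derivative_works by (auto simp: christoffel_chr[OF assms(2)])
qed

lemma geodesic_continuous:
  "geodesic_from A g p v \<gamma> \<Longrightarrow> t \<in> {0..1} \<Longrightarrow> continuous (at t within {0..1}) \<gamma>"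
  unfolding geodesic_from_def using continuous_on_eq_continuous_within by blast

text \<open>The derivative is computed in a chart chosen anew at each t; its vanishing at every
  point of the interval is enough for constancy.\<close>

lemma geodesic_speed:
  assumes \<gamma>: "geodesic_from A g p v \<gamma>" and t: "t \<in> {0..1}"
  shows "g (\<gamma> t) (velocity A \<gamma> t) (velocity A \<gamma> t) = g p v v"
proof -
  define e where "e t = g (\<gamma> t) (velocity A \<gamma> t) (velocity A \<gamma> t)" for t
  have "(e has_derivative (\<lambda>h. 0)) (at t within {0..1})" if t: "t \<in> {0..1}" for t
  proof -
    let ?c = "chart_at A (\<gamma> t)"
    interpret coord_metric "snd ?c ` fst ?c" "gram A g ?c" by (rule coord_metric[OF chart_at(1)])
    have S: "snd ?c (\<gamma> t) \<in> snd ?c ` fst ?c" using chart_at(2) by blast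
    note D = G_along_curve[OF geodesic_coord(1)[OF \<gamma> chart_at(1) t chart_at(2)]
      geodesic_coord(2)[OF \<gamma> chart_at(1) t chart_at(2)] geodesic_coord(2)[OF \<gamma> chart_at(1) t chart_at(2)] t S]
    let ?x = "snd ?c (\<gamma> t)" and ?y = "cvel ?c \<gamma> t"
    \<comment> \<open>Compatibility of the connection with the metric: on the diagonal the defining
      identity of \<open>chr\<close> reads 2 G(chr y y, y) = dG y y y, so the two acceleration terms
      cancel the first one.\<close>
    have "dG ?x ?y ?y ?y + gram A g ?c ?x (- chr ?x ?y ?y) ?y + gram A g ?c ?x ?y (- chr ?x ?y ?y) = 0"
      using chr_eq[OF S, of ?y ?y ?y] G_commute[OF S, of ?y "- chr ?x ?y ?y"]
      by (simp add: linear_neg[OF linear_G(1)[OF S]])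
    with D have D0: "((\<lambda>\<tau>. gram A g ?c (snd ?c (\<gamma> \<tau>)) (cvel ?c \<gamma> \<tau>) (cvel ?c \<gamma> \<tau>)) has_derivative (\<lambda>h. 0)) (at t within {0..1})"
      by (simp add: has_field_derivative_def lambda_zero)
    have "\<forall>\<^sub>F \<tau> in at t within {0..1}. gram A g ?c (snd ?c (\<gamma> \<tau>)) (cvel ?c \<gamma> \<tau>) (cvel ?c \<gamma> \<tau>) = e \<tau>"
      using eventually_in_chart[OF chart_at(1) chart_at(2) geodesic_continuous[OF \<gamma> t]]
      by eventually_elim (simp add: cvel_def e_def gram_to_coord chart_at)
    then show ?thesis
      by (rule has_derivative_transform_eventually[OF D0 _ _ t]) (simp add: cvel_def e_def gram_to_coord chart_at)
  qed
  then have "\<exists>k. \<forall>t\<in>{0..1}. e t = k"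
    by (intro has_derivative_zero_constant) auto
  then have "e t = e 0" using t by auto
  then show ?thesis using \<gamma> by (simp add: e_def geodesic_from_def)
qed

text \<open>Geodesics are parametrised by [0,1] throughout, so the initial vector r v is realised by
  slowing down; r = 0 gives the constant curve. This makes \<open>exp_map\<close> at r v the point
  \<gamma> r.\<close>

lemma geodesic_rescale:
  assumes \<gamma>: "geodesic_from A g p v \<gamma>" and r: "r \<in> {0..1}"
  shows "geodesic_from A g p (r *\<^sub>R v) (\<lambda>\<tau>. \<gamma> (r * \<tau>))"
proof -
  let ?\<delta> = "\<lambda>\<tau>. \<gamma> (r * \<tau>)"
  have rt: "r * t \<in> {0..1}" if "t \<in> {0..1}" for t using that r by (auto intro: mult_le_one)
  have cont: "continuous_on {0..1} ?\<delta>"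
    by (rule continuous_on_compose2[of "{0..1}" \<gamma>]) (use \<gamma> rt in \<open>auto simp: geodesic_from_def intro!: continuous_intros\<close>)
  have x: "((\<lambda>\<tau>. snd c (?\<delta> \<tau>)) has_vector_derivative r *\<^sub>R cvel c \<gamma> (r * t)) (at t within {0..1})"
    if "c \<in> A" "t \<in> {0..1}" "\<gamma> (r * t) \<in> fst c" for c t
    by (rule has_vector_derivative_rescale[OF geodesic_coord(1)[OF \<gamma> that(1) rt[OF that(2)] that(3)] r that(2)])
  have cv: "cvel c ?\<delta> t = r *\<^sub>R cvel c \<gamma> (r * t)"
    if "c \<in> A" "t \<in> {0..1}" "\<gamma> (r * t) \<in> fst c" for c t
    by (rule cvel_eqI[OF that(1) cont that(2) _ x[OF that]]) (rule that(3))
  have "parallel_along A g ?\<delta> (velocity A ?\<delta>)"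
    unfolding parallel_along_def o_def
  proof (intro ballI impI conjI)
    fix c t assume c: "c \<in> A" and t: "t \<in> {0..1::real}" and ct: "\<gamma> (r * t) \<in> fst c"
    interpret coord_metric "snd c ` fst c" "gram A g c" by (rule coord_metric[OF c])
    have S: "snd c (\<gamma> (r * t)) \<in> snd c ` fst c" using ct by blast
    show "(\<lambda>\<tau>. snd c (\<gamma> (r * \<tau>))) differentiable (at t within {0..1})"
      using x[OF c t ct] differentiableI_vector by blast
    have vd: "vector_derivative (\<lambda>\<tau>. snd c (\<gamma> (r * \<tau>))) (at t within {0..1}) = r *\<^sub>R cvel c \<gamma> (r * t)"
      by (rule vector_derivative_within[OF at_within_01_nontrivial[OF t] x[OF c t ct]])
    have "((\<lambda>\<tau>. r *\<^sub>R cvel c \<gamma> (r * \<tau>)) has_vector_derivative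
        r *\<^sub>R r *\<^sub>R - chr (snd c (\<gamma> (r * t))) (cvel c \<gamma> (r * t)) (cvel c \<gamma> (r * t))) (at t within {0..1})"
      by (rule bounded_linear.has_vector_derivative[OF bounded_linear_scaleR_right
            has_vector_derivative_rescale[OF geodesic_coord(2)[OF \<gamma> c rt[OF t] ct] r t]])
    also have "r *\<^sub>R r *\<^sub>R - chr (snd c (\<gamma> (r * t))) (cvel c \<gamma> (r * t)) (cvel c \<gamma> (r * t)) =
        - christoffel A g c (snd c (\<gamma> (r * t))) (r *\<^sub>R cvel c \<gamma> (r * t)) (cvel c ?\<delta> t)"
      by (simp add: christoffel_chr[OF c] cv[OF c t ct] chr_scale[OF S])
    finally have D: "((\<lambda>\<tau>. r *\<^sub>R cvel c \<gamma> (r * \<tau>)) has_vector_derivative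
        - christoffel A g c (snd c (\<gamma> (r * t))) (r *\<^sub>R cvel c \<gamma> (r * t)) (cvel c ?\<delta> t)) (at t within {0..1})" .
    have "continuous (at t within {0..1}) ?\<delta>" using cont t continuous_on_eq_continuous_within by blast
    from eventually_in_chart[where X="?\<delta>", OF c ct this]
    have "\<forall>\<^sub>F \<tau> in at t within {0..1}. \<gamma> (r * \<tau>) \<in> fst c \<and> \<tau> \<in> {0..1}"
      by (auto simp: eventually_at_filter elim: eventually_mono)
    then have "\<forall>\<^sub>F \<tau> in at t within {0..1}. r *\<^sub>R cvel c \<gamma> (r * \<tau>) = cvel c ?\<delta> \<tau>"
      by eventually_elim (simp add: cv c)
    then have "(cvel c ?\<delta> has_vector_derivative
        - christoffel A g c (snd c (\<gamma> (r * t))) (r *\<^sub>R cvel c \<gamma> (r * t)) (cvel c ?\<delta> t)) (at t within {0..1})"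
      unfolding has_vector_derivative_def
      by (rule has_derivative_transform_eventually[OF D[unfolded has_vector_derivative_def] _ _ t])
        (rule cv[OF c t ct, symmetric])
    then show "((\<lambda>\<tau>. to_coord A c (\<gamma> (r * \<tau>)) (velocity A ?\<delta> \<tau>)) has_vector_derivative
        - christoffel A g c (snd c (\<gamma> (r * t)))
          (vector_derivative (\<lambda>\<tau>. snd c (\<gamma> (r * \<tau>))) (at t within {0..1}))
          (to_coord A c (\<gamma> (r * t)) (velocity A ?\<delta> t))) (at t within {0..1})"
      unfolding vd cvel_def[abs_def] .
  qed
  moreover have "velocity A ?\<delta> 0 = r *\<^sub>R v"
  proof -
    have "cvel (chart_at A (\<gamma> 0)) ?\<delta> 0 = r *\<^sub>R cvel (chart_at A (\<gamma> 0)) \<gamma> 0"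
      using cv[of "chart_at A (\<gamma> 0)" 0] chart_at by simp
    then show ?thesis using \<gamma> by (simp add: cvel_def to_coord_chart_at geodesic_from_def)
  qed
  ultimately show ?thesis using cont \<gamma> unfolding geodesic_from_def by simp
qed

text \<open>Near t0 both curves have position and velocity in a set on which the quadratic
  Christoffel term is Lipschitz, so their squared distance in phase space satisfies the hypothesis
  of \<open>gronwall_zero\<close>.\<close>

lemma geodesic_agree_locally:
  assumes \<gamma>1: "geodesic_from A g p v \<gamma>1" and \<gamma>2: "geodesic_from A g p' v' \<gamma>2" and t0: "t0 \<in> {0..1}"
    and eq: "\<gamma>1 t0 = \<gamma>2 t0" "velocity A \<gamma>1 t0 = velocity A \<gamma>2 t0"
  shows "\<forall>\<^sub>F t in at t0 within {0..1}. \<gamma>1 t = \<gamma>2 t \<and> velocity A \<gamma>1 t = velocity A \<gamma>2 t"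
proof -
  define c where "c = chart_at A (\<gamma>1 t0)"
  have c: "c \<in> A" "\<gamma>1 t0 \<in> fst c" "\<gamma>2 t0 \<in> fst c" using chart_at[of "\<gamma>1 t0"] by (auto simp: c_def eq(1)[symmetric])
  interpret coord_metric "snd c ` fst c" "gram A g c" by (rule coord_metric[OF c(1)])
  \<comment> \<open>The margin 1 leaves room for both velocities, which agree at t0, to stay below R
    nearby.\<close>
  define R where "R = norm (cvel c \<gamma>1 t0) + 1"
  have S0: "snd c (\<gamma>1 t0) \<in> snd c ` fst c" and R0: "R \<ge> 0" using c by (auto simp: R_def)
  obtain r C where rC: "r > 0" "C \<ge> 0" "cball (snd c (\<gamma>1 t0)) r \<subseteq> snd c ` fst c"
    and lip: "\<And>x1 x2 (y1::'e) (y2::'e). x1 \<in> cball (snd c (\<gamma>1 t0)) r \<Longrightarrow> x2 \<in> cball (snd c (\<gamma>1 t0)) r \<Longrightarrow> norm y1 \<le> R \<Longrightarrow> norm y2 \<le> R \<Longrightarrow>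
       norm (chr x1 y1 y1 - chr x2 y2 y2) \<le> C * (norm (x1 - x2) + norm (y1 - y2))"
    using chr_local_lipschitz[OF S0 R0] by blast
  define good where "good \<gamma> t \<longleftrightarrow> \<gamma> t \<in> fst c \<and> snd c (\<gamma> t) \<in> cball (snd c (\<gamma>1 t0)) r \<and> norm (cvel c \<gamma> t) \<le> R"
    for \<gamma> t
  have ev: "\<forall>\<^sub>F t in at t0 within {0..1}. good \<gamma> t"
    if \<gamma>: "geodesic_from A g q u \<gamma>" and e: "\<gamma> t0 = \<gamma>1 t0" "velocity A \<gamma> t0 = velocity A \<gamma>1 t0" for \<gamma> q u
  proof -
    have ct: "\<gamma> t0 \<in> fst c" using c e by simp
    have cv0: "cvel c \<gamma> t0 = cvel c \<gamma>1 t0" using e by (simp add: cvel_def)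
    have "\<forall>\<^sub>F t in at t0 within {0..1}. \<gamma> t \<in> fst c"
      by (rule eventually_in_chart[OF c(1) ct geodesic_continuous[OF \<gamma> t0]])
    moreover have "((\<lambda>t. snd c (\<gamma> t)) \<longlongrightarrow> snd c (\<gamma>1 t0)) (at t0 within {0..1})"
      using has_vector_derivative_continuous[OF geodesic_coord(1)[OF \<gamma> c(1) t0 ct]] e by (simp add: continuous_within)
    then have "\<forall>\<^sub>F t in at t0 within {0..1}. dist (snd c (\<gamma> t)) (snd c (\<gamma>1 t0)) < r"
      using rC(1) tendstoD by blast
    moreover have "((\<lambda>t. norm (cvel c \<gamma> t)) \<longlongrightarrow> norm (cvel c \<gamma>1 t0)) (at t0 within {0..1})"
      using has_vector_derivative_continuous[OF geodesic_coord(2)[OF \<gamma> c(1) t0 ct]] cv0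
      by (intro tendsto_norm) (simp add: continuous_within)
    then have "\<forall>\<^sub>F t in at t0 within {0..1}. norm (cvel c \<gamma> t) < R"
      by (rule order_tendstoD(2)) (simp add: R_def)
    ultimately show ?thesis
      by eventually_elim (simp add: good_def dist_commute)
  qed
  have "\<forall>\<^sub>F t in at t0 within {0..1}. good \<gamma>1 t \<and> good \<gamma>2 t"
    using ev[OF \<gamma>1 refl refl] ev[OF \<gamma>2] eq by (auto intro: eventually_conj)
  then obtain d where d: "d > 0" "\<And>t. t \<in> {0..1} \<Longrightarrow> t \<noteq> t0 \<Longrightarrow> dist t t0 < d \<Longrightarrow> good \<gamma>1 t \<and> good \<gamma>2 t"
    unfolding eventually_at by blast
  have good0: "good \<gamma>1 t0" "good \<gamma>2 t0" using c eq rC by (auto simp: good_def R_def cvel_def)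
  \<comment> \<open>Half of d, so that the closed interval stays strictly within distance d of t0;
    the clipping keeps it in [0,1].\<close>
  define a b where "a = max 0 (t0 - d / 2)" and "b = min 1 (t0 + d / 2)"
  have ab: "{a..b} \<subseteq> {0..1}" "t0 \<in> {a..b}" using t0 d by (auto simp: a_def b_def)
  have good: "good \<gamma>1 t" "good \<gamma>2 t" if "t \<in> {a..b}" for t
  proof -
    have "dist t t0 < d" using that d(1) unfolding a_def b_def dist_real_def by (auto simp: abs_if max_def min_def split: if_splits)
    then show "good \<gamma>1 t" "good \<gamma>2 t" using d(2)[of t] that ab good0 by (cases "t = t0"; auto)+
  qed
  let ?x = "\<lambda>t. snd c (\<gamma>1 t) - snd c (\<gamma>2 t)" and ?y = "\<lambda>t. cvel c \<gamma>1 t - cvel c \<gamma>2 t"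
  let ?z = "\<lambda>t. - chr (snd c (\<gamma>1 t)) (cvel c \<gamma>1 t) (cvel c \<gamma>1 t) - - chr (snd c (\<gamma>2 t)) (cvel c \<gamma>2 t) (cvel c \<gamma>2 t)"
  define D where "D t = ?x t \<bullet> ?x t + ?y t \<bullet> ?y t" for t
  let ?D' = "\<lambda>t. 2 * (?x t \<bullet> ?y t) + 2 * (?y t \<bullet> ?z t)"
  \<comment> \<open>The 1 comes from 2 x.y \<le> |x|^2 + |y|^2, the 3 C from 2 C |y| (|x| + |y|)
    \<le> 3 C (|x|^2 + |y|^2).\<close>
  have D': "(D has_real_derivative ?D' t) (at t within {a..b})" "\<bar>?D' t\<bar> \<le> (1 + 3 * C) * D t"
    if t: "t \<in> {a..b}" for t
  proof -
    have t01: "t \<in> {0..1}" using ab t by blast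
    have ct: "\<gamma>1 t \<in> fst c" "\<gamma>2 t \<in> fst c" using good[OF t] by (auto simp: good_def)
    have "(D has_real_derivative 2 * (?x t \<bullet> ?y t) + 2 * (?y t \<bullet> ?z t)) (at t within {0..1})"
      unfolding D_def
      by (intro DERIV_add has_real_derivative_inner_self has_vector_derivative_diff
          geodesic_coord[OF \<gamma>1 c(1) t01 ct(1)] geodesic_coord[OF \<gamma>2 c(1) t01 ct(2)])
    then show "(D has_real_derivative 2 * (?x t \<bullet> ?y t) + 2 * (?y t \<bullet> ?z t)) (at t within {a..b})"
      using ab(1) DERIV_subset by blast
    have z: "norm (?z t) \<le> C * (norm (?x t) + norm (?y t))"
      using lip[of "snd c (\<gamma>1 t)" "snd c (\<gamma>2 t)" "cvel c \<gamma>1 t" "cvel c \<gamma>2 t"] good[OF t]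
      by (simp add: good_def norm_minus_commute)
    define X Y where "X = norm (?x t)" and "Y = norm (?y t)"
    have XY: "X \<ge> 0" "Y \<ge> 0" "D t = X\<^sup>2 + Y\<^sup>2" by (auto simp: X_def Y_def D_def power2_norm_eq_inner)
    have s: "2 * X * Y \<le> X\<^sup>2 + Y\<^sup>2" using sum_squares_bound[of X Y] .
    have "\<bar>?x t \<bullet> ?y t\<bar> \<le> X * Y" unfolding X_def Y_def by (rule Cauchy_Schwarz_ineq2)
    moreover have "\<bar>?y t \<bullet> ?z t\<bar> \<le> Y * (C * (X + Y))"
      using order_trans[OF Cauchy_Schwarz_ineq2 mult_left_mono[OF z]] by (simp add: X_def Y_def)
    moreover have "2 * (Y * (C * (X + Y))) \<le> 3 * C * (X\<^sup>2 + Y\<^sup>2)"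
    proof -
      have "C * (2 * X * Y + 2 * Y\<^sup>2) \<le> C * (3 * (X\<^sup>2 + Y\<^sup>2))"
      proof (rule mult_left_mono[OF _ rC(2)])
        show "2 * X * Y + 2 * Y\<^sup>2 \<le> 3 * (X\<^sup>2 + Y\<^sup>2)"
          using s zero_le_power2[of X] zero_le_power2[of Y] by argo
      qed
      then show ?thesis by (simp add: algebra_simps power2_eq_square)
    qed
    ultimately show "\<bar>2 * (?x t \<bullet> ?y t) + 2 * (?y t \<bullet> ?z t)\<bar> \<le> (1 + 3 * C) * D t"
    proof -
      have arith: "\<bar>2 * p + 2 * q\<bar> \<le> (1 + k) * d" if "\<bar>p\<bar> \<le> x" "\<bar>q\<bar> \<le> y" "2 * y \<le> k * d" "2 * x \<le> d"
        for p q x y k d :: real using that unfolding distrib_right by linarith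
      assume "\<bar>?x t \<bullet> ?y t\<bar> \<le> X * Y" "\<bar>?y t \<bullet> ?z t\<bar> \<le> Y * (C * (X + Y))"
        "2 * (Y * (C * (X + Y))) \<le> 3 * C * (X\<^sup>2 + Y\<^sup>2)"
      then show ?thesis using s unfolding XY(3) by (intro arith) (simp_all add: mult.assoc)
    qed
  qed
  have D0: "D t = 0" if t: "t \<in> {a..b}" for t
    using gronwall_zero[OF D'(1) D'(2) _ ab(2) _ t] eq by (simp add: D_def cvel_def)
  have "\<gamma>1 t = \<gamma>2 t \<and> velocity A \<gamma>1 t = velocity A \<gamma>2 t" if t: "t \<in> {a..b}" for t
  proof -
    have ct: "\<gamma>1 t \<in> fst c" "\<gamma>2 t \<in> fst c" using good[OF t] by (auto simp: good_def)
    have "?x t \<bullet> ?x t = 0" "?y t \<bullet> ?y t = 0"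
      using D0[OF t] inner_ge_zero[of "?x t"] inner_ge_zero[of "?y t"] unfolding D_def by linarith+
    then have xy: "snd c (\<gamma>1 t) = snd c (\<gamma>2 t)" "cvel c \<gamma>1 t = cvel c \<gamma>2 t" by auto
    then have e: "\<gamma>1 t = \<gamma>2 t" using chart_inv[OF c(1) ct(1)] chart_inv[OF c(1) ct(2)] by metis
    then show ?thesis using xy(2) of_to_coord[OF c(1) ct(1)] unfolding cvel_def by metis
  qed
  moreover have "\<forall>\<^sub>F t in at t0 within {0..1}. t \<in> {a..b}"
    unfolding eventually_at by (rule exI[of _ "d / 2"]) (use d(1) in \<open>auto simp: a_def b_def dist_real_def abs_if field_simps split: if_splits\<close>)
  ultimately show ?thesis by (auto elim: eventually_mono)
qed

text \<open>Makes disagreement of two curves an open condition, by the Hausdorff property.\<close>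

lemma tendsto_separate:
  fixes f h :: "'a \<Rightarrow> 'b::t2_space"
  assumes "(f \<longlongrightarrow> l) F" "(h \<longlongrightarrow> k) F" "l \<noteq> k"
  shows "\<forall>\<^sub>F x in F. f x \<noteq> h x"
proof -
  obtain U V where "open U" "open V" "l \<in> U" "k \<in> V" "U \<inter> V = {}" using hausdorff[OF assms(3)] by blast
  then have "\<forall>\<^sub>F x in F. f x \<in> U" "\<forall>\<^sub>F x in F. h x \<in> V" using assms topological_tendstoD by blast+
  then show ?thesis by eventually_elim (use \<open>U \<inter> V = {}\<close> in auto)
qed

text \<open>Continuation by connectedness of [0,1]: agreement of position and velocity is open by
  local uniqueness, and disagreement is open by separation of limits. Where the positions coincide,
  the velocities are separated in a common chart.\<close>

lemma geodesic_unique: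
  assumes \<gamma>1: "geodesic_from A g p v \<gamma>1" and \<gamma>2: "geodesic_from A g p v \<gamma>2" and t: "t \<in> {0..1}"
  shows "\<gamma>1 t = \<gamma>2 t"
proof -
  define P where "P t \<longleftrightarrow> \<gamma>1 t = \<gamma>2 t \<and> velocity A \<gamma>1 t = velocity A \<gamma>2 t" for t
  have "\<forall>\<^sub>F t in at t0 within {0..1}. P t0 = P t" if t0: "t0 \<in> {0..1}" for t0
  proof (cases "P t0")
    case True
    then have "\<forall>\<^sub>F t in at t0 within {0..1}. P t"
      using geodesic_agree_locally[OF \<gamma>1 \<gamma>2 t0] unfolding P_def by simp
    then show ?thesis by eventually_elim (use True in simp)
  next
    case False
    have "\<forall>\<^sub>F t in at t0 within {0..1}. \<not> P t"
    proof (cases "\<gamma>1 t0 = \<gamma>2 t0")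
      case ne: False
      have "\<forall>\<^sub>F t in at t0 within {0..1}. \<gamma>1 t \<noteq> \<gamma>2 t"
        by (rule tendsto_separate[OF _ _ ne])
          (use geodesic_continuous[OF \<gamma>1 t0] geodesic_continuous[OF \<gamma>2 t0] in \<open>auto simp: continuous_within\<close>)
      then show ?thesis by eventually_elim (simp add: P_def)
    next
      case True
      define c where "c = chart_at A (\<gamma>1 t0)"
      have c: "c \<in> A" "\<gamma>1 t0 \<in> fst c" "\<gamma>2 t0 \<in> fst c" using chart_at[of "\<gamma>1 t0"] by (auto simp: c_def True[symmetric])
      have "cvel c \<gamma>1 t0 \<noteq> cvel c \<gamma>2 t0"
        using False True of_to_coord[OF c(1,2)] unfolding P_def cvel_def by metis
      then have "\<forall>\<^sub>F t in at t0 within {0..1}. cvel c \<gamma>1 t \<noteq> cvel c \<gamma>2 t"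
        by (rule tendsto_separate[rotated 2])
          (use has_vector_derivative_continuous[OF geodesic_coord(2)[OF \<gamma>1 c(1) t0 c(2)]]
             has_vector_derivative_continuous[OF geodesic_coord(2)[OF \<gamma>2 c(1) t0 c(3)]] in \<open>auto simp: continuous_within\<close>)
      then show ?thesis by eventually_elim (auto simp: P_def cvel_def)
    qed
    then show ?thesis by eventually_elim (use False in simp)
  qed
  then have "P 0 = P t" using connected_local_const[of "{0..1::real}" 0 t P] t by auto
  moreover have "P 0" using \<gamma>1 \<gamma>2 by (simp add: P_def geodesic_from_def)
  ultimately show ?thesis by (simp add: P_def)
qed

lemma exp_map_geodesic:
  assumes "geodesic_from A g p v \<gamma>"
  shows "exp_map A g p v = \<gamma> 1"
  unfolding exp_map_def
proof (rule the_equality)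
  show "\<exists>\<gamma>'. geodesic_from A g p v \<gamma>' \<and> \<gamma>' 1 = \<gamma> 1" using assms by blast
  fix q assume "\<exists>\<gamma>'. geodesic_from A g p v \<gamma>' \<and> \<gamma>' 1 = q"
  then obtain \<gamma>' where "geodesic_from A g p v \<gamma>'" "\<gamma>' 1 = q" by blast
  then show "q = \<gamma> 1" using geodesic_unique[OF assms, of \<gamma>' 1] by simp
qed

lemma exp_map_ray:
  assumes "geodesic_from A g p v \<gamma>" "r \<in> {0..1}"
  shows "exp_map A g p (r *\<^sub>R v) = \<gamma> r"
  using exp_map_geodesic[OF geodesic_rescale[OF assms]] by simp

end

section \<open>The Gauss lemma\<close>

text \<open>The part of (ii) that concerns a single centre p. \<open>ball_dom\<close> provides a
  geodesic for every vector of the ball, so that values of \<open>exp_map\<close> there are end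
  points of actual geodesics.\<close>

locale normal_ball = riemannian +
  fixes p and \<rho> :: real
  assumes \<rho>: "\<rho> > 0"
    and ball_dom: "tball g p \<rho> \<subseteq> exp_dom A g p"
    and diffeo: "diffeomorphism_on A (tball g p \<rho>) (exp_map A g p)"
begin

abbreviation B where "B \<equiv> tball g p \<rho>"
abbreviation E where "E \<equiv> exp_map A g p"

lemma B_iff: "v \<in> B \<longleftrightarrow> sqrt (g p v v) < \<rho>"
  unfolding tball_def tnorm_def by simp

lemma zero_in_B: "0 \<in> B"
  using \<rho> by (simp add: B_iff g_simps)

lemma open_B: "open B"
proof -
  have "bounded_bilinear (g p)" using bilinear_g bilinear_conv_bounded_bilinear by blast
  then have "continuous_on UNIV (\<lambda>v. g p v v)"
    by (rule bounded_bilinear.continuous_on[OF _ continuous_on_id continuous_on_id])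
  then show ?thesis unfolding tball_def tnorm_def
    by (intro open_Collect_less continuous_intros) auto
qed

lemma scale_in_B: "v \<in> B \<Longrightarrow> s \<in> {0..1} \<Longrightarrow> s *\<^sub>R v \<in> B"
proof -
  assume v: "v \<in> B" and s: "s \<in> {0..1}"
  have "sqrt (g p (s *\<^sub>R v) (s *\<^sub>R v)) = s * sqrt (g p v v)"
    using s by (simp add: g_simps real_sqrt_mult real_sqrt_abs2)
  also have "\<dots> \<le> 1 * sqrt (g p v v)" using s by (intro mult_right_mono) (auto simp: g_nonneg)
  finally show ?thesis using v unfolding B_iff by linarith
qed

lemma E_inj: "inj_on E B" and E_cont: "continuous_on B E"
  and E_smooth: "c \<in> A \<Longrightarrow> smooth_on {v\<in>B. E v \<in> fst c} (snd c \<circ> E)"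
  and E_inv_smooth: "c \<in> A \<Longrightarrow> smooth_on (snd c ` (fst c \<inter> E ` B)) (inv_into B E \<circ> chart_inv c)"
  using diffeo unfolding diffeomorphism_on_def by auto

section \<open>Derivatives of the exponential map in charts\<close>

definition U where "U c = {v\<in>B. E v \<in> fst c}"

lemma open_U: "c \<in> A \<Longrightarrow> open (U c)"
  using continuous_open_preimage[OF E_cont open_B open_chart, of c] unfolding U_def vimage_def Int_def by simp

text \<open>First and second derivatives of the exponential map read in the chart c. In
  \<open>D2\<close> the last argument is the direction of the second differentiation.\<close>

definition D where "D c z a = frechet_derivative (\<lambda>v. snd c (E v)) (at z) a"
definition D2 where "D2 c z a w = frechet_derivative (\<lambda>v. D c v a) (at z) w"

lemma smooth_coord: "c \<in> A \<Longrightarrow> smooth_on (U c) (\<lambda>v. snd c (E v))"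
  using E_smooth unfolding U_def o_def .

lemma D_has_derivative: "c \<in> A \<Longrightarrow> z \<in> U c \<Longrightarrow> ((\<lambda>v. snd c (E v)) has_derivative D c z) (at z)"
  using smooth_on_has_derivative[OF smooth_coord] unfolding D_def[abs_def] by blast

lemma D2_has_derivative: "c \<in> A \<Longrightarrow> z \<in> U c \<Longrightarrow> ((\<lambda>v. D c v a) has_derivative D2 c z a) (at z)"
  unfolding D2_def[abs_def] D_def[abs_def]
  by (rule smooth_on_has_derivative[OF smooth_on_frechet_derivative[OF smooth_coord]])

lemma linear_D: "c \<in> A \<Longrightarrow> z \<in> U c \<Longrightarrow> linear (D c z)"
  using D_has_derivative has_derivative_linear by blast

lemma linear_D2: "c \<in> A \<Longrightarrow> z \<in> U c \<Longrightarrow> linear (D2 c z a)"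
  using D2_has_derivative has_derivative_linear by blast

lemma D2_commute: "c \<in> A \<Longrightarrow> z \<in> U c \<Longrightarrow> D2 c z a w = D2 c z w a"
  unfolding D2_def D_def
  by (rule smooth_on_second_derivative_symmetric[OF open_U _ smooth_coord])

lemma linear_D2_left: "c \<in> A \<Longrightarrow> z \<in> U c \<Longrightarrow> linear (\<lambda>a. D2 c z a w)"
  using linear_D2[of c z w] D2_commute[of c z _ w] by presburger

lemma D_curve:
  assumes "c \<in> A" "u t \<in> U c" "(u has_vector_derivative u') (at t within T)"
  shows "((\<lambda>\<tau>. snd c (E (u \<tau>))) has_vector_derivative D c (u t) u') (at t within T)"
  using has_derivative_compose[OF assms(3)[unfolded has_vector_derivative_def] D_has_derivative[OF assms(1,2)]]
  by (simp add: has_vector_derivative_def linear_scale[OF linear_D[OF assms(1,2)]])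

lemma D2_curve:
  assumes "c \<in> A" "u t \<in> U c" "(u has_vector_derivative u') (at t within T)"
  shows "((\<lambda>\<tau>. D c (u \<tau>) a) has_vector_derivative D2 c (u t) a u') (at t within T)"
  using has_derivative_compose[OF assms(3)[unfolded has_vector_derivative_def] D2_has_derivative[OF assms(1,2)]]
  by (simp add: has_vector_derivative_def linear_scale[OF linear_D2[OF assms(1,2)]])

lemma U_in_chart: "z \<in> U c \<Longrightarrow> E z \<in> fst c" "z \<in> U c \<Longrightarrow> z \<in> B"
  by (auto simp: U_def)

section \<open>Radial geodesics\<close>

lemma ray_obtain:
  assumes "z \<in> B"
  obtains \<gamma> where "geodesic_from A g p z \<gamma>" "\<And>\<tau>. \<tau> \<in> {0..1} \<Longrightarrow> E (\<tau> *\<^sub>R z) = \<gamma> \<tau>"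
proof -
  obtain \<gamma> where "geodesic_from A g p z \<gamma>" using ball_dom assms unfolding exp_dom_def by blast
  then show ?thesis using that exp_map_ray by blast
qed

lemma ray_velocity:
  assumes c: "c \<in> A" and z: "z \<in> B" and \<gamma>: "geodesic_from A g p z \<gamma>"
    and t: "t \<in> {0..1}" "\<gamma> t \<in> fst c"
  shows "cvel c \<gamma> t = D c (t *\<^sub>R z) z"
proof (rule cvel_eqI[where \<gamma>=\<gamma> and t=t, OF c _ t])
  show "continuous_on {0..1} \<gamma>" using \<gamma> unfolding geodesic_from_def by blast
  have eq: "E (\<tau> *\<^sub>R z) = \<gamma> \<tau>" if "\<tau> \<in> {0..1}" for \<tau> using exp_map_ray[OF \<gamma> that] .
  have U: "t *\<^sub>R z \<in> U c" using t eq scale_in_B[OF z t(1)] by (simp add: U_def)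
  have "((\<lambda>\<tau>. \<tau> *\<^sub>R z) has_vector_derivative z) (at t within {0..1})"
    by (auto intro!: derivative_eq_intros)
  from D_curve[OF c _ this] U
  have "((\<lambda>\<tau>. snd c (E (\<tau> *\<^sub>R z))) has_vector_derivative D c (t *\<^sub>R z) z) (at t within {0..1})" by simp
  then show "((\<lambda>\<tau>. snd c (\<gamma> \<tau>)) has_vector_derivative D c (t *\<^sub>R z) z) (at t within {0..1})"
    by (rule has_vector_derivative_transform[OF t(1), rotated]) (simp add: eq)
qed

text \<open>The geodesic equation of the ray with initial velocity z, taken at time 1, where its
  point is \<open>E z\<close>, its velocity \<open>D c z z\<close> and its second derivative
  \<open>D2 c z z z\<close>. Using the end point treats every z of the ball without an extra time
  parameter.\<close>

lemma ray_acceleration: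
  assumes c: "c \<in> A" and z: "z \<in> U c"
  shows "D2 c z z z = - coord_metric.chr (gram A g c) (snd c (E z)) (D c z z) (D c z z)"
proof -
  have zB: "z \<in> B" using z by (simp add: U_def)
  obtain \<gamma> where \<gamma>: "geodesic_from A g p z \<gamma>" and eq: "\<And>\<tau>. \<tau> \<in> {0..1} \<Longrightarrow> E (\<tau> *\<^sub>R z) = \<gamma> \<tau>"
    using ray_obtain[OF zB] by blast
  have e1: "\<gamma> 1 = E z" using eq[of 1] by simp
  have c1: "\<gamma> 1 \<in> fst c" using e1 U_in_chart[OF z] by simp
  have one: "(1::real) \<in> {0..1}" by simp
  have cv1: "cvel c \<gamma> 1 = D c z z" using ray_velocity[OF c zB \<gamma> one c1] by simp
  have "((\<lambda>\<tau>. \<tau> *\<^sub>R z) has_vector_derivative z) (at 1 within {0..1})"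
    by (auto intro!: derivative_eq_intros)
  from D2_curve[OF c _ this] z
  have D: "((\<lambda>\<tau>. D c (\<tau> *\<^sub>R z) z) has_vector_derivative D2 c z z z) (at 1 within {0..1})" by simp
  have ev: "\<forall>\<^sub>F \<tau> in at 1 within {0..1}. \<gamma> \<tau> \<in> fst c"
    by (rule eventually_in_chart[OF c c1 geodesic_continuous[OF \<gamma> one]])
  have "\<forall>\<^sub>F \<tau>::real in at 1 within {0..1}. \<tau> \<in> {0..1}" by (simp add: eventually_at_filter)
  with ev have "\<forall>\<^sub>F \<tau> in at 1 within {0..1}. D c (\<tau> *\<^sub>R z) z = cvel c \<gamma> \<tau>"
    by eventually_elim (simp add: ray_velocity[OF c zB \<gamma>])
  then have "(cvel c \<gamma> has_vector_derivative D2 c z z z) (at 1 within {0..1})"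
    unfolding has_vector_derivative_def
    by (rule has_derivative_transform_eventually[OF D[unfolded has_vector_derivative_def] _ _ one]) (simp add: cv1)
  from vector_derivative_unique_within[OF at_within_01_nontrivial[OF one] this geodesic_coord(2)[OF \<gamma> c one c1]]
  show ?thesis by (simp add: cv1 e1)
qed

lemma ray_energy:
  assumes c: "c \<in> A" and z: "z \<in> U c"
  shows "gram A g c (snd c (E z)) (D c z z) (D c z z) = g p z z"
proof -
  have zB: "z \<in> B" using z by (simp add: U_def)
  obtain \<gamma> where \<gamma>: "geodesic_from A g p z \<gamma>" and eq: "\<And>\<tau>. \<tau> \<in> {0..1} \<Longrightarrow> E (\<tau> *\<^sub>R z) = \<gamma> \<tau>"
    using ray_obtain[OF zB] by blast
  have e1: "\<gamma> 1 = E z" using eq[of 1] by simp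
  have c1: "\<gamma> 1 \<in> fst c" using e1 U_in_chart[OF z] by simp
  have one: "(1::real) \<in> {0..1}" by simp
  have "D c z z = to_coord A c (E z) (velocity A \<gamma> 1)"
    using ray_velocity[OF c zB \<gamma> one c1] by (simp add: cvel_def e1)
  then show ?thesis
    using gram_to_coord[OF c c1] geodesic_speed[OF \<gamma> one] by (simp add: e1)
qed

text \<open>The energy identity \<open>ray_energy\<close> holds for all vectors near z, so it may be
  differentiated at z in direction w; its right-hand side is a quadratic polynomial in the parameter
  with derivative 2 g(z, w).\<close>

lemma ray_energy_variation:
  assumes c: "c \<in> A" and z: "z \<in> U c"
  shows "2 * g p z w = coord_metric.dG (gram A g c) (snd c (E z)) (D c z w) (D c z z) (D c z z)
     + 2 * gram A g c (snd c (E z)) (D2 c z z w + D c z w) (D c z z)"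
proof -
  interpret coord_metric "snd c ` fst c" "gram A g c" by (rule coord_metric[OF c])
  have S: "snd c (E z) \<in> snd c ` fst c" using U_in_chart[OF z] by blast
  let ?u = "\<lambda>\<tau>::real. z + \<tau> *\<^sub>R w"
  have u: "(?u has_vector_derivative w) (at 0)" by (auto intro!: derivative_eq_intros)
  have u0: "?u 0 \<in> U c" using z by simp
  note X = D_curve[OF c u0 u]
  \<comment> \<open>This is \<open>D\<close> at the moving vector applied to that same vector, split
    by linearity so that each summand is differentiated with a fixed direction.\<close>
  let ?Y = "\<lambda>\<tau>. D c (?u \<tau>) z + \<tau> *\<^sub>R D c (?u \<tau>) w"
  have "(?Y has_vector_derivative D2 c (?u 0) z w + (0 *\<^sub>R D2 c (?u 0) w w + 1 *\<^sub>R D c (?u 0) w)) (at 0)"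
    by (intro has_vector_derivative_add has_vector_derivative_scaleR D2_curve[OF c u0 u] DERIV_ident)
  then have Y: "(?Y has_vector_derivative D2 c z z w + D c z w) (at 0)" by simp
  let ?e = "\<lambda>\<tau>. gram A g c (snd c (E (?u \<tau>))) (?Y \<tau>) (?Y \<tau>)"
  have "(?e has_real_derivative
      dG (snd c (E z)) (D c z w) (D c z z) (D c z z) + gram A g c (snd c (E z)) (D2 c z z w + D c z w) (D c z z)
      + gram A g c (snd c (E z)) (D c z z) (D2 c z z w + D c z w)) (at 0)"
    using G_along_curve[OF X Y Y] S by simp
  then have e: "(?e has_real_derivative
      dG (snd c (E z)) (D c z w) (D c z z) (D c z z) + 2 * gram A g c (snd c (E z)) (D2 c z z w + D c z w) (D c z z)) (at 0)"
    using G_commute[OF S, of "D c z z"] by (simp add: add.commute)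
  have "isCont ?u 0" by (intro continuous_intros)
  then have "\<forall>\<^sub>F \<tau> in at 0. ?u \<tau> \<in> U c"
    using topological_tendstoD[OF _ open_U[OF c] u0] by (simp add: isCont_def)
  then have ev: "\<forall>\<^sub>F \<tau> in at 0. ?e \<tau> = g p z z + 2 * \<tau> * g p z w + \<tau>\<^sup>2 * g p w w"
  proof eventually_elim
    case (elim \<tau>)
    have "?Y \<tau> = D c (?u \<tau>) (?u \<tau>)"
      by (simp add: linear_add[OF linear_D[OF c elim]] linear_scale[OF linear_D[OF c elim]])
    then show ?case using ray_energy[OF c elim] g_commute[of p w z]
      by (simp add: g_simps algebra_simps power2_eq_square)
  qed
  have "((\<lambda>\<tau>. g p z z + 2 * \<tau> * g p z w + \<tau>\<^sup>2 * g p w w) has_real_derivative 2 * g p z w) (at 0)"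
    by (auto intro!: derivative_eq_intros)
  moreover have "((\<lambda>\<tau>. g p z z + 2 * \<tau> * g p z w + \<tau>\<^sup>2 * g p w w) has_real_derivative
      dG (snd c (E z)) (D c z w) (D c z z) (D c z z) + 2 * gram A g c (snd c (E z)) (D2 c z z w + D c z w) (D c z z)) (at 0)"
    using e ev unfolding has_field_derivative_def
    by (rule has_derivative_transform_eventually) (use ray_energy[OF c z] in simp_all)
  ultimately show ?thesis by (rule DERIV_unique)
qed

text \<open>The differential of E at z with values in the tangent space at \<open>E z\<close>, whose
  elements are stored in the preferred chart there.\<close>

definition dE where "dE z a = D (chart_at A (E z)) z a"

lemma isCont_E: "z \<in> B \<Longrightarrow> isCont E z"
  using E_cont open_B continuous_on_eq_continuous_at by blast

lemma to_coord_dE: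
  assumes c: "c \<in> A" and z: "z \<in> U c"
  shows "to_coord A c (E z) (dE z a) = D c z a"
proof -
  let ?d = "chart_at A (E z)"
  have zB: "z \<in> B" using z by (simp add: U_def)
  then have zd: "z \<in> U ?d" using chart_at(2) by (simp add: U_def)
  have "((\<lambda>v. snd c (E v)) has_derivative (\<lambda>h. transition ?d c (E z) (D ?d z h))) (at z)"
    by (rule change_chart[OF chart_at(1) c chart_at(2) U_in_chart(1)[OF z] UNIV_I isCont_E[OF zB] D_has_derivative[OF chart_at(1) zd]])
  from has_derivative_unique[OF this D_has_derivative[OF c z]]
  show ?thesis unfolding to_coord_transition dE_def by (simp add: fun_eq_iff)
qed

lemma gram_D:
  assumes "c \<in> A" "z \<in> U c"
  shows "gram A g c (snd c (E z)) (D c z a) (D c z b) = g (E z) (dE z a) (dE z b)"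
  using gram_to_coord[OF assms(1) U_in_chart(1)[OF assms(2)], of "dE z a" "dE z b"]
  by (simp add: to_coord_dE[OF assms])

text \<open>
  Along a ray, the derivative of \<open>\<langle>dE z, dE w\<rangle>\<close> at \<open>z = s v\<close> is computed from the geodesic equation, from the
  derivative in the direction \<open>w\<close> of the constant-speed identity \<open>\<langle>dE z, dE z\<rangle> = \<langle>z, z\<rangle>\<close>, and from the symmetry of
  the second derivative. These give \<open>s\<close> times the derivative, hence the exception at \<open>s = 0\<close>.
\<close>

lemma radial_derivative:
  assumes v: "v \<in> B" and s: "s \<in> {0..1}"
  shows "\<exists>d. ((\<lambda>s. g (E (s *\<^sub>R v)) (dE (s *\<^sub>R v) (s *\<^sub>R v)) (dE (s *\<^sub>R v) w)) has_real_derivative d) (at s)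
     \<and> (s > 0 \<longrightarrow> d = g p v w)"
proof -
  define z where "z = s *\<^sub>R v"
  define c where "c = chart_at A (E z)"
  have c: "c \<in> A" unfolding c_def by (rule chart_at(1))
  have z: "z \<in> U c" using scale_in_B[OF v s] chart_at(2) by (simp add: U_def c_def z_def)
  interpret coord_metric "snd c ` fst c" "gram A g c" by (rule coord_metric[OF c])
  let ?x = "snd c (E z)"
  have S: "?x \<in> snd c ` fst c" using U_in_chart[OF z] by blast
  let ?u = "\<lambda>\<tau>::real. \<tau> *\<^sub>R v"
  have u: "(?u has_vector_derivative v) (at s)" by (auto intro!: derivative_eq_intros)
  have us: "?u s \<in> U c" using z by (simp add: z_def)
  note X = D_curve[OF c us u]
  let ?Y = "\<lambda>\<tau>. \<tau> *\<^sub>R D c (?u \<tau>) v"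
  have Y: "(?Y has_vector_derivative s *\<^sub>R D2 c (?u s) v v + 1 *\<^sub>R D c (?u s) v) (at s)"
    by (intro has_vector_derivative_scaleR D2_curve[OF c us u] DERIV_ident)
  note Z = D2_curve[OF c us u, of w]
  let ?d = "dG ?x (D c z v) (s *\<^sub>R D c z v) (D c z w) + gram A g c ?x (s *\<^sub>R D2 c z v v + D c z v) (D c z w)
      + gram A g c ?x (s *\<^sub>R D c z v) (D2 c z w v)"
  let ?e = "\<lambda>\<tau>. gram A g c (snd c (E (?u \<tau>))) (?Y \<tau>) (D c (?u \<tau>) w)"
  have e: "(?e has_real_derivative ?d) (at s)"
    using G_along_curve[OF X Y Z UNIV_I] S by (simp add: z_def)
  have "isCont ?u s" by (intro continuous_intros)
  then have "\<forall>\<^sub>F \<tau> in at s. ?u \<tau> \<in> U c"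
    using topological_tendstoD[OF _ open_U[OF c] us] by (simp add: isCont_def)
  then have ev: "\<forall>\<^sub>F \<tau> in at s. ?e \<tau> = g (E (?u \<tau>)) (dE (?u \<tau>) (?u \<tau>)) (dE (?u \<tau>) w)"
  proof eventually_elim
    case (elim \<tau>)
    show ?case using gram_D[OF c elim, of "?u \<tau>" w] by (simp add: linear_scale[OF linear_D[OF c elim]])
  qed
  have at_s: "?e s = g (E (?u s)) (dE (?u s) (?u s)) (dE (?u s) w)"
    using gram_D[OF c us, of "?u s" w] by (simp add: linear_scale[OF linear_D[OF c us]])
  have e': "((\<lambda>\<tau>. g (E (?u \<tau>)) (dE (?u \<tau>) (?u \<tau>)) (dE (?u \<tau>) w)) has_real_derivative ?d) (at s)"
    using e ev unfolding has_field_derivative_def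
    by (rule has_derivative_transform_eventually) (use at_s in simp_all)
  have "?d = g p v w" if pos: "s > 0"
  proof -
    note lin = linear_scale[OF linear_D[OF c z]] linear_scale[OF linear_D2[OF c z]] linear_scale[OF linear_D2_left[OF c z]]
      linear_scale[OF linear_dG1[OF S]] linear_scale[OF linear_dG2[OF S]] linear_scale[OF linear_dG3[OF S]]
      linear_scale[OF linear_G(1)[OF S]] linear_scale[OF linear_G(2)[OF S]]
      linear_add[OF linear_G(1)[OF S]] linear_add[OF linear_G(2)[OF S]]
    have Dz: "D c z z = s *\<^sub>R D c z v" using lin(1)[of s v] unfolding z_def[symmetric] .
    have D2z: "D2 c z z z = (s * s) *\<^sub>R D2 c z v v" "D2 c z w z = s *\<^sub>R D2 c z w v"
    proof -
      have "D2 c z (s *\<^sub>R v) (s *\<^sub>R v) = (s * s) *\<^sub>R D2 c z v v" by (simp add: lin(2,3))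
      then show "D2 c z z z = (s * s) *\<^sub>R D2 c z v v" unfolding z_def[symmetric] .
      have "D2 c z w (s *\<^sub>R v) = s *\<^sub>R D2 c z w v" by (simp add: lin(2))
      then show "D2 c z w z = s *\<^sub>R D2 c z w v" unfolding z_def[symmetric] .
    qed
    have d: "s * ?d = dG ?x (D c z z) (D c z z) (D c z w) + gram A g c ?x (D2 c z z z + D c z z) (D c z w)
      + gram A g c ?x (D c z z) (D2 c z w z)"
      unfolding Dz D2z by (simp add: lin algebra_simps)
    have a: "gram A g c ?x (D2 c z z z) (D c z w) = - gram A g c ?x (chr ?x (D c z z) (D c z z)) (D c z w)"
      unfolding ray_acceleration[OF c z] by (simp add: linear_neg[OF linear_G(1)[OF S]])
    have k: "2 * gram A g c ?x (chr ?x (D c z z) (D c z z)) (D c z w)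
        = 2 * dG ?x (D c z z) (D c z z) (D c z w) - dG ?x (D c z w) (D c z z) (D c z z)"
      unfolding chr_eq[OF S] by simp
    have b: "2 * g p z w = dG ?x (D c z w) (D c z z) (D c z z)
        + 2 * gram A g c ?x (D2 c z w z) (D c z z) + 2 * gram A g c ?x (D c z w) (D c z z)"
      using ray_energy_variation[OF c z, of w] D2_commute[OF c z, of z w] by (simp add: lin)
    have arith: "2 * (d1 + (a + r) + q) = d2 + 2 * q' + 2 * r'"
      if "a = - h" "2 * h = 2 * d1 - d2" "q = q'" "r = r'" for a h d1 d2 q q' r r' :: real
      using that(2) unfolding that(1,3,4) by (simp add: algebra_simps)
    \<comment> \<open>By the geodesic equation, the acceleration term cancels the derivative of the
      metric along the ray and leaves half of its derivative along \<open>D c z w\<close>. With the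
      other two terms this is half of the energy variation \<open>b\<close>; symmetry of
      \<open>D2\<close> has already entered through \<open>b\<close>.\<close>
    have "2 * (s * ?d) = 2 * g p z w"
      unfolding d unfolding b lin(9)
      by (rule arith[OF a k G_commute[OF S] G_commute[OF S]])
    then have "s * ?d = s * g p v w" by (simp add: z_def g_simps)
    then show ?thesis using pos by simp
  qed
  then show ?thesis using e' by blast
qed

text \<open>The pairing of dE z with dE w at z = s v vanishes at s = 0 and has constant derivative
  g(v, w) for s > 0. The mean value theorem on [0,1] needs the value of the derivative only at an
  interior point, so the exception at s = 0 is harmless.\<close>

theorem gauss_lemma:
  assumes v: "v \<in> B"
  shows "g (E v) (dE v v) (dE v w) = g p v w"
proof -
  let ?k = "\<lambda>s. g (E (s *\<^sub>R v)) (dE (s *\<^sub>R v) (s *\<^sub>R v)) (dE (s *\<^sub>R v) w)"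
  define k where "k = ?k"
  have "\<forall>s\<in>{0..1}. \<exists>d. (k has_real_derivative d) (at s) \<and> (s > 0 \<longrightarrow> d = g p v w)"
    unfolding k_def by (intro ballI radial_derivative[OF v])
  from bchoice[OF this] obtain k'
    where k': "\<And>s. s \<in> {0..1} \<Longrightarrow> (k has_real_derivative k' s) (at s) \<and> (s > 0 \<longrightarrow> k' s = g p v w)" by blast
  have "\<exists>s>0. s < 1 \<and> k 1 - k 0 = (1 - 0) * k' s"
    by (rule MVT2) (use k' in auto)
  then obtain s where "0 < s" "s < 1" "?k 1 - ?k 0 = (1 - 0) * k' s" unfolding k_def by blast
  then have "?k 1 - ?k 0 = g p v w" using k'[of s] by simp
  moreover have "?k 0 = 0"
  proof -
    have "0 \<in> U (chart_at A (E 0))" using zero_in_B chart_at(2) by (simp add: U_def)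
    then have "dE 0 0 = 0" unfolding dE_def using linear_0[OF linear_D[OF chart_at(1)]] by blast
    then show ?thesis by (simp add: g_simps)
  qed
  ultimately show ?thesis by simp
qed

lemma E_0: "E 0 = p"
proof -
  obtain \<gamma> where \<gamma>: "geodesic_from A g p 0 \<gamma>" "\<And>\<tau>. \<tau> \<in> {0..1} \<Longrightarrow> E (\<tau> *\<^sub>R 0) = \<gamma> \<tau>"
    using ray_obtain[OF zero_in_B] by blast
  then show ?thesis using \<gamma>(2)[of 0] by (simp add: geodesic_from_def)
qed

text \<open>Let u be the inverse exponential along \<gamma>. The Gauss lemma applied to u' gives
  g(u, u') = <dE u, \<gamma>'>, applied to u itself it gives |dE u| = |u|, and \<gamma> has constant
  speed |\<eta>|. Hence the derivative of |u|^2 is at most 2 |u| |\<eta>|.\<close>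

theorem exp_inv_le_geodesic:
  assumes \<gamma>: "geodesic_from A g x \<eta> \<gamma>" and ran: "\<And>\<tau>. \<tau> \<in> {0..1} \<Longrightarrow> \<gamma> \<tau> \<in> E ` B"
  shows "\<bar>tnorm g p (exp_inv A g \<rho> p (\<gamma> 1)) - tnorm g p (exp_inv A g \<rho> p (\<gamma> 0))\<bar> \<le> tnorm g x \<eta>"
proof -
  let ?u = "\<lambda>t. inv_into B E (\<gamma> t)"
  have uB: "?u t \<in> B" and Eu: "E (?u t) = \<gamma> t" if "t \<in> {0..1}" for t
    using inv_into_into[OF ran[OF that]] f_inv_into_f[OF ran[OF that]] by auto
  have ex: "\<exists>u'. (?u has_vector_derivative u') (at t within {0..1}) \<and>
      \<bar>g p (?u t) u'\<bar> \<le> tnorm g p (?u t) * tnorm g x \<eta>" if t: "t \<in> {0..1}" for t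
  proof -
    define c where "c = chart_at A (\<gamma> t)"
    have c: "c \<in> A" "\<gamma> t \<in> fst c" unfolding c_def by (rule chart_at)+
    have "snd c (\<gamma> t) \<in> snd c ` (fst c \<inter> E ` B)" using c ran[OF t] by blast
    from smooth_on_has_derivative[OF E_inv_smooth[OF c(1)] this]
    obtain h where h: "((inv_into B E \<circ> chart_inv c) has_derivative h) (at (snd c (\<gamma> t)))" by blast
    have d: "((\<lambda>\<tau>. (inv_into B E \<circ> chart_inv c) (snd c (\<gamma> \<tau>))) has_derivative (\<lambda>k. h (k *\<^sub>R cvel c \<gamma> t))) (at t within {0..1})"
      by (rule has_derivative_compose[OF geodesic_coord(1)[OF \<gamma> c(1) t c(2), unfolded has_vector_derivative_def] h])
    have ev: "\<forall>\<^sub>F \<tau> in at t within {0..1}. (inv_into B E \<circ> chart_inv c) (snd c (\<gamma> \<tau>)) = ?u \<tau>"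
      using eventually_in_chart[OF c geodesic_continuous[OF \<gamma> t]]
      by eventually_elim (simp add: chart_inv[OF c(1)])
    have "(?u has_derivative (\<lambda>k. h (k *\<^sub>R cvel c \<gamma> t))) (at t within {0..1})"
      by (rule has_derivative_transform_eventually[OF d ev _ t]) (simp add: chart_inv[OF c])
    then have u': "(?u has_vector_derivative h (cvel c \<gamma> t)) (at t within {0..1})" (is "(_ has_vector_derivative ?u') _")
      unfolding has_vector_derivative_def by (simp add: linear_scale[OF has_derivative_linear[OF h]])
    have uU: "?u t \<in> U c" using uB[OF t] Eu[OF t] c by (simp add: U_def)
    have "((\<lambda>\<tau>. snd c (E (?u \<tau>))) has_vector_derivative D c (?u t) ?u') (at t within {0..1})"
      by (rule D_curve[OF c(1) uU u'])
    then have "((\<lambda>\<tau>. snd c (\<gamma> \<tau>)) has_vector_derivative D c (?u t) ?u') (at t within {0..1})"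
      by (rule has_vector_derivative_transform[OF t, rotated]) (simp add: Eu)
    then have "cvel c \<gamma> t = D c (?u t) ?u'"
      using \<gamma> by (intro cvel_eqI[where \<gamma>=\<gamma> and t=t, OF c(1) _ t c(2)]) (auto simp: geodesic_from_def)
    then have vel: "velocity A \<gamma> t = dE (?u t) ?u'"
      unfolding cvel_def to_coord_dE[OF c(1) uU, symmetric] Eu[OF t]
      using of_to_coord[OF c] by metis
    have 1: "g p (?u t) ?u' = g (\<gamma> t) (dE (?u t) (?u t)) (velocity A \<gamma> t)"
      using gauss_lemma[OF uB[OF t], of ?u'] by (simp add: vel Eu[OF t])
    have 2: "tnorm g (\<gamma> t) (dE (?u t) (?u t)) = tnorm g p (?u t)"
      using gauss_lemma[OF uB[OF t], of "?u t"] by (simp add: tnorm_def Eu[OF t])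
    have 3: "tnorm g (\<gamma> t) (velocity A \<gamma> t) = tnorm g x \<eta>"
      using geodesic_speed[OF \<gamma> t] by (simp add: tnorm_def)
    have "\<bar>g p (?u t) ?u'\<bar> \<le> tnorm g p (?u t) * tnorm g x \<eta>"
      unfolding 1 2[symmetric] 3[symmetric] by (rule g_Cauchy_Schwarz)
    then show ?thesis using u' by blast
  qed
  then obtain u' where u': "\<And>t. t \<in> {0..1} \<Longrightarrow> (?u has_vector_derivative u' t) (at t within {0..1})"
    and bound: "\<And>t. t \<in> {0..1} \<Longrightarrow> \<bar>g p (?u t) (u' t)\<bar> \<le> tnorm g p (?u t) * tnorm g x \<eta>"
    by metis
  have bb: "bounded_bilinear (g p)" using bilinear_g bilinear_conv_bounded_bilinear by blast
  have "\<bar>sqrt (g p (?u 1) (?u 1)) - sqrt (g p (?u 0) (?u 0))\<bar> \<le> tnorm g x \<eta>"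
  proof (rule sqrt_increment_bound[where f' = "\<lambda>t. 2 * g p (?u t) (u' t)"])
    fix t :: real assume t: "t \<in> {0..1}"
    show "((\<lambda>t. g p (?u t) (?u t)) has_real_derivative 2 * g p (?u t) (u' t)) (at t within {0..1})"
      by (rule has_derivative_imp_has_field_derivative[OF bounded_bilinear.FDERIV[OF bb
            u'[OF t, unfolded has_vector_derivative_def] u'[OF t, unfolded has_vector_derivative_def]]])
         (simp add: g_simps g_commute[of p "u' t"])
    show "0 \<le> g p (?u t) (?u t)" by (rule g_nonneg)
    show "\<bar>2 * g p (?u t) (u' t)\<bar> \<le> 2 * sqrt (g p (?u t) (?u t)) * tnorm g x \<eta>"
      using bound[OF t] by (simp add: tnorm_def abs_mult)
  qed (simp add: tnorm_def g_nonneg)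
  then show ?thesis by (simp add: tnorm_def exp_inv_def)
qed

corollary exp_inv_step:
  assumes dom: "\<eta> \<in> exp_dom A g x" and ran: "\<And>\<tau>. \<tau> \<in> {0..1} \<Longrightarrow> exp_map A g x (\<tau> *\<^sub>R \<eta>) \<in> E ` B"
  shows "\<bar>tnorm g p (exp_inv A g \<rho> p (exp_map A g x \<eta>)) - tnorm g p (exp_inv A g \<rho> p x)\<bar> \<le> tnorm g x \<eta>"
proof -
  obtain \<gamma> where \<gamma>: "geodesic_from A g x \<eta> \<gamma>" using dom unfolding exp_dom_def by blast
  have ray: "exp_map A g x (\<tau> *\<^sub>R \<eta>) = \<gamma> \<tau>" if "\<tau> \<in> {0..1}" for \<tau> by (rule exp_map_ray[OF \<gamma> that])
  have "\<gamma> 0 = x" using \<gamma> by (simp add: geodesic_from_def)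
  then show ?thesis using exp_inv_le_geodesic[OF \<gamma>] ran ray ray[of 1] by simp
qed

lemma exp_inv_self: "exp_inv A g \<rho> p p = 0"
  unfolding exp_inv_def using inv_into_f_f[OF E_inj zero_in_B] by (simp add: E_0)

end

section \<open>Batch averages and gradients\<close>

lemma finite_batches: "finite (batches n b)"
  unfolding batches_def by (rule finite_subset[of _ "Pow {1..n}"]) auto

lemma card_batches: "card (batches n b) = n choose b"
  unfolding batches_def using n_subsets[of "{1..n}" b] by simp

lemma card_batches_pos: "b \<le> n \<Longrightarrow> card (batches n b) > 0"
  by (simp add: card_batches)

text \<open>Every index lies in the same fraction b / n of the batches, which is the source of
  unbiasedness.\<close>

lemma card_batches_containing:
  assumes "i \<in> {1..n}" "1 \<le> b"
  shows "b * card (batches n b) = n * card {J \<in> batches n b. i \<in> J}"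
proof -
  have "bij_betw (insert i) {J. J \<subseteq> {1..n} - {i} \<and> card J = b - 1} {J \<in> batches n b. i \<in> J}"
  proof (rule bij_betw_byWitness[where f' = "\<lambda>J. J - {i}"])
    show "insert i ` {J. J \<subseteq> {1..n} - {i} \<and> card J = b - 1} \<subseteq> {J \<in> batches n b. i \<in> J}"
    proof (intro image_subsetI)
      fix J assume "J \<in> {J. J \<subseteq> {1..n} - {i} \<and> card J = b - 1}"
      then have J: "J \<subseteq> {1..n} - {i}" "card J = b - 1" by auto
      then have "finite J" "i \<notin> J" using finite_subset by auto
      then show "insert i J \<in> {J \<in> batches n b. i \<in> J}" using J assms by (auto simp: batches_def)
    qed
    show "(\<lambda>J. J - {i}) ` {J \<in> batches n b. i \<in> J} \<subseteq> {J. J \<subseteq> {1..n} - {i} \<and> card J = b - 1}"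
      by (auto simp: batches_def card_Diff_singleton)
  qed auto
  then have "card {J \<in> batches n b. i \<in> J} = card {J. J \<subseteq> {1..n} - {i} \<and> card J = b - 1}"
    by (rule bij_betw_same_card[symmetric])
  also have "\<dots> = (n - 1) choose (b - 1)"
    using n_subsets[of "{1..n} - {i}" "b - 1"] assms by simp
  finally show ?thesis using times_binomial_minus1_eq[of b n] assms by (simp add: card_batches)
qed

text \<open>Double counting of pairs of a batch and a member. It is stated for real vector spaces
  since it serves both tangent vectors and their squared lengths.\<close>

lemma sum_batches:
  fixes x :: "nat \<Rightarrow> 'v::real_vector"
  assumes "1 \<le> b" "b \<le> n"
  shows "(\<Sum>J\<in>batches n b. (1 / real b) *\<^sub>R (\<Sum>i\<in>J. x i)) = (real (card (batches n b)) / real n) *\<^sub>R (\<Sum>i\<in>{1..n}. x i)"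
proof -
  have sub: "J \<subseteq> {1..n}" if "J \<in> batches n b" for J using that by (simp add: batches_def)
  have "sum x J = (\<Sum>i\<in>{1..n}. if i \<in> J then x i else 0)" if "J \<in> batches n b" for J
    using sum.inter_restrict[of "{1..n}" x J] sub[OF that] by (simp add: Int_absorb1)
  then have "(\<Sum>J\<in>batches n b. \<Sum>i\<in>J. x i) = (\<Sum>J\<in>batches n b. \<Sum>i\<in>{1..n}. if i \<in> J then x i else 0)"
    by (rule sum.cong[OF refl])
  also have "\<dots> = (\<Sum>i\<in>{1..n}. \<Sum>J\<in>batches n b. if i \<in> J then x i else 0)" by (rule sum.swap)
  also have "\<dots> = (\<Sum>i\<in>{1..n}. real (card {J \<in> batches n b. i \<in> J}) *\<^sub>R x i)"
    by (intro sum.cong refl, subst sum.inter_filter[OF finite_batches, symmetric])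
      (simp add: sum_constant_scaleR)
  also have "\<dots> = (\<Sum>i\<in>{1..n}. (real b * real (card (batches n b)) / real n) *\<^sub>R x i)"
  proof (intro sum.cong refl)
    fix i assume i: "i \<in> {1..n}"
    have "real b * real (card (batches n b)) = real n * real (card {J \<in> batches n b. i \<in> J})"
      using card_batches_containing[OF i assms(1)] by (metis of_nat_mult)
    then show "real (card {J \<in> batches n b. i \<in> J}) *\<^sub>R x i = (real b * real (card (batches n b)) / real n) *\<^sub>R x i"
      using i by (simp add: field_simps)
  qed
  finally have "(\<Sum>J\<in>batches n b. \<Sum>i\<in>J. x i) = (real b * real (card (batches n b)) / real n) *\<^sub>R (\<Sum>i\<in>{1..n}. x i)"
    by (simp add: scaleR_sum_right)
  then show ?thesis using assms(1) by (simp flip: scaleR_sum_right)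
qed

section \<open>Second moments of batch averages in a tangent space\<close>

context riemannian begin

lemma tnorm_sq: "(tnorm g q v)\<^sup>2 = g q v v"
  unfolding tnorm_def by (simp add: g_nonneg)

lemma g_sum_left: "g q (\<Sum>i\<in>I. z i) v = (\<Sum>i\<in>I. g q (z i) v)"
  using linear_sum[of "\<lambda>u. g q u v" z I] bilinear_g unfolding bilinear_def by blast

text \<open>The difference of the two sides is the sum of the squared pairwise differences.\<close>

lemma g_three_squares: "g q (a + b + c) (a + b + c) \<le> 3 * (g q a a + g q b b + g q c c)"
proof -
  have "0 \<le> g q (a - b) (a - b) + g q (b - c) (b - c) + g q (a - c) (a - c)" by (simp add: g_nonneg)
  then show ?thesis using g_commute[of q b a] g_commute[of q c a] g_commute[of q c b]
    by (simp add: g_simps)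
qed

text \<open>The deviations from the mean sum to zero, so the shift d has no cross term with
  them.\<close>

lemma mean_variance:
  assumes "finite J" "J \<noteq> {}" and m: "m = (1 / real (card J)) *\<^sub>R (\<Sum>i\<in>J. z i)"
  shows "(\<Sum>i\<in>J. g q (z i - m + d) (z i - m + d)) = (\<Sum>i\<in>J. g q (z i) (z i)) - real (card J) * g q m m + real (card J) * g q d d"
proof -
  have k: "real (card J) > 0" using assms by (simp add: card_gt_0_iff)
  have s: "(\<Sum>i\<in>J. z i) = real (card J) *\<^sub>R m" using k m by simp
  have "(\<Sum>i\<in>J. g q (z i - m + d) (z i - m + d)) =
     (\<Sum>i\<in>J. g q (z i) (z i) + (2 * g q (z i) (d - m)) + g q (d - m) (d - m))"
  proof (intro sum.cong refl)
    fix i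
    show "g q (z i - m + d) (z i - m + d) = g q (z i) (z i) + (2 * g q (z i) (d - m)) + g q (d - m) (d - m)"
      using g_commute[of q d "z i"] g_commute[of q m "z i"] g_commute[of q d m] by (simp add: g_simps)
  qed
  also have "\<dots> = (\<Sum>i\<in>J. g q (z i) (z i)) + 2 * g q (real (card J) *\<^sub>R m) (d - m) + real (card J) * g q (d - m) (d - m)"
    unfolding s[symmetric] by (simp add: sum.distrib g_sum_left sum_distrib_left)
  also have "\<dots> = (\<Sum>i\<in>J. g q (z i) (z i)) - real (card J) * g q m m + real (card J) * g q d d"
    using g_commute[of q d m] by (simp add: g_simps algebra_simps)
  finally show ?thesis .
qed

lemma mean_square_le:
  assumes "finite J" "J \<noteq> {}"
  shows "g q ((1 / real (card J)) *\<^sub>R (\<Sum>i\<in>J. z i)) ((1 / real (card J)) *\<^sub>R (\<Sum>i\<in>J. z i)) \<le> (1 / real (card J)) * (\<Sum>i\<in>J. g q (z i) (z i))"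
proof -
  have k: "real (card J) > 0" using assms by (simp add: card_gt_0_iff)
  let ?m = "(1 / real (card J)) *\<^sub>R (\<Sum>i\<in>J. z i)"
  have "0 \<le> (\<Sum>i\<in>J. g q (z i - ?m + 0) (z i - ?m + 0))" by (intro sum_nonneg g_nonneg)
  also have "\<dots> = (\<Sum>i\<in>J. g q (z i) (z i)) - real (card J) * g q ?m ?m"
    by (subst mean_variance[OF assms refl]) (simp add: g_simps(7))
  finally have "real (card J) * g q ?m ?m \<le> (\<Sum>i\<in>J. g q (z i) (z i))" by linarith
  then show ?thesis using k by (simp add: pos_le_divide_eq mult.commute)
qed

text \<open>Within a batch the squared mean is at most the mean square, and averaging over batches
  turns this into the mean over all indices; the variance identity over batches adds d with
  coefficient exactly one. That coefficient is what prevents geometric growth of the transported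
  error.\<close>

lemma batch_variance:
  fixes z :: "nat \<Rightarrow> 'e"
  assumes b: "1 \<le> b" "b \<le> n"
  defines "mn \<equiv> (1 / real n) *\<^sub>R (\<Sum>i\<in>{1..n}. z i)"
  shows "(\<Sum>J\<in>batches n b. g q ((1 / real b) *\<^sub>R (\<Sum>i\<in>J. z i) - mn + d) ((1 / real b) *\<^sub>R (\<Sum>i\<in>J. z i) - mn + d))
      / real (card (batches n b)) \<le> (\<Sum>i\<in>{1..n}. g q (z i) (z i)) / real n + g q d d"
proof -
  let ?B = "batches n b" and ?h = "\<lambda>J. (1 / real b) *\<^sub>R (\<Sum>i\<in>J. z i)"
  have k: "real (card ?B) > 0" using card_batches_pos[OF b(2)] by simp
  have n: "real n > 0" using b by simp
  have ne: "?B \<noteq> {}" using k by auto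
  have mn: "mn = (1 / real (card ?B)) *\<^sub>R (\<Sum>J\<in>?B. ?h J)"
    unfolding sum_batches[OF b] mn_def using k by simp
  have "(\<Sum>J\<in>?B. g q (?h J - mn + d) (?h J - mn + d)) \<le> (\<Sum>J\<in>?B. g q (?h J) (?h J)) + real (card ?B) * g q d d"
    unfolding mean_variance[OF finite_batches ne mn] using k g_nonneg[of q mn] by simp
  also have "(\<Sum>J\<in>?B. g q (?h J) (?h J)) \<le> (\<Sum>J\<in>?B. (1 / real b) *\<^sub>R (\<Sum>i\<in>J. g q (z i) (z i)))"
  proof (rule sum_mono)
    fix J assume "J \<in> ?B"
    then have J: "finite J" "J \<noteq> {}" "card J = b" using b finite_subset by (auto simp: batches_def)
    show "g q (?h J) (?h J) \<le> (1 / real b) *\<^sub>R (\<Sum>i\<in>J. g q (z i) (z i))"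
      using mean_square_le[OF J(1,2), of q z] J(3) by simp
  qed
  also have "\<dots> = (real (card ?B) / real n) * (\<Sum>i\<in>{1..n}. g q (z i) (z i))"
    unfolding sum_batches[OF b] by simp
  finally show ?thesis using k n by (simp add: field_simps)
qed

text \<open>
  With \<open>a\<close>, \<open>b\<close>, \<open>c\<close> the component gradients at the current, first and previous point of the epoch
  (the latter two transported to the current point) and \<open>d\<close> the transported error of the previous
  direction, this is the conditional second moment of the error of the new direction.
\<close>

lemma direction_error:
  assumes nb: "1 \<le> k" "k \<le> n" and w: "0 \<le> \<phi>" "\<phi> \<le> 1" "0 \<le> \<psi>'" "\<psi>' \<le> \<psi>"
    and ab: "(\<Sum>i\<in>{1..n}. g q (a i - b i) (a i - b i)) / real n \<le> K"
    and aN: "\<And>i. i \<in> {1..n} \<Longrightarrow> g q (a i) (a i) \<le> N\<^sup>2" and cN: "\<And>i. i \<in> {1..n} \<Longrightarrow> g q (c i) (c i) \<le> N\<^sup>2"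
    and mean: "\<And>z. mean z = (1 / real n) *\<^sub>R (\<Sum>i\<in>{1..n}. z i)"
    and batch: "\<And>J z. batch J z = (1 / real k) *\<^sub>R (\<Sum>i\<in>J. z i)"
    and err: "\<And>J. J \<in> batches n k \<Longrightarrow> err J = (batch J a - mean a) - \<phi> *\<^sub>R (batch J b - mean b) - \<psi>' *\<^sub>R (batch J c - mean c) + \<psi>' *\<^sub>R d"
  shows "(\<Sum>J\<in>batches n k. g q (err J) (err J)) / real (card (batches n k))
    \<le> 3 * (K + ((1 - \<phi>)\<^sup>2 + \<psi>\<^sup>2) * N\<^sup>2) + \<psi>\<^sup>2 * g q d d"
proof -
  \<comment> \<open>The three centred batch means use the same batch, so they merge into the centred
    batch mean of a single family, to which the variance bound applies once.\<close>
  define z where "z i = a i - \<phi> *\<^sub>R b i - \<psi>' *\<^sub>R c i" for i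
  have n: "real n > 0" using nb by simp
  have "err J = batch J z - mean z + \<psi>' *\<^sub>R d" if "J \<in> batches n k" for J
  proof -
    have "batch J z = batch J a - \<phi> *\<^sub>R batch J b - \<psi>' *\<^sub>R batch J c"
      by (simp add: batch z_def sum_subtractf scaleR_diff_right flip: scaleR_sum_right, (simp add: algebra_simps)?)
    moreover have "mean z = mean a - \<phi> *\<^sub>R mean b - \<psi>' *\<^sub>R mean c"
      by (simp add: mean z_def sum_subtractf scaleR_diff_right flip: scaleR_sum_right, (simp add: algebra_simps)?)
    ultimately show ?thesis unfolding err[OF that] by (simp add: algebra_simps)
  qed
  then have "(\<Sum>J\<in>batches n k. g q (err J) (err J)) / real (card (batches n k)) \<le>
     (\<Sum>i\<in>{1..n}. g q (z i) (z i)) / real n + g q (\<psi>' *\<^sub>R d) (\<psi>' *\<^sub>R d)"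
    using batch_variance[OF nb, of q z "\<psi>' *\<^sub>R d"] by (simp add: batch mean cong: sum.cong)
  also have "g q (\<psi>' *\<^sub>R d) (\<psi>' *\<^sub>R d) \<le> \<psi>\<^sup>2 * g q d d"
  proof -
    have "\<psi>'\<^sup>2 * g q d d \<le> \<psi>\<^sup>2 * g q d d" using w by (intro mult_right_mono power_mono g_nonneg) auto
    then show ?thesis by (simp add: g_simps power2_eq_square)
  qed
  also have "(\<Sum>i\<in>{1..n}. g q (z i) (z i)) / real n \<le> 3 * (K + ((1 - \<phi>)\<^sup>2 + \<psi>\<^sup>2) * N\<^sup>2)"
  proof -
    have "g q (z i) (z i) \<le> 3 * (g q (a i - b i) (a i - b i) + ((1 - \<phi>)\<^sup>2 + \<psi>\<^sup>2) * N\<^sup>2)" if i: "i \<in> {1..n}" for i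
    proof -
      have arith: "p \<le> 3 * (x + (y + y'))" if "p \<le> 3 * (u + v + v')" "u \<le> 1 * x" "v \<le> y" "v' \<le> y'"
        for p x y y' u v v' :: real using that by argo
      \<comment> \<open>Regrouping around a - b isolates the variance-reduced difference; what
        remains has the small weights 1 - \<phi> and \<psi>'.\<close>
      have z: "z i = \<phi> *\<^sub>R (a i - b i) + (1 - \<phi>) *\<^sub>R a i + (- \<psi>') *\<^sub>R c i" by (simp add: z_def algebra_simps)
      have "g q (z i) (z i) \<le> 3 * (\<phi>\<^sup>2 * g q (a i - b i) (a i - b i) + (1 - \<phi>)\<^sup>2 * g q (a i) (a i) + \<psi>'\<^sup>2 * g q (c i) (c i))"
        using g_three_squares[of q "\<phi> *\<^sub>R (a i - b i)" "(1 - \<phi>) *\<^sub>R a i" "(- \<psi>') *\<^sub>R c i"]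
        unfolding z[symmetric] bilinear_lmul[OF bilinear_g] bilinear_rmul[OF bilinear_g]
        by (simp add: power2_eq_square mult.assoc)
      moreover have "\<phi>\<^sup>2 * g q (a i - b i) (a i - b i) \<le> 1 * g q (a i - b i) (a i - b i)"
        using w by (intro mult_right_mono g_nonneg power_le_one)
      moreover have "(1 - \<phi>)\<^sup>2 * g q (a i) (a i) \<le> (1 - \<phi>)\<^sup>2 * N\<^sup>2"
        by (intro mult_left_mono aN[OF i]) simp
      moreover have "\<psi>'\<^sup>2 * g q (c i) (c i) \<le> \<psi>\<^sup>2 * N\<^sup>2"
        using w by (intro mult_mono cN[OF i] power_mono g_nonneg) auto
      ultimately show ?thesis unfolding distrib_right by (rule arith)
    qed
    then have "(\<Sum>i\<in>{1..n}. g q (z i) (z i)) \<le> (\<Sum>i\<in>{1..n}. 3 * (g q (a i - b i) (a i - b i) + ((1 - \<phi>)\<^sup>2 + \<psi>\<^sup>2) * N\<^sup>2))"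
      by (rule sum_mono)
    also have "\<dots> = 3 * ((\<Sum>i\<in>{1..n}. g q (a i - b i) (a i - b i)) + real n * (((1 - \<phi>)\<^sup>2 + \<psi>\<^sup>2) * N\<^sup>2))"
      by (simp add: sum.distrib flip: sum_distrib_left)
    also have "\<dots> \<le> 3 * (real n * K + real n * (((1 - \<phi>)\<^sup>2 + \<psi>\<^sup>2) * N\<^sup>2))"
      using ab n by (simp add: field_simps)
    also have "\<dots> = 3 * (K + ((1 - \<phi>)\<^sup>2 + \<psi>\<^sup>2) * N\<^sup>2) * real n" by (simp add: algebra_simps)
    finally show ?thesis using n by (simp add: pos_divide_le_eq)
  qed
  finally show ?thesis by simp
qed

text \<open>Transport is given by a definite description, so linearity is not immediate; but the
  defect of additivity or of homogeneity has inner product zero with itself.\<close>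

lemma isometry_linear:
  assumes iso: "\<And>\<xi> \<zeta>. g y (T \<xi>) (T \<zeta>) = g x \<xi> \<zeta>"
  shows "linear T"
proof (rule linearI)
  have zero: "u = 0" if "g y u u = 0" for u using g_pos[of u y] that by (cases "u = 0") auto
  show "T (u + v) = T u + T v" for u v
    using zero[of "T (u + v) - T u - T v"] by (simp add: g_simps iso algebra_simps)
  show "T (r *\<^sub>R v) = r *\<^sub>R T v" for r v
    using zero[of "T (r *\<^sub>R v) - r *\<^sub>R T v"] by (simp add: g_simps iso algebra_simps)
qed

lemma C1_differentiable:
  assumes "C1_function A f"
  shows "(f \<circ> chart_inv (chart_at A q)) differentiable (at (snd (chart_at A q) q))"
  using assms chart_at[of q] unfolding C1_function_def by (auto simp: numeral_eq_Suc One_nat_def)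

lemma grad_eq:
  assumes "C1_function A f"
  shows "g q (grad A g f q) v = differential A f q v"
proof -
  have "linear (differential A f q)"
    using linear_frechet_derivative[OF C1_differentiable[OF assms, of q]]
    unfolding differential_def[abs_def] by (simp add: eta_contract_eq)
  from riesz_bilinear[OF bilinear_g g_pos this]
  have "\<exists>!u. \<forall>v. g q u v = differential A f q v" .
  from theI'[OF this] show ?thesis unfolding grad_def by blast
qed

lemma grad_average:
  assumes "C1_function A (average n f)" "\<And>i. i \<in> {1..n} \<Longrightarrow> C1_function A (f i)"
  shows "grad A g (average n f) q = (1 / real n) *\<^sub>R (\<Sum>i\<in>{1..n}. grad A g (f i) q)"
proof -
  let ?c = "chart_at A q"
  have d: "((f i \<circ> chart_inv ?c) has_derivative differential A (f i) q) (at (snd ?c q))" if "i \<in> {1..n}" for i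
    using C1_differentiable[OF assms(2)[OF that]] unfolding differential_def[abs_def]
    by (simp add: frechet_derivative_works[symmetric])
  have "((\<lambda>x. (\<Sum>i\<in>{1..n}. (f i \<circ> chart_inv ?c) x) / real n) has_derivative
      (\<lambda>v. (\<Sum>i\<in>{1..n}. differential A (f i) q v) / real n)) (at (snd ?c q))"
    by (rule bounded_linear.has_derivative[OF bounded_linear_divide has_derivative_sum]) (rule d)
  moreover have "(\<lambda>x. (\<Sum>i\<in>{1..n}. (f i \<circ> chart_inv ?c) x) / real n) = average n f \<circ> chart_inv ?c"
    by (simp add: average_def fun_eq_iff)
  ultimately have "((average n f \<circ> chart_inv ?c) has_derivative
      (\<lambda>v. (\<Sum>i\<in>{1..n}. differential A (f i) q v) / real n)) (at (snd ?c q))" by simp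
  then have dav: "differential A (average n f) q v = (\<Sum>i\<in>{1..n}. differential A (f i) q v) / real n" for v
    unfolding differential_def[of A "average n f"] by (metis frechet_derivative_at)
  have e: "g q (grad A g (average n f) q) v = g q ((1 / real n) *\<^sub>R (\<Sum>i\<in>{1..n}. grad A g (f i) q)) v" for v
  proof -
    have "(\<Sum>i\<in>{1..n}. g q (grad A g (f i) q) v) = (\<Sum>i\<in>{1..n}. differential A (f i) q v)"
      by (intro sum.cong refl grad_eq assms(2))
    then show "g q (grad A g (average n f) q) v = g q ((1 / real n) *\<^sub>R (\<Sum>i\<in>{1..n}. grad A g (f i) q)) v"
      unfolding bilinear_lmul[OF bilinear_g] g_sum_left grad_eq[OF assms(1)]
      by (simp add: dav)
  qed
  have "g q (grad A g (average n f) q - (1 / real n) *\<^sub>R (\<Sum>i\<in>{1..n}. grad A g (f i) q)) v = 0" for v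
    unfolding bilinear_lsub[OF bilinear_g] e by simp
  then show ?thesis using g_pos by (metis eq_iff_diff_eq_0 less_irrefl)
qed

end

section \<open>Averaging over a fresh batch\<close>

context prob_space begin

text \<open>The values of Z carry no \<sigma>-algebra: finitely many level sets that are events
  suffice, so f may be arbitrary.\<close>

lemma expectation_finite_range:
  fixes f :: "'z \<Rightarrow> real"
  assumes "finite F" "\<And>w. w \<in> space M \<Longrightarrow> Z w \<in> F" "\<And>z. z \<in> F \<Longrightarrow> {w\<in>space M. Z w = z} \<in> events"
  shows "integrable M (\<lambda>w. f (Z w))" and "expectation (\<lambda>w. f (Z w)) = (\<Sum>z\<in>F. f z * prob {w\<in>space M. Z w = z})"
proof -
  let ?s = "\<lambda>w. \<Sum>z\<in>F. f z * indicator {w\<in>space M. Z w = z} w"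
  have eq: "f (Z w) = ?s w" if "w \<in> space M" for w
  proof -
    have "?s w = (\<Sum>z\<in>F. if z = Z w then f (Z w) else 0)"
      by (intro sum.cong refl) (auto simp: indicator_def that)
    then show ?thesis using assms(1,2) that by (simp add: sum.delta)
  qed
  have int: "integrable M (\<lambda>w. f z * indicator {w\<in>space M. Z w = z} w)" if "z \<in> F" for z
    using assms(3)[OF that] by (intro integrable_mult_right integrable_real_indicator) (auto simp: emeasure_eq_measure)
  have "integrable M ?s" by (intro Bochner_Integration.integrable_sum int)
  then show "integrable M (\<lambda>w. f (Z w))" using eq by (simp cong: Bochner_Integration.integrable_cong)
  have "expectation (\<lambda>w. f (Z w)) = expectation ?s" using eq by (intro Bochner_Integration.integral_cong) auto
  also have "\<dots> = (\<Sum>z\<in>F. f z * prob {w\<in>space M. Z w = z})"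
    using int assms(3) by (subst Bochner_Integration.integral_sum) auto
  finally show "expectation (\<lambda>w. f (Z w)) = (\<Sum>z\<in>F. f z * prob {w\<in>space M. Z w = z})" .
qed

text \<open>The intersection with \<open>space M\<close> covers empty J, where the intersection over
  J would be the whole type.\<close>

lemma indep_sets_split:
  assumes ind: "indep_sets F I" and J: "finite J" "J \<subseteq> I" and k: "k \<in> I" "k \<notin> J"
    and A: "\<And>j. j \<in> J \<Longrightarrow> A j \<in> F j" and B: "B \<in> F k"
  shows "prob (B \<inter> (space M \<inter> (\<Inter>j\<in>J. A j))) = prob B * prob (space M \<inter> (\<Inter>j\<in>J. A j))"
proof -
  have ev: "\<And>i. i \<in> I \<Longrightarrow> F i \<subseteq> events" using ind unfolding indep_sets_def by blast
  have prod: "prob (\<Inter>j\<in>K. A' j) = (\<Prod>j\<in>K. prob (A' j))"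
    if "K \<subseteq> I" "K \<noteq> {}" "finite K" "\<And>j. j \<in> K \<Longrightarrow> A' j \<in> F j" for K A'
    using ind that unfolding indep_sets_def by (auto simp: Pi_iff)
  have Bs: "B \<subseteq> space M" using ev[OF k(1)] B sets.sets_into_space by blast
  have As: "A j \<subseteq> space M" if "j \<in> J" for j using ev[of j] A[OF that] J(2) that sets.sets_into_space by blast
  show ?thesis
  proof (cases "J = {}")
    case True
    then show ?thesis using Bs by (simp add: Int_absorb2 prob_space)
  next
    case False
    let ?A' = "\<lambda>j. if j = k then B else A j"
    have "prob (\<Inter>j\<in>insert k J. ?A' j) = (\<Prod>j\<in>insert k J. prob (?A' j))"
      using J k A B by (intro prod) auto
    also have "(\<Prod>j\<in>insert k J. prob (?A' j)) = prob B * (\<Prod>j\<in>J. prob (A j))"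
      using J(1) k(2) by (auto intro!: prod.cong)
    also have "(\<Prod>j\<in>J. prob (A j)) = prob (\<Inter>j\<in>J. A j)"
      using J A False by (intro prod[symmetric]) auto
    finally have "prob (\<Inter>j\<in>insert k J. ?A' j) = prob B * prob (\<Inter>j\<in>J. A j)" .
    moreover have "(\<Inter>j\<in>insert k J. ?A' j) = B \<inter> (\<Inter>j\<in>J. A j)" using k(2) by auto
    moreover have "space M \<inter> (\<Inter>j\<in>J. A j) = (\<Inter>j\<in>J. A j)" using As False by blast
    ultimately show ?thesis by simp
  qed
qed

lemma uniform_rv_prob:
  assumes "uniform_rv M K Y" "finite K" "u \<in> K"
  shows "{w\<in>space M. Y w = u} \<in> events" "prob {w\<in>space M. Y w = u} = 1 / real (card K)"
proof -
  have Y: "Y \<in> measurable M (count_space K)" and d: "distr M (count_space K) Y = uniform_count_measure K"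
    using assms(1) unfolding uniform_rv_def by auto
  have s: "Y -` {u} \<inter> space M = {w\<in>space M. Y w = u}" by auto
  show "{w\<in>space M. Y w = u} \<in> events" using measurable_sets[OF Y, of "{u}"] assms(3) s by simp
  have "prob {w\<in>space M. Y w = u} = measure (distr M (count_space K) Y) {u}"
    using measure_distr[OF Y, of "{u}"] assms(3) s by simp
  then show "prob {w\<in>space M. Y w = u} = 1 / real (card K)"
    unfolding d using assms by (simp add: measure_uniform_count_measure)
qed

lemma uniform_rv_in: "uniform_rv M K Y \<Longrightarrow> w \<in> space M \<Longrightarrow> Y w \<in> K"
  using measurable_space[of Y M "count_space K" w] by (simp add: uniform_rv_def)

text \<open>Such an h factors through the tuple of the X j, which takes finitely many values, so h
  is a simple function.\<close>

lemma integrable_finitely_determined: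
  fixes h :: "'a \<Rightarrow> real" and X :: "'i \<Rightarrow> 'a \<Rightarrow> 'x"
  assumes J: "finite J" and X: "\<And>j. j \<in> J \<Longrightarrow> uniform_rv M (K j) (X j)" "\<And>j. j \<in> J \<Longrightarrow> finite (K j)"
    and dep: "\<And>w w'. w \<in> space M \<Longrightarrow> w' \<in> space M \<Longrightarrow> (\<And>j. j \<in> J \<Longrightarrow> X j w = X j w') \<Longrightarrow> h w = h w'"
  shows "integrable M h"
proof -
  define C where "C w = restrict (\<lambda>j. X j w) J" for w
  define k where "k c = h (SOME w. w \<in> space M \<and> C w = c)" for c
  have kC: "k (C w) = h w" if w: "w \<in> space M" for w
  proof -
    let ?w = "SOME w'. w' \<in> space M \<and> C w' = C w"
    have w': "?w \<in> space M \<and> C ?w = C w" by (rule someI_ex) (use w in blast)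
    have "h ?w = h w"
    proof (rule dep)
      fix j assume j: "j \<in> J"
      have "C ?w j = C w j" using w' by simp
      then show "X j ?w = X j w" using j unfolding C_def by simp
    qed (use w w' in auto)
    then show ?thesis unfolding k_def .
  qed
  have "integrable M (\<lambda>w. k (C w))"
  proof (rule expectation_finite_range[where F = "PiE J K"])
    show "finite (PiE J K)" using J X(2) by (rule finite_PiE)
    show "C w \<in> PiE J K" if "w \<in> space M" for w
      using uniform_rv_in[OF X(1) that] unfolding C_def by auto
    fix c assume c: "c \<in> PiE J K"
    have "{w\<in>space M. C w = c} = space M \<inter> (\<Inter>j\<in>J. {w\<in>space M. X j w = c j})"
      using c unfolding C_def by (auto simp: fun_eq_iff restrict_def PiE_iff extensional_def)
    moreover have "{w\<in>space M. X j w = c j} \<in> events" if "j \<in> J" for j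
      using uniform_rv_prob(1)[OF X(1)[OF that] X(2)[OF that]] c that by (auto simp: PiE_iff)
    ultimately show "{w\<in>space M. C w = c} \<in> events"
      using J by (cases "J = {}") (auto intro!: sets.Int sets.finite_INT)
  qed
  then show ?thesis using kC by (simp cong: Bochner_Integration.integrable_cong)
qed

text \<open>Replaces conditioning on the past: on each cell where all X j are constant h depends on
  u only, and independence of Y from the cell replaces Y by the uniform average. The dependence
  hypothesis is required for every u because the average evaluates h at values that Y does not take
  at w.\<close>

lemma expectation_fresh_uniform:
  fixes h :: "'a \<Rightarrow> 'u \<Rightarrow> real" and X :: "'i \<Rightarrow> 'a \<Rightarrow> 'x"
  assumes J: "finite J" and X: "\<And>j. j \<in> J \<Longrightarrow> uniform_rv M (K j) (X j)" "\<And>j. j \<in> J \<Longrightarrow> finite (K j)"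
    and Y: "uniform_rv M U Y" "finite U"
    and dep: "\<And>w w' u. w \<in> space M \<Longrightarrow> w' \<in> space M \<Longrightarrow> (\<And>j. j \<in> J \<Longrightarrow> X j w = X j w') \<Longrightarrow> h w u = h w' u"
    and ind: "\<And>c u. u \<in> U \<Longrightarrow> prob ({w\<in>space M. Y w = u} \<inter> (space M \<inter> (\<Inter>j\<in>J. {w\<in>space M. X j w = c j}))) =
        prob {w\<in>space M. Y w = u} * prob (space M \<inter> (\<Inter>j\<in>J. {w\<in>space M. X j w = c j}))"
  shows "expectation (\<lambda>w. h w (Y w)) = expectation (\<lambda>w. (\<Sum>u\<in>U. h w u) / real (card U))"
proof -
  define C where "C w = restrict (\<lambda>j. X j w) J" for w
  \<comment> \<open>An arbitrary outcome with the prescribed past represents h on that cell;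
    \<open>dep\<close> makes the choice irrelevant.\<close>
  define k where "k c = h (SOME w. w \<in> space M \<and> C w = c)" for c
  have kC: "k (C w) = h w" if w: "w \<in> space M" for w
  proof -
    let ?w = "SOME w'. w' \<in> space M \<and> C w' = C w"
    have w': "?w \<in> space M \<and> C ?w = C w" by (rule someI_ex) (use w in blast)
    have "h ?w u = h w u" for u
    proof (rule dep)
      fix j assume j: "j \<in> J"
      have "C ?w j = C w j" using w' by simp
      then show "X j ?w = X j w" using j unfolding C_def by simp
    qed (use w w' in auto)
    then show ?thesis unfolding k_def by blast
  qed
  have finC: "finite (PiE J K)" using J X(2) by (rule finite_PiE)
  have Cin: "C w \<in> PiE J K" if "w \<in> space M" for w
    using uniform_rv_in[OF X(1) that] unfolding C_def by auto
  have Ceq: "{w\<in>space M. C w = c} = space M \<inter> (\<Inter>j\<in>J. {w\<in>space M. X j w = c j})" if c: "c \<in> PiE J K" for c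
    using c unfolding C_def by (auto simp: fun_eq_iff restrict_def PiE_iff extensional_def)
  have Cev: "{w\<in>space M. C w = c} \<in> events" if c: "c \<in> PiE J K" for c
  proof -
    have "{w\<in>space M. X j w = c j} \<in> events" if "j \<in> J" for j
      using uniform_rv_prob(1)[OF X(1)[OF that] X(2)[OF that]] c that by (auto simp: PiE_iff)
    then show ?thesis unfolding Ceq[OF c]
      using J by (cases "J = {}") (auto intro!: sets.Int sets.finite_INT)
  qed
  have split: "{w\<in>space M. (C w, Y w) = (c, u)} = {w\<in>space M. Y w = u} \<inter> {w\<in>space M. C w = c}" for c u by auto
  have "expectation (\<lambda>w. h w (Y w)) = expectation (\<lambda>w. (\<lambda>(c, u). k c u) (C w, Y w))"
    using kC by (intro Bochner_Integration.integral_cong) auto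
  also have "\<dots> = (\<Sum>(c, u)\<in>PiE J K \<times> U. k c u * prob {w\<in>space M. (C w, Y w) = (c, u)})"
  proof (subst expectation_finite_range(2)[where F = "PiE J K \<times> U"])
    fix z assume "z \<in> PiE J K \<times> U"
    then obtain c u where z: "z = (c, u)" "c \<in> PiE J K" "u \<in> U" by auto
    show "{w\<in>space M. (C w, Y w) = z} \<in> events"
      unfolding z(1) split using Cev[OF z(2)] uniform_rv_prob(1)[OF Y z(3)] by blast
  qed (use finC Y(2) Cin uniform_rv_in[OF Y(1)] in \<open>auto intro!: sum.cong\<close>)
  also have "\<dots> = (\<Sum>(c, u)\<in>PiE J K \<times> U. k c u / real (card U) * prob {w\<in>space M. C w = c})"
  proof (intro sum.cong refl)
    fix z assume "z \<in> PiE J K \<times> U"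
    then obtain c u where z: "z = (c, u)" "c \<in> PiE J K" "u \<in> U" by auto
    have "prob {w\<in>space M. (C w, Y w) = (c, u)} = 1 / real (card U) * prob {w\<in>space M. C w = c}"
      unfolding split Ceq[OF z(2)] ind[OF z(3)] uniform_rv_prob(2)[OF Y z(3)] ..
    then show "(case z of (c, u) \<Rightarrow> k c u * prob {w\<in>space M. (C w, Y w) = (c, u)}) =
        (case z of (c, u) \<Rightarrow> k c u / real (card U) * prob {w\<in>space M. C w = c})" unfolding z(1) by simp
  qed
  also have "\<dots> = (\<Sum>c\<in>PiE J K. (\<Sum>u\<in>U. k c u) / real (card U) * prob {w\<in>space M. C w = c})"
    by (simp add: sum.cartesian_product[symmetric] sum_divide_distrib sum_distrib_right)
  also have "\<dots> = expectation (\<lambda>w. (\<lambda>c. (\<Sum>u\<in>U. k c u) / real (card U)) (C w))"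
    using finC Cin Cev by (intro expectation_finite_range(2)[symmetric])
  also have "\<dots> = expectation (\<lambda>w. (\<Sum>u\<in>U. h w u) / real (card U))"
    using kC by (intro Bochner_Integration.integral_cong) auto
  finally show ?thesis .
qed

end

section \<open>Convergence\<close>

text \<open>The upper limit for c is the positive root of \<nu> c^2 + L c = 1, written so that no
  division by \<nu> occurs.\<close>

lemma step_size_bound:
  fixes L \<nu> c :: real
  assumes "L > 0" "\<nu> \<ge> 0" "0 < c" "c \<le> 2 / (L + sqrt (L\<^sup>2 + 4 * \<nu>))"
  shows "\<nu> * c\<^sup>2 + L * c \<le> 1"
proof -
  define r where "r = sqrt (L\<^sup>2 + 4 * \<nu>)"
  have r: "r \<ge> 0" "r\<^sup>2 = L\<^sup>2 + 4 * \<nu>" using assms by (auto simp: r_def)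
  have "c * (L + r) \<le> 2" using assms r by (simp add: r_def[symmetric] pos_le_divide_eq add_pos_nonneg)
  then have "c * r \<le> 2 - c * L" by (simp add: algebra_simps)
  moreover have "0 \<le> c * r" using assms r by simp
  ultimately have "(c * r)\<^sup>2 \<le> (2 - c * L)\<^sup>2" by (intro power_mono)
  then have "c\<^sup>2 * (L\<^sup>2 + 4 * \<nu>) \<le> (2 - c * L)\<^sup>2" by (simp add: power_mult_distrib r(2))
  then show ?thesis by (simp add: power2_eq_square algebra_simps)
qed

text \<open>Since \<psi> \<le> 1, errors only add up: each step contributes at most the same c, so e
  t \<le> t c \<le> m c, and summation gives another factor m.\<close>

lemma error_recursion_sum:
  fixes e v :: "nat \<Rightarrow> real"
  assumes e0: "e 0 = 0"
    and rec: "\<And>t. Suc t < m \<Longrightarrow> e (Suc t) \<le> 3 * (K * real (Suc t) * (\<Sum>j\<le>t. v j) + D) + \<psi>\<^sup>2 * e t"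
    and nonneg: "\<And>t. e t \<ge> 0" "\<And>t. t < m \<Longrightarrow> v t \<ge> 0" "K \<ge> 0" "D \<ge> 0" and \<psi>: "0 \<le> \<psi>" "\<psi> \<le> 1"
  shows "(\<Sum>t<m. e t) \<le> 4 * real m ^ 3 * K * (\<Sum>j<m. v j) + 4 * (real m)\<^sup>2 * D"
proof -
  define c where "c = 3 * (K * real m * (\<Sum>j<m. v j) + D)"
  have v: "(\<Sum>j<m. v j) \<ge> 0" using nonneg(2) by (intro sum_nonneg) auto
  have c: "c \<ge> 0" using nonneg v by (simp add: c_def)
  have le: "e t \<le> real t * c" if "t < m" for t
    using that
  proof (induction t)
    case (Suc t)
    have "(\<Sum>j\<le>t. v j) \<le> (\<Sum>j<m. v j)"
      using Suc.prems nonneg(2) by (intro sum_mono2) auto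
    moreover have "(\<Sum>j\<le>t. v j) \<ge> 0" using Suc.prems nonneg(2) by (intro sum_nonneg) auto
    ultimately have "K * real (Suc t) * (\<Sum>j\<le>t. v j) \<le> K * real m * (\<Sum>j<m. v j)"
      using Suc.prems nonneg by (intro mult_mono) auto
    then have "3 * (K * real (Suc t) * (\<Sum>j\<le>t. v j) + D) \<le> c" by (simp add: c_def)
    moreover have "\<psi>\<^sup>2 * e t \<le> 1 * e t"
      using \<psi> nonneg(1) by (intro mult_right_mono power_le_one)
    moreover have "e t \<le> real t * c" using Suc by simp
    ultimately show ?case using rec[OF Suc.prems] by (simp add: algebra_simps)
  qed (simp add: e0)
  have "(\<Sum>t<m. e t) \<le> (\<Sum>t<m. real m * c)"
  proof (rule sum_mono)
    fix t assume "t \<in> {..<m}"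
    then have "real t * c \<le> real m * c" "t < m" using c by (auto intro: mult_right_mono)
    then show "e t \<le> real m * c" using le[of t] by linarith
  qed
  also have "\<dots> = 3 * (real m ^ 3 * K * (\<Sum>j<m. v j)) + 3 * ((real m)\<^sup>2 * D)"
    by (simp add: c_def power2_eq_square power3_eq_cube algebra_simps)
  \<comment> \<open>The recursion yields 3; it is relaxed to the constant 4 of the target.\<close>
  also have "\<dots> \<le> 4 * (real m ^ 3 * K * (\<Sum>j<m. v j)) + 4 * ((real m)\<^sup>2 * D)"
    using nonneg v by (intro add_mono mult_right_mono) auto
  finally show ?thesis by (simp add: mult.assoc)
qed

theorem corollary2:
  fixes A :: "('m::{t2_space,second_countable_topology}, 'e::euclidean_space) chart set"
    and g :: "'m \<Rightarrow> 'e \<Rightarrow> 'e \<Rightarrow> real"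
    and f :: "nat \<Rightarrow> 'm \<Rightarrow> real"
    and n b m :: nat
    and \<Omega> :: "'m set"
    and \<omega>opt \<omega>init :: 'm
    and \<rho> M \<theta> L C\<^sub>1 C\<^sub>2 \<delta> N C\<alpha> \<mu> \<nu> :: real
    and \<phi> \<psi> :: "nat \<Rightarrow> real"
    and P :: "'w measure"
    and I :: "nat \<Rightarrow> nat \<Rightarrow> 'w \<Rightarrow> nat set"
    and a :: "nat \<Rightarrow> 'w \<Rightarrow> nat \<times> nat"
    and F :: "'m \<Rightarrow> real"
    and R :: "'m \<Rightarrow> 'e \<Rightarrow> 'm"
    and \<T> :: "'m \<Rightarrow> 'e \<Rightarrow> 'e \<Rightarrow> 'e"
    and \<Gamma> :: "'m \<Rightarrow> 'm \<Rightarrow> 'e \<Rightarrow> 'e"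
    and \<omega> :: "nat \<Rightarrow> nat \<Rightarrow> 'w \<Rightarrow> 'm"
    and V :: "nat \<Rightarrow> nat \<Rightarrow> 'w \<Rightarrow> 'e"
  assumes manifold: "riemannian_manifold A g"
    and F: "F = average n f"
    and R: "R = exp_map A g"
    and \<T>: "\<T> = par_transport A g"
    and \<Gamma>: "\<Gamma> = par_transport_between A g \<rho>"
    and sizes: "n \<ge> 1" "1 \<le> b" "b \<le> n" "m \<ge> 1"
    and \<mu>: "0 < \<mu>" "\<mu> < 1"
    and minimizer: "\<And>p. F \<omega>opt \<le> F p"
    and randomness: "rshg_randomness P n b m I a"
    and weights: "\<And>s. s \<ge> 1 \<Longrightarrow> \<phi> s \<ge> 0 \<and> \<psi> s \<ge> 0 \<and> \<phi> s + \<psi> s \<le> 1"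
    and run: "\<And>s t w. s \<ge> 1 \<Longrightarrow> w \<in> space P \<Longrightarrow>
        (\<omega> s t w, V s t w) =
          rshg g R \<Gamma> (grad A g F) (batch_grad A g f) m \<mu>
            (\<lambda>_ _. C\<alpha>) (\<lambda>s _. \<phi> s) (\<lambda>s _. \<psi> s) (\<lambda>s t. I s t w) \<omega>init s t"
    and C1: "C1_function A F" "\<And>i. i \<in> {1..n} \<Longrightarrow> C1_function A (f i)"
    and \<Omega>: "compact \<Omega>" "\<omega>opt \<in> interior \<Omega>"
    and iterates: "\<And>s t w. s \<ge> 1 \<Longrightarrow> t \<le> m \<Longrightarrow> w \<in> space P \<Longrightarrow> \<omega> s t w \<in> \<Omega>"
    and \<rho>: "\<rho> > 0"
    and retractive: "\<And>x. x \<in> \<Omega> \<Longrightarrow>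
        tball g x \<rho> \<subseteq> exp_dom A g x \<and> diffeomorphism_on A (tball g x \<rho>) (R x) \<and>
        \<Omega> \<subseteq> R x ` tball g x \<rho>"
    and segments: "\<And>s t w \<tau>. s \<ge> 1 \<Longrightarrow> t < m \<Longrightarrow> w \<in> space P \<Longrightarrow> 0 \<le> \<tau> \<Longrightarrow> \<tau> \<le> 1 \<Longrightarrow>
        - (\<tau> * C\<alpha>) *\<^sub>R V s t w \<in> exp_dom A g (\<omega> s t w) \<and>
        R (\<omega> s t w) (- (\<tau> * C\<alpha>) *\<^sub>R V s t w) \<in> \<Omega>"
    and transport_continuous: "continuous_transport A (exp_dom A g) R \<T>"
    and transport_isometric: "\<And>x \<eta> \<xi> \<zeta>. \<eta> \<in> exp_dom A g x \<Longrightarrow>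
        g (R x \<eta>) (\<T> x \<eta> \<xi>) (\<T> x \<eta> \<zeta>) = g x \<xi> \<zeta>"
    and M: "M > 0"
    and grad_lipschitz: "\<And>x y \<xi>. x \<in> \<Omega> \<Longrightarrow> y \<in> \<Omega> \<Longrightarrow> \<xi> \<in> exp_dom A g x \<Longrightarrow> y = R x \<xi> \<Longrightarrow>
        (\<Sum>i\<in>{1..n}. (tnorm g x (grad A g (f i) x - \<Gamma> y x (grad A g (f i) y)))\<^sup>2) / real n
          \<le> M\<^sup>2 * (tnorm g x \<xi>)\<^sup>2"
    and \<theta>: "\<theta> > 0"
    and transport_close: "\<And>x y \<xi> \<eta>. x \<in> \<Omega> \<Longrightarrow> y \<in> \<Omega> \<Longrightarrow> \<xi> \<in> exp_dom A g x \<Longrightarrow> y = R x \<xi> \<Longrightarrow>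
        tnorm g y (\<Gamma> x y \<eta> - \<T> x \<xi> \<eta>) \<le> \<theta> * tnorm g x \<xi> * tnorm g x \<eta>"
    and L: "L > 0"
    and descent: "\<And>x y \<xi>. x \<in> \<Omega> \<Longrightarrow> y \<in> \<Omega> \<Longrightarrow> \<xi> \<in> exp_dom A g x \<Longrightarrow> y = R x \<xi> \<Longrightarrow>
        F y \<le> F x + g x (grad A g F x) \<xi> + L / 2 * (tnorm g x \<xi>)\<^sup>2"
    and C12: "C\<^sub>1 > 0" "C\<^sub>2 > 0" "\<delta> > 0"
    and dist_compare: "\<And>x y \<xi>. x \<in> \<Omega> \<Longrightarrow> y \<in> \<Omega> \<Longrightarrow> \<xi> \<in> exp_dom A g x \<Longrightarrow> y = R x \<xi> \<Longrightarrow>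
        tnorm g x \<xi> \<le> \<delta> \<Longrightarrow>
        tnorm g x \<xi> \<le> C\<^sub>1 * rdist A g x y \<and> rdist A g x y \<le> C\<^sub>2 * tnorm g x \<xi>"
    and N: "N > 0" "\<And>x i. x \<in> \<Omega> \<Longrightarrow> i \<in> {1..n} \<Longrightarrow> tnorm g x (grad A g (f i) x) \<le> N"
    and \<nu>: "\<nu> = 4 * real m ^ 3 * M\<^sup>2"
    and step: "0 < C\<alpha>" "C\<alpha> \<le> 2 / (L + sqrt (L\<^sup>2 + 4 * \<nu>))"
    and summable: "summable (\<lambda>s. (1 - \<phi> (Suc s))\<^sup>2 + (\<psi> (Suc s))\<^sup>2)"
  shows "let
      E = (\<lambda>S. prob_space.expectation P (\<lambda>w. case a S w of (s, t) \<Rightarrow>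
             (tnorm g (\<omega> s t w) (grad A g F (\<omega> s t w)))\<^sup>2));
      bound = (\<lambda>S. 2 / (real m * real S * C\<alpha>) * (F \<omega>init - F \<omega>opt)
             + 4 * real m * N\<^sup>2 / real S * (\<Sum>s. (1 - \<phi> (Suc s))\<^sup>2 + (\<psi> (Suc s))\<^sup>2))
    in (\<forall>S\<ge>1. E S \<le> bound S) \<and> bound \<in> O(\<lambda>S. 1 / real S) \<and> E \<in> O(\<lambda>S. 1 / real S)"
proof -
  interpret riemannian A g by unfold_locales (rule manifold)
  interpret prob_space P using randomness unfolding rshg_randomness_def by blast
  define G where "G = grad A g F"
  define H where "H = batch_grad A g f"

  \<comment> \<open>The recursion of a single run\<close>
  have epoch: "rshg_epoch g R \<Gamma> G H \<mu> (\<lambda>_. C\<alpha>) (\<lambda>_. \<phi> s) (\<lambda>_. \<psi> s) (\<lambda>t. I s t w)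
      (rshg_outer g R \<Gamma> G H m \<mu> (\<lambda>_ _. C\<alpha>) (\<lambda>s _. \<phi> s) (\<lambda>s _. \<psi> s) (\<lambda>s t. I s t w) \<omega>init (s - 1)) t
      = (\<omega> s t w, V s t w)" if "s \<ge> 1" "w \<in> space P" for s t w
    using run[OF that, of t] by (simp add: rshg_def G_def H_def)
  have outer: "rshg_outer g R \<Gamma> G H m \<mu> (\<lambda>_ _. C\<alpha>) (\<lambda>s _. \<phi> s) (\<lambda>s _. \<psi> s) (\<lambda>s t. I s t w) \<omega>init (s - 1) = \<omega> s 0 w"
    and V_0: "V s 0 w = G (\<omega> s 0 w)" if "s \<ge> 1" "w \<in> space P" for s w
    using epoch[OF that, of 0] by auto
  have \<omega>_Suc: "\<omega> s (Suc t) w = R (\<omega> s t w) (- C\<alpha> *\<^sub>R V s t w)"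
    and V_Suc: "V s (Suc t) w = rshg_direction g \<Gamma> G H \<mu> (\<phi> s) (\<psi> s) (I s (Suc t) w)
        (\<omega> s 0 w) (\<omega> s t w) (V s t w) (\<omega> s (Suc t) w)" if "s \<ge> 1" "w \<in> space P" for s t w
    using epoch[OF that, of "Suc t"] epoch[OF that, of t] unfolding outer[OF that]
    by (auto simp: Let_def)
  have \<omega>_init: "\<omega> 1 0 w = \<omega>init" if "w \<in> space P" for w
    using outer[OF _ that, of 1] by simp
  have \<omega>_next: "\<omega> (Suc s) 0 w = \<omega> s m w" if "s \<ge> 1" "w \<in> space P" for s w
  proof -
    obtain k where k: "s = Suc k" using \<open>s \<ge> 1\<close> by (cases s) auto
    show ?thesis using outer[of "Suc s" w] epoch[OF that, of m] that by (simp add: k)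
  qed

  \<comment> \<open>Dependence of the run on past batches\<close>
  define past where "past s t = {(s', t'). 1 \<le> s' \<and> 1 \<le> t' \<and> (s' < s \<and> t' < m \<or> s' = s \<and> t' \<le> t)}" for s t :: nat
  define agree where "agree s t w w' \<longleftrightarrow> w \<in> space P \<and> w' \<in> space P \<and> (\<forall>(s', t')\<in>past s t. I s' t' w = I s' t' w')" for s t w w'
  \<comment> \<open>Batches start at inner step 1, so \<open>past s 0\<close> contains earlier
    epochs only; t < m keeps all indices where batches are drawn.\<close>
  have past_sub: "past s t \<subseteq> {1..} \<times> {1..<m}" and past_fin: "finite (past s t)" if "t < m" for s t
  proof -
    show "past s t \<subseteq> {1..} \<times> {1..<m}" using that unfolding past_def by auto
    have "past s t \<subseteq> {..s} \<times> {..m}" using that unfolding past_def by auto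
    then show "finite (past s t)" by (rule finite_subset) simp
  qed
  have past_mono: "agree s t w w'" if "agree s' t' w w'" "past s t \<subseteq> past s' t'" for s t s' t' w w'
    using that unfolding agree_def by blast
  have dep_epoch: "\<omega> s t w = \<omega> s t w' \<and> V s t w = V s t w'"
    if s: "s \<ge> 1" and t: "t < m" and a: "agree s t w w'" and start: "\<omega> s 0 w = \<omega> s 0 w'" for s t w w'
    using t a
  proof (induction t)
    case 0
    then show ?case using start V_0[OF s] by (simp add: agree_def)
  next
    case (Suc t)
    have w: "w \<in> space P" "w' \<in> space P" using Suc.prems(2) by (auto simp: agree_def)
    have "agree s t w w'" by (rule past_mono[OF Suc.prems(2)]) (auto simp: past_def)
    then have IH: "\<omega> s t w = \<omega> s t w'" "V s t w = V s t w'" using Suc by auto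
    have "(s, Suc t) \<in> past s (Suc t)" using s by (simp add: past_def)
    then have "I s (Suc t) w = I s (Suc t) w'" using Suc.prems(2) by (auto simp: agree_def)
    then show ?case using IH start by (simp add: \<omega>_Suc[OF s w(1)] \<omega>_Suc[OF s w(2)] V_Suc[OF s w(1)] V_Suc[OF s w(2)])
  qed
  have dep0: "\<omega> s 0 w = \<omega> s 0 w'" if s: "s \<ge> 1" and a: "agree s 0 w w'" for s w w'
    using s a
  proof (induction s rule: nat_induct_at_least)
    case base
    then show ?case by (simp add: agree_def \<omega>_init[unfolded One_nat_def])
  next
    case (Suc s)
    have w: "w \<in> space P" "w' \<in> space P" using Suc.prems by (auto simp: agree_def)
    \<comment> \<open>The next epoch starts at the m-th point, one step beyond the last batch, which
      has index k = m - 1.\<close>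
    obtain k where k: "m = Suc k" using sizes(4) by (cases m) auto
    have "agree s 0 w w'" by (rule past_mono[OF Suc.prems]) (auto simp: past_def k)
    then have st: "\<omega> s 0 w = \<omega> s 0 w'" by (rule Suc.IH)
    have "agree s k w w'" by (rule past_mono[OF Suc.prems]) (auto simp: past_def k)
    then have "\<omega> s k w = \<omega> s k w' \<and> V s k w = V s k w'" using dep_epoch[OF Suc.hyps, of k] st by (simp add: k)
    then show ?case
      by (simp add: \<omega>_next[OF Suc.hyps w(1)] \<omega>_next[OF Suc.hyps w(2)] k \<omega>_Suc[OF Suc.hyps w(1)] \<omega>_Suc[OF Suc.hyps w(2)])
  qed
  \<comment> \<open>The batch of step t enters the direction at t, and this direction fixes the
    point at t + 1. Hence that point is already determined when the batch of step t + 1 is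
    drawn.\<close>
  have dep: "\<omega> s t w = \<omega> s t w'" "V s t w = V s t w'" "\<omega> s (Suc t) w = \<omega> s (Suc t) w'"
    if s: "s \<ge> 1" and t: "t < m" and a: "agree s t w w'" for s t w w'
  proof -
    have "agree s 0 w w'" by (rule past_mono[OF a]) (auto simp: past_def)
    from dep_epoch[OF s t a dep0[OF s this]]
    show "\<omega> s t w = \<omega> s t w'" "V s t w = V s t w'" by auto
    then show "\<omega> s (Suc t) w = \<omega> s (Suc t) w'" using a by (simp add: \<omega>_Suc[OF s] agree_def)
  qed
  have dep_le: "\<omega> s j w = \<omega> s j w'" "V s j w = V s j w'"
    if "s \<ge> 1" "t < m" "agree s t w w'" "j \<le> t" for s t j w w'
  proof -
    have "agree s j w w'" by (rule past_mono[OF that(3)]) (use that in \<open>auto simp: past_def\<close>)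
    then show "\<omega> s j w = \<omega> s j w'" "V s j w = V s j w'" using dep[of s j w w'] that by auto
  qed

  \<comment> \<open>Independence of the next batch and of the output index from the past\<close>
  have batch_rv: "uniform_rv P (batches n b) (I s t)" if "(s, t) \<in> {1..} \<times> {1..<m}" for s t
    using randomness that unfolding rshg_randomness_def by auto
  have past_rv: "uniform_rv P (batches n b) (case j of (s, t) \<Rightarrow> I s t)" if "t < m" "j \<in> past s t" for j s t
  proof -
    obtain s' t' where j: "j = (s', t')" by (cases j)
    then have "(s', t') \<in> {1..} \<times> {1..<m}" using past_sub[OF that(1)] that(2) by blast
    then show ?thesis unfolding j by (simp add: batch_rv del: mem_Sigma_iff)
  qed
  have out_rv: "uniform_rv P ({1..S} \<times> {0..<m}) (a S)" if "S \<ge> 1" for S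
    using randomness that unfolding rshg_randomness_def by auto
  have indep: "indep_sets (\<lambda>j. case j of None \<Rightarrow> rv_events P (a S) | Some (s, t) \<Rightarrow> rv_events P (I s t))
        (insert None (Some ` ({1..} \<times> {1..<m})))" if "S \<ge> 1" for S
    using randomness that unfolding rshg_randomness_def by auto
  have level: "{w\<in>space P. X w = x} \<in> rv_events P X" for X :: "'w \<Rightarrow> 'x" and x
    unfolding rv_events_def by (rule CollectI, rule exI[of _ "{x}"]) auto

  have integ: "integrable P h" if t: "t < m" and h: "\<And>w w'. agree s t w w' \<Longrightarrow> h w = h w'" for s t and h :: "'w \<Rightarrow> real"
  proof (rule integrable_finitely_determined[where J = "past s t" and X = "\<lambda>(s, t). I s t" and K = "\<lambda>_. batches n b"])
    show "uniform_rv P (batches n b) (case j of (s, t) \<Rightarrow> I s t)" if "j \<in> past s t" for j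
      by (rule past_rv[OF t that])
    show "h w = h w'" if "w \<in> space P" "w' \<in> space P"
      "\<And>j. j \<in> past s t \<Longrightarrow> (case j of (s, t) \<Rightarrow> I s t) w = (case j of (s, t) \<Rightarrow> I s t) w'" for w w'
      using that by (intro h) (auto simp: agree_def)
  qed (use past_fin[OF t] finite_batches in auto)

  have indep_past: "prob (B \<inter> (space P \<inter> (\<Inter>j\<in>past s t. {w\<in>space P. (case j of (s, t) \<Rightarrow> I s t) w = c j}))) =
      prob B * prob (space P \<inter> (\<Inter>j\<in>past s t. {w\<in>space P. (case j of (s, t) \<Rightarrow> I s t) w = c j}))"
    if t: "t < m" and S: "S \<ge> 1" and k: "k \<in> insert None (Some ` ({1..} \<times> {1..<m}))" "k \<notin> Some ` past s t"
      and B: "B \<in> (case k of None \<Rightarrow> rv_events P (a S) | Some (s, t) \<Rightarrow> rv_events P (I s t))" for s t S k B c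
  proof -
    let ?A = "\<lambda>j. {w\<in>space P. (case the j of (s, t) \<Rightarrow> I s t) w = c (the j)}"
    have "prob (B \<inter> (space P \<inter> (\<Inter>j\<in>Some ` past s t. ?A j))) = prob B * prob (space P \<inter> (\<Inter>j\<in>Some ` past s t. ?A j))"
    proof (rule indep_sets_split[OF indep[OF S] _ _ k _ B])
      show "Some ` past s t \<subseteq> insert None (Some ` ({1..} \<times> {1..<m}))" using past_sub[OF t] by blast
      show "?A j \<in> (case j of None \<Rightarrow> rv_events P (a S) | Some (s, t) \<Rightarrow> rv_events P (I s t))" if "j \<in> Some ` past s t" for j
        using that level by (auto split: prod.splits)
    qed (use past_fin[OF t] in simp)
    then show ?thesis by simp
  qed

  have fresh_batch: "expectation (\<lambda>w. h w (I s (Suc t) w)) =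
      expectation (\<lambda>w. (\<Sum>J\<in>batches n b. h w J) / real (card (batches n b)))"
    if s: "s \<ge> 1" and t: "Suc t < m" and h: "\<And>w w' J. agree s t w w' \<Longrightarrow> h w J = h w' J" for s t and h :: "'w \<Rightarrow> nat set \<Rightarrow> real"
  proof (rule expectation_fresh_uniform[where J = "past s t" and X = "\<lambda>(s, t). I s t" and K = "\<lambda>_. batches n b"])
    have t': "t < m" using t by simp
    show "finite (past s t)" by (rule past_fin[OF t'])
    show "uniform_rv P (batches n b) (case j of (s, t) \<Rightarrow> I s t)" if "j \<in> past s t" for j
      by (rule past_rv[OF t' that])
    show "uniform_rv P (batches n b) (I s (Suc t))" using s t by (intro batch_rv) auto
    show "h w J = h w' J" if "w \<in> space P" "w' \<in> space P"
      "\<And>j. j \<in> past s t \<Longrightarrow> (case j of (s, t) \<Rightarrow> I s t) w = (case j of (s, t) \<Rightarrow> I s t) w'" for w w' J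
      using that by (intro h) (auto simp: agree_def)
    show "prob ({w\<in>space P. I s (Suc t) w = J} \<inter> (space P \<inter> (\<Inter>j\<in>past s t. {w\<in>space P. (case j of (s, t) \<Rightarrow> I s t) w = c j}))) =
        prob {w\<in>space P. I s (Suc t) w = J} * prob (space P \<inter> (\<Inter>j\<in>past s t. {w\<in>space P. (case j of (s, t) \<Rightarrow> I s t) w = c j}))" for c J
      \<comment> \<open>The independence hypothesis is indexed by the number of epochs through the
        output index; that index does not occur in this event, and \<open>order_refl\<close> selects
        one epoch.\<close>
      by (rule indep_past[OF t' order_refl, of "Some (s, Suc t)"]) (use s t level in \<open>auto simp: past_def\<close>)
  qed (rule finite_batches)+

  \<comment> \<open>\<open>past S (m - 1)\<close> collects all batches of the first S epochs, which
    determine every candidate for the output.\<close>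
  have fresh_out: "expectation (\<lambda>w. h w (a S w)) = expectation (\<lambda>w. (\<Sum>u\<in>{1..S} \<times> {0..<m}. h w u) / real (card ({1..S} \<times> {0..<m})))"
    if S: "S \<ge> 1" and h: "\<And>w w' u. agree S (m - 1) w w' \<Longrightarrow> h w u = h w' u" for S and h :: "'w \<Rightarrow> nat \<times> nat \<Rightarrow> real"
  proof (rule expectation_fresh_uniform[where J = "past S (m - 1)" and X = "\<lambda>(s, t). I s t" and K = "\<lambda>_. batches n b"])
    have t': "m - 1 < m" using sizes by simp
    show "finite (past S (m - 1))" by (rule past_fin[OF t'])
    show "uniform_rv P (batches n b) (case j of (s, t) \<Rightarrow> I s t)" if "j \<in> past S (m - 1)" for j
      by (rule past_rv[OF t' that])
    show "uniform_rv P ({1..S} \<times> {0..<m}) (a S)" by (rule out_rv[OF S])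
    show "h w u = h w' u" if "w \<in> space P" "w' \<in> space P"
      "\<And>j. j \<in> past S (m - 1) \<Longrightarrow> (case j of (s, t) \<Rightarrow> I s t) w = (case j of (s, t) \<Rightarrow> I s t) w'" for w w' u
      using that by (intro h) (auto simp: agree_def)
    show "prob ({w\<in>space P. a S w = u} \<inter> (space P \<inter> (\<Inter>j\<in>past S (m - 1). {w\<in>space P. (case j of (s, t) \<Rightarrow> I s t) w = c j}))) =
        prob {w\<in>space P. a S w = u} * prob (space P \<inter> (\<Inter>j\<in>past S (m - 1). {w\<in>space P. (case j of (s, t) \<Rightarrow> I s t) w = c j}))" for c u
      by (rule indep_past[OF t' S, of None]) (use level in auto)
  qed (simp_all add: finite_batches)

  \<comment> \<open>Transport on \<Omega> and the path of an epoch\<close>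
  have ball: "normal_ball A g x \<rho>" if "x \<in> \<Omega>" for x
    using retractive[OF that] \<rho> by unfold_locales (auto simp: R)
  have inv: "exp_inv A g \<rho> x y \<in> exp_dom A g x" "R x (exp_inv A g \<rho> x y) = y" if "x \<in> \<Omega>" "y \<in> \<Omega>" for x y
  proof -
    have y: "y \<in> R x ` tball g x \<rho>" using retractive[OF that(1)] that(2) by blast
    show "exp_inv A g \<rho> x y \<in> exp_dom A g x"
      using inv_into_into[OF y] retractive[OF that(1)] unfolding exp_inv_def R by blast
    show "R x (exp_inv A g \<rho> x y) = y" using f_inv_into_f[OF y] unfolding exp_inv_def R .
  qed
  have iso: "g y (\<Gamma> x y \<xi>) (\<Gamma> x y \<zeta>) = g x \<xi> \<zeta>" if "x \<in> \<Omega>" "y \<in> \<Omega>" for x y \<xi> \<zeta>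
    using transport_isometric[OF inv(1)[OF that], of \<xi> \<zeta>] inv(2)[OF that]
    by (simp add: \<Gamma> \<T> par_transport_between_def)
  have lin: "linear (\<Gamma> x y)" if "x \<in> \<Omega>" "y \<in> \<Omega>" for x y
    by (rule isometry_linear) (rule iso[OF that])
  have G_mean: "G x = (1 / real n) *\<^sub>R (\<Sum>i\<in>{1..n}. grad A g (f i) x)" for x
    unfolding G_def F using C1 by (intro grad_average) (auto simp: F)
  have grad_N: "g x (grad A g (f i) x) (grad A g (f i) x) \<le> N\<^sup>2" if "x \<in> \<Omega>" "i \<in> {1..n}" for x i
    unfolding tnorm_sq[symmetric] using N(2)[OF that] by (intro power_mono) (auto simp: tnorm_def g_nonneg)

  define v where "v s t w = g (\<omega> s t w) (V s t w) (V s t w)" for s t w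
  define \<gamma> where "\<gamma> s t w = g (\<omega> s t w) (G (\<omega> s t w)) (G (\<omega> s t w))" for s t w
  define e where "e s t w = g (\<omega> s t w) (V s t w - G (\<omega> s t w)) (V s t w - G (\<omega> s t w))" for s t w
  define \<sigma> where "\<sigma> s = (1 - \<phi> s)\<^sup>2 + (\<psi> s)\<^sup>2" for s

  have step_in: "\<omega> s t w \<in> \<Omega>" "- C\<alpha> *\<^sub>R V s t w \<in> exp_dom A g (\<omega> s t w)"
    if "s \<ge> 1" "t < m" "w \<in> space P" for s t w
    using iterates[OF that(1) _ that(3), of t] segments[OF that, of 1] that(2) by auto

  \<comment> \<open>The normal ball is centred at the newest point, since the Lipschitz hypothesis
    is applied with that point as x; earlier points of the epoch are compared with this fixed
    centre.\<close>
  have path: "tnorm g p (exp_inv A g \<rho> p (\<omega> s 0 w)) \<le> C\<alpha> * (\<Sum>j\<le>t. tnorm g (\<omega> s j w) (V s j w))"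
    if s: "s \<ge> 1" and t: "t < m" and w: "w \<in> space P" and p: "p = \<omega> s (Suc t) w" for s t w p
  proof -
    have p\<Omega>: "p \<in> \<Omega>" using iterates[OF s _ w, of "Suc t"] t p by simp
    interpret normal_ball A g p \<rho> by (rule ball[OF p\<Omega>])
    have step: "tnorm g p (exp_inv A g \<rho> p (\<omega> s j w)) \<le> tnorm g p (exp_inv A g \<rho> p (\<omega> s (Suc j) w)) + C\<alpha> * tnorm g (\<omega> s j w) (V s j w)"
      if j: "j \<le> t" for j
    proof -
      have j': "j < m" using j t by simp
      \<comment> \<open>The segment condition keeps the whole step inside \<Omega>, and \<Omega>
        lies in the normal ball of each of its points.\<close>
      have "exp_map A g (\<omega> s j w) (\<tau> *\<^sub>R (- C\<alpha> *\<^sub>R V s j w)) \<in> E ` B" if "\<tau> \<in> {0..1}" for \<tau>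
        using segments[OF s j' w, of \<tau>] that retractive[OF p\<Omega>] by (auto simp: R)
      from exp_inv_step[OF step_in(2)[OF s j' w] this]
      have "\<bar>tnorm g p (exp_inv A g \<rho> p (\<omega> s (Suc j) w)) - tnorm g p (exp_inv A g \<rho> p (\<omega> s j w))\<bar>
          \<le> tnorm g (\<omega> s j w) (- C\<alpha> *\<^sub>R V s j w)"
        by (simp add: \<omega>_Suc[OF s w] R)
      also have "\<dots> = C\<alpha> * tnorm g (\<omega> s j w) (V s j w)"
        using step(1) by (simp add: tnorm_def g_simps real_sqrt_mult)
      finally show ?thesis by linarith
    qed
    \<comment> \<open>k counts steps back from p, whose own inverse exponential is 0, to the start
      of the epoch at k = t + 1.\<close>
    have "tnorm g p (exp_inv A g \<rho> p (\<omega> s (Suc t - k) w)) \<le> C\<alpha> * (\<Sum>j\<in>{Suc t - k..t}. tnorm g (\<omega> s j w) (V s j w))"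
      if "k \<le> Suc t" for k
      using that
    proof (induction k)
      case 0
      then show ?case using exp_inv_self by (simp add: p[symmetric] tnorm_def g_simps)
    next
      case (Suc k)
      let ?j = "t - k"
      have j: "Suc t - k = Suc ?j" "Suc t - Suc k = ?j" "?j \<le> t" using Suc.prems by auto
      have set: "{?j..t} = insert ?j {Suc ?j..t}" using j(3) by auto
      have "tnorm g p (exp_inv A g \<rho> p (\<omega> s (Suc ?j) w)) \<le> C\<alpha> * (\<Sum>j\<in>{Suc ?j..t}. tnorm g (\<omega> s j w) (V s j w))"
        using Suc j by simp
      then show ?case unfolding j(2) using step[OF j(3)] by (simp add: set distrib_left)
    qed
    from this[of "Suc t"] show ?thesis by (simp add: atMost_atLeast0)
  qed

  \<comment> \<open>Error of one direction, averaged over the batch\<close>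
  have one_step: "(\<Sum>J\<in>batches n b.
        g q (rshg_direction g \<Gamma> G H \<mu> (\<phi> s) (\<psi> s) J (\<omega> s 0 w) (\<omega> s t w) (V s t w) q - G q)
            (rshg_direction g \<Gamma> G H \<mu> (\<phi> s) (\<psi> s) J (\<omega> s 0 w) (\<omega> s t w) (V s t w) q - G q)) / real (card (batches n b))
      \<le> 3 * (M\<^sup>2 * C\<alpha>\<^sup>2 * real (Suc t) * (\<Sum>j\<le>t. v s j w) + \<sigma> s * N\<^sup>2) + (\<psi> s)\<^sup>2 * e s t w"
    if s: "s \<ge> 1" and t: "Suc t < m" and w: "w \<in> space P" and q: "q = \<omega> s (Suc t) w" for s t w q
  proof -
    let ?o = "\<omega> s 0 w" and ?p = "\<omega> s t w" and ?V = "V s t w"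
    have in\<Omega>: "?o \<in> \<Omega>" "?p \<in> \<Omega>" "q \<in> \<Omega>" using iterates[OF s _ w] t by (auto simp: q)
    \<comment> \<open>The adaptive weight depends on the points and on the previous direction but
      not on J, so it is a constant in the average over batches.\<close>
    define \<psi>' where "\<psi>' = adaptive_weight g \<Gamma> G \<mu> (\<psi> s) ?p ?V q"
    have \<psi>': "0 \<le> \<psi>'" "\<psi>' \<le> \<psi> s" using weights[OF s] \<mu> by (auto simp: \<psi>'_def adaptive_weight_def Let_def)
    define mean where "mean z = (1 / real n) *\<^sub>R (\<Sum>i\<in>{1..n}. z i)" for z :: "nat \<Rightarrow> 'e"
    define batch where "batch J z = (1 / real b) *\<^sub>R (\<Sum>i\<in>J. z i)" for J and z :: "nat \<Rightarrow> 'e"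
    let ?To = "\<Gamma> ?o q" and ?T = "\<Gamma> ?p q"
    note lin0 = lin[OF in\<Omega>(1,3)] and lin1 = lin[OF in\<Omega>(2,3)]
    let ?a = "\<lambda>i. grad A g (f i) q" and ?b = "\<lambda>i. ?To (grad A g (f i) ?o)" and ?c = "\<lambda>i. ?T (grad A g (f i) ?p)"
    let ?d = "?T (?V - G ?p)"
    have H: "H J x = batch J (\<lambda>i. grad A g (f i) x)" if "J \<in> batches n b" for J x
      using that by (simp add: H_def batch_grad_def batch_def batches_def)
    have Tmean: "?To (G ?o) = mean ?b" "?T (G ?p) = mean ?c"
      by (simp_all add: G_mean mean_def linear_scale[OF lin0] linear_scale[OF lin1] linear_sum[OF lin0] linear_sum[OF lin1])
    have Tbatch: "?To (batch J z) = batch J (\<lambda>i. ?To (z i))" "?T (batch J z) = batch J (\<lambda>i. ?T (z i))" for J z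
      by (simp_all add: batch_def linear_scale[OF lin0] linear_scale[OF lin1] linear_sum[OF lin0] linear_sum[OF lin1])
    \<comment> \<open>Linear transports commute with batch and full means. Writing V as
      \<open>G p\<close> plus its error completes the third centred mean and leaves the transported
      error \<open>?d\<close>.\<close>
    have err: "rshg_direction g \<Gamma> G H \<mu> (\<phi> s) (\<psi> s) J ?o ?p ?V q - G q =
        (batch J ?a - mean ?a) - \<phi> s *\<^sub>R (batch J ?b - mean ?b) - \<psi>' *\<^sub>R (batch J ?c - mean ?c) + \<psi>' *\<^sub>R ?d"
      if J: "J \<in> batches n b" for J
    proof -
      have Gq: "G q = mean ?a" by (simp add: G_mean mean_def)
      show ?thesis
        unfolding rshg_direction_def Let_def \<psi>'_def[symmetric] H[OF J] Gq
          linear_diff[OF lin0] linear_diff[OF lin1] Tmean Tbatch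
        by (simp add: algebra_simps)
    qed
    define \<xi> where "\<xi> = exp_inv A g \<rho> q ?o"
    have "(\<Sum>i\<in>{1..n}. g q (?a i - ?b i) (?a i - ?b i)) / real n \<le> M\<^sup>2 * (tnorm g q \<xi>)\<^sup>2"
      using grad_lipschitz[OF in\<Omega>(3,1) inv(1)[OF in\<Omega>(3,1)]] inv(2)[OF in\<Omega>(3,1)]
      by (simp add: \<xi>_def tnorm_sq)
    also have "\<dots> \<le> M\<^sup>2 * (C\<alpha>\<^sup>2 * (real (Suc t) * (\<Sum>j\<le>t. v s j w)))"
    proof (rule mult_left_mono)
      have "(tnorm g q \<xi>)\<^sup>2 \<le> (C\<alpha> * (\<Sum>j\<le>t. tnorm g (\<omega> s j w) (V s j w)))\<^sup>2"
        unfolding \<xi>_def using path[OF s _ w q] t by (intro power_mono) (auto simp: tnorm_def g_nonneg)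
      \<comment> \<open>Cauchy-Schwarz over the t + 1 steps of the path.\<close>
      also have "\<dots> \<le> C\<alpha>\<^sup>2 * ((\<Sum>j\<le>t. (tnorm g (\<omega> s j w) (V s j w))\<^sup>2) * real (card {..t}))"
        unfolding power_mult_distrib by (intro mult_left_mono sum_squared_le_sum_of_squares) simp
      finally show "(tnorm g q \<xi>)\<^sup>2 \<le> C\<alpha>\<^sup>2 * (real (Suc t) * (\<Sum>j\<le>t. v s j w))"
        by (simp add: tnorm_sq v_def mult.commute)
    qed simp
    also have "\<dots> = M\<^sup>2 * C\<alpha>\<^sup>2 * real (Suc t) * (\<Sum>j\<le>t. v s j w)" by (simp only: mult.assoc)
    finally have K: "(\<Sum>i\<in>{1..n}. g q (?a i - ?b i) (?a i - ?b i)) / real n \<le> M\<^sup>2 * C\<alpha>\<^sup>2 * real (Suc t) * (\<Sum>j\<le>t. v s j w)" .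
    have cN: "g q (?c i) (?c i) \<le> N\<^sup>2" if "i \<in> {1..n}" for i
      using grad_N[OF in\<Omega>(2) that] by (simp add: iso[OF in\<Omega>(2,3)])
    have d: "g q ?d ?d = e s t w" by (simp add: iso[OF in\<Omega>(2,3)] e_def)
    have \<phi>: "0 \<le> \<phi> s" "\<phi> s \<le> 1" using weights[OF s] by auto
    show ?thesis
      unfolding d[symmetric] \<sigma>_def
      by (rule direction_error[OF sizes(2,3) \<phi> \<psi>' K grad_N[OF in\<Omega>(3)] cN mean_def batch_def err])
  qed

  \<comment> \<open>Expected errors over an epoch\<close>
  have int_v: "integrable P (v s j)" and int_\<gamma>: "integrable P (\<gamma> s j)" and int_e: "integrable P (e s j)"
    and int_F: "integrable P (\<lambda>w. F (\<omega> s j w))" and int_F': "integrable P (\<lambda>w. F (\<omega> s (Suc j) w))"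
    if "s \<ge> 1" "j < m" for s j
    by (rule integ[OF that(2), of s], simp add: v_def \<gamma>_def e_def dep[OF that])+

  define Ev where "Ev s t = expectation (v s t)" for s t
  define E\<gamma> where "E\<gamma> s t = expectation (\<gamma> s t)" for s t
  define Ee where "Ee s t = expectation (e s t)" for s t
  define EF where "EF s t = expectation (\<lambda>w. F (\<omega> s t w))" for s t
  have nonneg: "Ev s t \<ge> 0" "E\<gamma> s t \<ge> 0" "Ee s t \<ge> 0" for s t
    unfolding Ev_def E\<gamma>_def Ee_def v_def \<gamma>_def e_def by (intro integral_nonneg_AE AE_I2 g_nonneg)+

  have error_rec: "Ee s (Suc t) \<le> 3 * (M\<^sup>2 * C\<alpha>\<^sup>2 * real (Suc t) * (\<Sum>j\<le>t. Ev s j) + \<sigma> s * N\<^sup>2) + (\<psi> s)\<^sup>2 * Ee s t"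
    if s: "s \<ge> 1" and t: "Suc t < m" for s t
  proof -
    have t': "t < m" using t by simp
    define h where "h w J = (let q = \<omega> s (Suc t) w; D = rshg_direction g \<Gamma> G H \<mu> (\<phi> s) (\<psi> s) J (\<omega> s 0 w) (\<omega> s t w) (V s t w) q - G q
      in g q D D)" for w J
    have h_dep: "h w J = h w' J" if "agree s t w w'" for w w' J
      using dep[OF s t' that] dep_le[OF s t' that, of 0] by (simp add: h_def)
    have "Ee s (Suc t) = expectation (\<lambda>w. h w (I s (Suc t) w))"
      unfolding Ee_def by (intro Bochner_Integration.integral_cong) (simp_all add: e_def h_def Let_def V_Suc[OF s])
    \<comment> \<open>The current point and previous direction are functions of
      \<open>past s t\<close>, so the batch of step t + 1 may be averaged out.\<close>
    also have "\<dots> = expectation (\<lambda>w. (\<Sum>J\<in>batches n b. h w J) / real (card (batches n b)))"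
      by (rule fresh_batch[OF s t h_dep])
    also have "\<dots> \<le> expectation (\<lambda>w. 3 * (M\<^sup>2 * C\<alpha>\<^sup>2 * real (Suc t) * (\<Sum>j\<le>t. v s j w) + \<sigma> s * N\<^sup>2) + (\<psi> s)\<^sup>2 * e s t w)"
    proof (rule integral_mono)
      show "integrable P (\<lambda>w. (\<Sum>J\<in>batches n b. h w J) / real (card (batches n b)))"
        by (rule integ[OF t', of s]) (simp add: h_dep cong: sum.cong)
      show "integrable P (\<lambda>w. 3 * (M\<^sup>2 * C\<alpha>\<^sup>2 * real (Suc t) * (\<Sum>j\<le>t. v s j w) + \<sigma> s * N\<^sup>2) + (\<psi> s)\<^sup>2 * e s t w)"
        using int_v[OF s] int_e[OF s] t by (intro Bochner_Integration.integrable_add integrable_mult_right Bochner_Integration.integrable_sum) auto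
      show "(\<Sum>J\<in>batches n b. h w J) / real (card (batches n b)) \<le>
          3 * (M\<^sup>2 * C\<alpha>\<^sup>2 * real (Suc t) * (\<Sum>j\<le>t. v s j w) + \<sigma> s * N\<^sup>2) + (\<psi> s)\<^sup>2 * e s t w" if "w \<in> space P" for w
        using one_step[OF s t that refl] by (simp add: h_def Let_def)
    qed
    also have "\<dots> = 3 * (M\<^sup>2 * C\<alpha>\<^sup>2 * real (Suc t) * (\<Sum>j\<le>t. Ev s j) + \<sigma> s * N\<^sup>2) + (\<psi> s)\<^sup>2 * Ee s t"
    proof -
      have iv: "integrable P (\<lambda>w. v s j w)" if "j \<in> {..t}" for j using int_v[OF s, of j] t that by simp
      have ie: "integrable P (\<lambda>w. e s t w)" using int_e[OF s t'] .
      have "expectation (\<lambda>w. \<Sum>j\<le>t. v s j w) = (\<Sum>j\<le>t. Ev s j)"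
        unfolding Ev_def by (rule Bochner_Integration.integral_sum[OF iv])
      then show ?thesis using ie Bochner_Integration.integrable_sum[of "{..t}" P "\<lambda>j w. v s j w", OF iv]
        by (simp add: Ee_def prob_space)
    qed
    finally show ?thesis .
  qed

  have error_sum: "(\<Sum>t<m. Ee s t) \<le> \<nu> * C\<alpha>\<^sup>2 * (\<Sum>t<m. Ev s t) + 4 * (real m)\<^sup>2 * (\<sigma> s * N\<^sup>2)" if s: "s \<ge> 1" for s
  proof -
    have "(\<Sum>t<m. Ee s t) \<le> 4 * real m ^ 3 * (M\<^sup>2 * C\<alpha>\<^sup>2) * (\<Sum>j<m. Ev s j) + 4 * (real m)\<^sup>2 * (\<sigma> s * N\<^sup>2)"
    proof (rule error_recursion_sum[where \<psi> = "\<psi> s"])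
      \<comment> \<open>An epoch starts with the full gradient, so no error is inherited from the
        epoch before.\<close>
      have "Ee s 0 = expectation (\<lambda>_. 0)"
        unfolding Ee_def by (intro Bochner_Integration.integral_cong) (simp_all add: e_def V_0[OF s] g_simps)
      then show "Ee s 0 = 0" by simp
    qed (use error_rec[OF s] nonneg weights[OF s] in \<open>auto simp: \<sigma>_def\<close>)
    then show ?thesis by (simp add: \<nu> mult.assoc)
  qed

  \<comment> \<open>Descent over an epoch\<close>
  have descent_step: "EF s (Suc t) \<le> EF s t + C\<alpha> / 2 * (Ee s t - E\<gamma> s t - Ev s t) + L / 2 * (C\<alpha>\<^sup>2 * Ev s t)"
    if s: "s \<ge> 1" and t: "t < m" for s t
  proof -
    have pw: "F (\<omega> s (Suc t) w) \<le> F (\<omega> s t w) + C\<alpha> / 2 * (e s t w - \<gamma> s t w - v s t w) + L / 2 * (C\<alpha>\<^sup>2 * v s t w)"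
      if w: "w \<in> space P" for w
    proof -
      let ?p = "\<omega> s t w"
      have "F (\<omega> s (Suc t) w) \<le> F ?p + g ?p (G ?p) (- C\<alpha> *\<^sub>R V s t w) + L / 2 * (tnorm g ?p (- C\<alpha> *\<^sub>R V s t w))\<^sup>2"
        unfolding G_def
        by (rule descent[OF step_in(1)[OF s t w] _ step_in(2)[OF s t w] \<omega>_Suc[OF s w]])
          (use iterates[OF s _ w, of "Suc t"] t in simp)
      moreover have "(tnorm g ?p (- C\<alpha> *\<^sub>R V s t w))\<^sup>2 = C\<alpha>\<^sup>2 * v s t w"
        unfolding tnorm_sq v_def by (simp add: g_simps power2_eq_square)
      \<comment> \<open>Polarisation: -2 <G, V> = |V - G|^2 - |G|^2 - |V|^2. It brings in the error
        and supplies the negative multiple of |V|^2 that absorbs it.\<close>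
      moreover have "g ?p (G ?p) (- C\<alpha> *\<^sub>R V s t w) = C\<alpha> / 2 * (e s t w - \<gamma> s t w - v s t w)"
        using g_commute[of ?p "V s t w" "G ?p"] by (simp add: e_def \<gamma>_def v_def g_simps)
      ultimately show ?thesis by simp
    qed
    have "EF s (Suc t) \<le> expectation (\<lambda>w. F (\<omega> s t w) + C\<alpha> / 2 * (e s t w - \<gamma> s t w - v s t w) + L / 2 * (C\<alpha>\<^sup>2 * v s t w))"
      unfolding EF_def using int_F[OF s t] int_F'[OF s t] int_e[OF s t] int_\<gamma>[OF s t] int_v[OF s t] pw
      by (intro integral_mono Bochner_Integration.integrable_add integrable_mult_right Bochner_Integration.integrable_diff) auto
    also have "\<dots> = EF s t + C\<alpha> / 2 * (Ee s t - E\<gamma> s t - Ev s t) + L / 2 * (C\<alpha>\<^sup>2 * Ev s t)"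
    proof -
      have i: "integrable P (\<lambda>w. F (\<omega> s t w))" "integrable P (\<lambda>w. e s t w)" "integrable P (\<lambda>w. \<gamma> s t w)" "integrable P (\<lambda>w. v s t w)"
        using int_F[OF s t] int_e[OF s t] int_\<gamma>[OF s t] int_v[OF s t] by simp_all
      show ?thesis using i by (simp add: EF_def Ee_def E\<gamma>_def Ev_def)
    qed
    finally show ?thesis .
  qed

  have epoch_descent: "C\<alpha> / 2 * (\<Sum>t<m. E\<gamma> s t) \<le> EF s 0 - EF s m + C\<alpha> / 2 * (4 * (real m)\<^sup>2 * (\<sigma> s * N\<^sup>2))"
    if s: "s \<ge> 1" for s
  proof -
    let ?W = "\<Sum>t<m. Ev s t"
    have W: "?W \<ge> 0" using nonneg by (intro sum_nonneg) auto
    have "EF s m - EF s 0 = (\<Sum>t<m. EF s (Suc t) - EF s t)" by (rule sum_lessThan_telescope[symmetric])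
    also have "\<dots> \<le> (\<Sum>t<m. C\<alpha> / 2 * (Ee s t - E\<gamma> s t - Ev s t) + L / 2 * (C\<alpha>\<^sup>2 * Ev s t))"
    proof (rule sum_mono)
      fix t assume "t \<in> {..<m}"
      then show "EF s (Suc t) - EF s t \<le> C\<alpha> / 2 * (Ee s t - E\<gamma> s t - Ev s t) + L / 2 * (C\<alpha>\<^sup>2 * Ev s t)"
        using descent_step[OF s, of t] by simp
    qed
    also have "\<dots> = C\<alpha> / 2 * ((\<Sum>t<m. Ee s t) - (\<Sum>t<m. E\<gamma> s t) - ?W) + L / 2 * (C\<alpha>\<^sup>2 * ?W)"
      by (simp only: sum.distrib sum_subtractf sum_distrib_left[symmetric])
    also have "\<dots> \<le> C\<alpha> / 2 * ((\<nu> * C\<alpha>\<^sup>2 * ?W + 4 * (real m)\<^sup>2 * (\<sigma> s * N\<^sup>2)) - (\<Sum>t<m. E\<gamma> s t) - ?W) + L / 2 * (C\<alpha>\<^sup>2 * ?W)"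
      using error_sum[OF s] step(1) by (intro add_right_mono mult_left_mono diff_right_mono) auto
    also have "\<dots> = C\<alpha> / 2 * ((\<nu> * C\<alpha>\<^sup>2 + L * C\<alpha> - 1) * ?W) + C\<alpha> / 2 * (4 * (real m)\<^sup>2 * (\<sigma> s * N\<^sup>2)) - C\<alpha> / 2 * (\<Sum>t<m. E\<gamma> s t)"
      by (simp add: algebra_simps power2_eq_square)
    \<comment> \<open>The coefficient of the summed squared directions is nonpositive exactly by the
      step size restriction.\<close>
    also have "C\<alpha> / 2 * ((\<nu> * C\<alpha>\<^sup>2 + L * C\<alpha> - 1) * ?W) \<le> 0"
    proof -
      have "\<nu> \<ge> 0" by (simp add: \<nu>)
      from step_size_bound[OF L this step] show ?thesis
        using W step(1) by (intro mult_nonneg_nonpos mult_nonpos_nonneg) auto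
    qed
    finally show ?thesis by linarith
  qed

  \<comment> \<open>Summation over the epochs\<close>
  have EF_next: "EF (Suc s) 0 = EF s m" if "s \<ge> 1" for s
    unfolding EF_def by (intro Bochner_Integration.integral_cong) (simp_all add: \<omega>_next[OF that])
  have EF_init: "EF 1 0 = F \<omega>init"
  proof -
    have "EF 1 0 = expectation (\<lambda>_. F \<omega>init)"
      unfolding EF_def by (intro Bochner_Integration.integral_cong) (simp_all only: \<omega>_init)
    then show ?thesis by (simp add: prob_space)
  qed
  have EF_opt: "F \<omega>opt \<le> EF s m" if s: "s \<ge> 1" for s
  proof -
    obtain k where k: "m = Suc k" using sizes(4) by (cases m) auto
    have "integrable P (\<lambda>w. F (\<omega> s m w))" using int_F'[OF s, of k] by (simp add: k)
    then have "expectation (\<lambda>_. F \<omega>opt) \<le> EF s m" unfolding EF_def using minimizer by (intro integral_mono) auto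
    then show ?thesis by (simp add: prob_space)
  qed
  \<comment> \<open>Epochs are numbered from 1, hence the shift by \<open>Suc\<close>. The
    telescoped sum ends at the start of epoch S + 1, which is the output of epoch S.\<close>
  have total: "C\<alpha> / 2 * (\<Sum>s<S. \<Sum>t<m. E\<gamma> (Suc s) t) \<le> F \<omega>init - F \<omega>opt + C\<alpha> / 2 * (4 * (real m)\<^sup>2 * N\<^sup>2 * (\<Sum>s<S. \<sigma> (Suc s)))"
    if S: "S \<ge> 1" for S
  proof -
    have "C\<alpha> / 2 * (\<Sum>s<S. \<Sum>t<m. E\<gamma> (Suc s) t) = (\<Sum>s<S. C\<alpha> / 2 * (\<Sum>t<m. E\<gamma> (Suc s) t))"
      by (rule sum_distrib_left)
    also have "\<dots> \<le> (\<Sum>s<S. (EF (Suc s) 0 - EF (Suc (Suc s)) 0) + C\<alpha> / 2 * (4 * (real m)\<^sup>2 * (\<sigma> (Suc s) * N\<^sup>2)))"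
      using epoch_descent EF_next by (intro sum_mono) auto
    also have "\<dots> = (\<Sum>s<S. EF (Suc s) 0 - EF (Suc (Suc s)) 0) + C\<alpha> / 2 * (4 * (real m)\<^sup>2 * N\<^sup>2 * (\<Sum>s<S. \<sigma> (Suc s)))"
      unfolding sum.distrib by (simp add: sum_distrib_left mult_ac)
    also have "(\<Sum>s<S. EF (Suc s) 0 - EF (Suc (Suc s)) 0) = EF 1 0 - EF (Suc S) 0"
      using sum_lessThan_telescope'[of "\<lambda>s. EF (Suc s) 0" S] by simp
    also have "\<dots> \<le> F \<omega>init - F \<omega>opt"
      using EF_opt[OF S] by (simp add: EF_next[OF S] EF_init[unfolded One_nat_def])
    finally show ?thesis by simp
  qed

  \<comment> \<open>The random output\<close>
  define \<E> where "\<E> S = expectation (\<lambda>w. case a S w of (s, t) \<Rightarrow> (tnorm g (\<omega> s t w) (grad A g F (\<omega> s t w)))\<^sup>2)" for S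
  define c where "c = 2 / (real m * C\<alpha>) * (F \<omega>init - F \<omega>opt)
             + 4 * real m * N\<^sup>2 * (\<Sum>s. (1 - \<phi> (Suc s))\<^sup>2 + (\<psi> (Suc s))\<^sup>2)"
  have m0: "real m > 0" using sizes by simp
  have \<E>_eq: "\<E> S = (\<Sum>s<S. \<Sum>t<m. E\<gamma> (Suc s) t) / (real S * real m)" if S: "S \<ge> 1" for S
  proof -
    \<comment> \<open>Cut off outside the index range, so that dependence on the past holds for
      every u, as the averaging lemma demands.\<close>
    define h where "h w u = (if u \<in> {1..S} \<times> {0..<m} then \<gamma> (fst u) (snd u) w else 0)" for w u
    have h_dep: "h w u = h w' u" if "agree S (m - 1) w w'" for w w' u
    proof (cases "u \<in> {1..S} \<times> {0..<m}")
      case True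
      then obtain s t where u: "u = (s, t)" "1 \<le> s" "s \<le> S" "t < m" by auto
      have "agree s t w w'" by (rule past_mono[OF that]) (use u in \<open>auto simp: past_def\<close>)
      then show ?thesis using dep[OF u(2,4), of w w'] by (simp add: h_def u(1) \<gamma>_def)
    next
      case False
      then show ?thesis by (simp add: h_def del: mem_Sigma_iff)
    qed
    have "\<E> S = expectation (\<lambda>w. h w (a S w))"
      unfolding \<E>_def
    proof (intro Bochner_Integration.integral_cong refl)
      fix w assume "w \<in> space P"
      then have "a S w \<in> {1..S} \<times> {0..<m}" by (rule uniform_rv_in[OF out_rv[OF S]])
      then show "(case a S w of (s, t) \<Rightarrow> (tnorm g (\<omega> s t w) (grad A g F (\<omega> s t w)))\<^sup>2) = h w (a S w)"
        unfolding h_def by (simp add: tnorm_sq \<gamma>_def G_def split: prod.splits)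
    qed
    also have "\<dots> = expectation (\<lambda>w. (\<Sum>u\<in>{1..S} \<times> {0..<m}. h w u) / real (card ({1..S} \<times> {0..<m})))"
      by (rule fresh_out[OF S h_dep])
    also have "\<dots> = expectation (\<lambda>w. (\<Sum>s\<in>{1..S}. \<Sum>t\<in>{0..<m}. \<gamma> s t w) / (real S * real m))"
    proof -
      have "(\<Sum>u\<in>{1..S} \<times> {0..<m}. h w u) = (\<Sum>s\<in>{1..S}. \<Sum>t\<in>{0..<m}. \<gamma> s t w)" for w
        unfolding sum.cartesian_product by (rule sum.cong) (auto simp: h_def)
      then show ?thesis by simp
    qed
    also have "\<dots> = (\<Sum>s\<in>{1..S}. \<Sum>t\<in>{0..<m}. E\<gamma> s t) / (real S * real m)"
    proof -
      have i: "integrable P (\<lambda>w. \<gamma> s t w)" if "s \<in> {1..S}" "t \<in> {0..<m}" for s t using int_\<gamma>[of s t] that by simp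
      have "expectation (\<lambda>w. \<Sum>t\<in>{0..<m}. \<gamma> s t w) = (\<Sum>t\<in>{0..<m}. E\<gamma> s t)" if "s \<in> {1..S}" for s
        unfolding E\<gamma>_def by (rule Bochner_Integration.integral_sum[OF i[OF that]])
      moreover have "expectation (\<lambda>w. \<Sum>s\<in>{1..S}. \<Sum>t\<in>{0..<m}. \<gamma> s t w) = (\<Sum>s\<in>{1..S}. expectation (\<lambda>w. \<Sum>t\<in>{0..<m}. \<gamma> s t w))"
        by (intro Bochner_Integration.integral_sum Bochner_Integration.integrable_sum i)
      ultimately show ?thesis by simp
    qed
    also have "(\<Sum>s\<in>{1..S}. \<Sum>t\<in>{0..<m}. E\<gamma> s t) = (\<Sum>s<S. \<Sum>t<m. E\<gamma> (Suc s) t)"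
      by (simp add: sum.atLeast1_atMost_eq atLeast0LessThan)
    finally show ?thesis .
  qed
  have bound: "\<E> S \<le> c * (1 / real S)" if S: "S \<ge> 1" for S
  proof -
    have "(\<Sum>s<S. \<sigma> (Suc s)) \<le> (\<Sum>s. \<sigma> (Suc s))"
      using summable by (intro sum_le_suminf) (auto simp: \<sigma>_def)
    then have "4 * (real m)\<^sup>2 * N\<^sup>2 * (\<Sum>s<S. \<sigma> (Suc s)) \<le> 4 * (real m)\<^sup>2 * N\<^sup>2 * (\<Sum>s. \<sigma> (Suc s))"
      by (intro mult_left_mono) auto
    then have "C\<alpha> / 2 * (4 * (real m)\<^sup>2 * N\<^sup>2 * (\<Sum>s<S. \<sigma> (Suc s))) \<le> C\<alpha> / 2 * (4 * (real m)\<^sup>2 * N\<^sup>2 * (\<Sum>s. \<sigma> (Suc s)))"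
      by (rule mult_left_mono) (use step(1) in simp)
    with total[OF S] have "C\<alpha> / 2 * (\<Sum>s<S. \<Sum>t<m. E\<gamma> (Suc s) t) \<le> F \<omega>init - F \<omega>opt + C\<alpha> / 2 * (4 * (real m)\<^sup>2 * N\<^sup>2 * (\<Sum>s. \<sigma> (Suc s)))"
      by linarith
    also have "\<dots> = C\<alpha> / 2 * (real m * c)"
      using m0 step(1) unfolding c_def \<sigma>_def by (simp add: field_simps power2_eq_square)
    finally have "(\<Sum>s<S. \<Sum>t<m. E\<gamma> (Suc s) t) \<le> real m * c" using step(1) by simp
    then show ?thesis unfolding \<E>_eq[OF S] using m0 S by (simp add: field_simps)
  qed
  have \<E>_nonneg: "\<E> S \<ge> 0" for S
    unfolding \<E>_def by (intro integral_nonneg_AE AE_I2) (auto split: prod.splits)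
  have c_eq: "(\<lambda>S. 2 / (real m * real S * C\<alpha>) * (F \<omega>init - F \<omega>opt)
             + 4 * real m * N\<^sup>2 / real S * (\<Sum>s. (1 - \<phi> (Suc s))\<^sup>2 + (\<psi> (Suc s))\<^sup>2)) = (\<lambda>S. c * (1 / real S))"
    by (rule ext) (simp add: c_def add_divide_distrib mult_ac)
  have bound_O: "(\<lambda>S. c * (1 / real S)) \<in> O(\<lambda>S. 1 / real S)"
    by (rule bigoI[of _ "\<bar>c\<bar>"]) (simp add: abs_mult)
  have "\<E> \<in> O(\<lambda>S. 1 / real S)"
  proof (rule bigoI[of _ "\<bar>c\<bar>"])
    show "\<forall>\<^sub>F S in sequentially. norm (\<E> S) \<le> \<bar>c\<bar> * norm (1 / real S)"
      using eventually_ge_at_top[of 1]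
    proof eventually_elim
      case (elim S)
      have "\<E> S \<le> c * (1 / real S)" by (rule bound[OF elim])
      \<comment> \<open>The absolute value spares a discussion of the sign of c; the other side of
        the estimate is the nonnegativity of \<E>.\<close>
      also have "\<dots> \<le> \<bar>c\<bar> * (1 / real S)" by (intro mult_right_mono) auto
      finally show ?case using \<E>_nonneg[of S] by simp
    qed
  qed
  with bound bound_O show ?thesis
    unfolding Let_def c_eq \<E>_def[abs_def] by blast
qed

end
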